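(* Let $(z,w)\in\mathbb{C}^n\times\mathbb{C}$ be the coordinates and, near the origin, let $M\subset\mathbb{C}^{n+1}$ be a submanifold of real codimension 2 given by $$w=\rho(z,\bar z)=Q(z,\bar z)+E(z,\bar z)=z^*Az+\overline{z^tBz}+z^tCz+E(z,\bar z),$$ where $\rho$ is real-analytic, $A,B,C$ are complex $n\times n$ matrices, $B$ and $C$ are symmetric, and $E$ is $O(\|z\|^3)$. Further suppose that $$\operatorname{rank}\begin{bmatrix}A^*\\ B\end{bmatrix}\geq 2 .$$ Then the following conditions are equivalent: (a) $M$ is flattenable, that is, there exists a holomorphic function near the origin with nonvanishing derivative that is real-valued on $M$. (b) The complex tangent bundle of $M$ has a real-valued nonconstant real-analytic first integral $g$ defined on $M$ whose second derivatives in terms of $z$ and $\bar z$ do not all vanish at the origin.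
   Context: Vectors $z\in\mathbb{C}^n$ are columns; $z^t$ is the transpose, $z^*$ the conjugate transpose, and $A^*$ the conjugate transpose of $A$. $\begin{bmatrix} A^* \\ B\end{bmatrix}$ is the $2n\times n$ matrix obtained by stacking $A^*$ on top of $B$. $\rho$ is complex-valued, not assumed real-valued. All statements are local at the origin ($M$ may be replaced by a smaller neighborhood of $0$ in $M$). $J$ denotes the complex structure of $\mathbb{C}^{n+1}$ and $T^cM=TM\cap J(TM)$ the complex tangent bundle. $M_{\mathit{CR}}\subset M$ is the set of CR points, i.e. the points near which $\dim T^c_pM$ is constant as $p\in M$ varies. A first integral of the complex tangent bundle is a function $g$ on $M$ that is constant on the integral curves of $T^cM$; in other words, $g$ is constant on the CR orbits of $M_{\mathit{CR}}$ (the sets of points of $M_{\mathit{CR}}$ reachable from a given point by finite concatenations of integral curves of vector fields on $M_{\mathit{CR}}$ with values in $T^cM$). Functions on $M$ are written as functions of $z,\bar z$ via the parametrization $z\mapsto(z,\rho(z,\bar z))$. *)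

theory Defs
  imports "HOL-Analysis.Analysis" "HOL-Library.Landau_Symbols"
begin

text \<open>
  The ambient space of dimension $n+1$ is the product type \<open>'n cspace\<close> with coordinates
  $(z,w)$; neither it nor \<open>complex^'n\<close> carries a complex vector space class, so complex
  linearity is expressed by means of the complex structure \<open>J\<close>.
\<close>

type_synonym 'n cspace = "(complex^'n) \<times> complex"

section \<open>Real-analytic and smooth maps\<close>

text \<open>
  The multi-indices are the functions \<open>Basis \<rightarrow>\<^sub>E UNIV\<close> with values in \<open>nat\<close>; unordered summability
  makes the power series absolutely convergent when the target is finite-dimensional.
\<close>

definition real_analytic_on :: "('a::euclidean_space \<Rightarrow> 'b::euclidean_space) \<Rightarrow> 'a set \<Rightarrow> bool" where
  "real_analytic_on f S \<longleftrightarrow>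
     (\<forall>x\<in>S. \<exists>r>0. \<exists>c :: ('a \<Rightarrow> nat) \<Rightarrow> 'b. \<forall>h. norm h < r \<longrightarrow>
        ((\<lambda>\<alpha>. (\<Prod>b\<in>Basis. (h \<bullet> b) ^ \<alpha> b) *\<^sub>R c \<alpha>) has_sum f (x + h)) (Basis \<rightarrow>\<^sub>E UNIV))"

text \<open>The following notion is meant for open \<open>U\<close> only.\<close>

primrec Ck_on :: "nat \<Rightarrow> ('a::euclidean_space \<Rightarrow> 'b::euclidean_space) \<Rightarrow> 'a set \<Rightarrow> bool" where
  "Ck_on 0 f U \<longleftrightarrow> continuous_on U f"
| "Ck_on (Suc k) f U \<longleftrightarrow>
     f differentiable_on U \<and> (\<forall>v. Ck_on k (\<lambda>x. frechet_derivative f (at x) v) U)"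

text \<open>
  Smoothness on an arbitrary subset: local extendability to a smooth map of the ambient space.
  On an embedded submanifold this is intrinsic smoothness.
\<close>

definition smooth_on :: "('a::euclidean_space \<Rightarrow> 'b::euclidean_space) \<Rightarrow> 'a set \<Rightarrow> bool" where
  "smooth_on f S \<longleftrightarrow>
     (\<forall>p\<in>S. \<exists>U h. open U \<and> p \<in> U \<and> (\<forall>k. Ck_on k h U) \<and> (\<forall>q\<in>S \<inter> U. h q = f q))"

section \<open>Wirtinger derivatives\<close>

definition dz :: "'n \<Rightarrow> (complex^'n::finite \<Rightarrow> complex) \<Rightarrow> complex^'n \<Rightarrow> complex" where
  "dz j f z = (frechet_derivative f (at z) (axis j 1)
               - \<i> * frechet_derivative f (at z) (axis j \<i>)) / 2"

definition dzbar :: "'n \<Rightarrow> (complex^'n::finite \<Rightarrow> complex) \<Rightarrow> complex^'n \<Rightarrow> complex" where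
  "dzbar j f z = (frechet_derivative f (at z) (axis j 1)
                  + \<i> * frechet_derivative f (at z) (axis j \<i>)) / 2"

definition second_derivatives_vanish :: "(complex^'n::finite \<Rightarrow> complex) \<Rightarrow> complex^'n \<Rightarrow> bool" where
  "second_derivatives_vanish f z \<longleftrightarrow>
     (\<forall>j k. dz j (dz k f) z = 0 \<and> dz j (dzbar k f) z = 0 \<and> dzbar j (dzbar k f) z = 0)"

section \<open>Complex structure, holomorphic functions, complex tangent spaces\<close>

definition J :: "'n::finite cspace \<Rightarrow> 'n cspace" where
  "J v = (\<i> *s fst v, \<i> * snd v)"

definition holomorphic_sev :: "('n::finite cspace \<Rightarrow> complex) \<Rightarrow> ('n cspace) set \<Rightarrow> bool" where
  "holomorphic_sev F U \<longleftrightarrow>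
     (\<forall>p\<in>U. F differentiable (at p) \<and>
        (\<forall>v. frechet_derivative F (at p) (J v) = \<i> * frechet_derivative F (at p) v))"

text \<open>Tangent vectors of an embedded submanifold as velocities of curves in it.\<close>

definition tangent_space :: "'a::real_normed_vector set \<Rightarrow> 'a \<Rightarrow> 'a set" where
  "tangent_space M p =
     {v. \<exists>\<gamma>. \<gamma> 0 = p \<and> (\<gamma> has_vector_derivative v) (at 0) \<and> (\<forall>\<^sub>F t in nhds 0. \<gamma> t \<in> M)}"

definition complex_tangent_space ::
  "('n::finite cspace) set \<Rightarrow> 'n cspace \<Rightarrow> ('n cspace) set" where
  "complex_tangent_space M p = tangent_space M p \<inter> J ` tangent_space M p"

definition CR_points :: "('n::finite cspace) set \<Rightarrow> ('n cspace) set" where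
  "CR_points M =
     {p \<in> M. \<exists>U. open U \<and> p \<in> U \<and>
        (\<forall>q\<in>M \<inter> U. dim (complex_tangent_space M q) = dim (complex_tangent_space M p))}"

section \<open>CR orbits and first integrals\<close>

definition CR_vector_field ::
  "('n::finite cspace) set \<Rightarrow> ('n cspace \<Rightarrow> 'n cspace) \<Rightarrow> bool" where
  "CR_vector_field M X \<longleftrightarrow>
     smooth_on X (CR_points M) \<and> (\<forall>p\<in>CR_points M. X p \<in> complex_tangent_space M p)"

definition CR_step ::
  "('n::finite cspace) set \<Rightarrow> 'n cspace \<Rightarrow> 'n cspace \<Rightarrow> bool" where
  "CR_step M p q \<longleftrightarrow>
     (\<exists>X \<gamma> a b. CR_vector_field M X \<and> a \<le> b \<and> \<gamma> a = p \<and> \<gamma> b = q \<and>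
        (\<forall>t\<in>{a..b}. \<gamma> t \<in> CR_points M \<and>
           (\<gamma> has_vector_derivative X (\<gamma> t)) (at t within {a..b})))"

definition CR_orbit ::
  "('n::finite cspace) set \<Rightarrow> 'n cspace \<Rightarrow> ('n cspace) set" where
  "CR_orbit M p = {q. (CR_step M)\<^sup>*\<^sup>* p q}"

definition first_integral ::
  "('n::finite cspace) set \<Rightarrow> ('n cspace \<Rightarrow> real) \<Rightarrow> bool" where
  "first_integral M g \<longleftrightarrow> (\<forall>p\<in>CR_points M. \<forall>q\<in>CR_orbit M p. g q = g p)"

definition flattenable :: "('n::finite cspace) set \<Rightarrow> bool" where
  "flattenable M \<longleftrightarrow>
     (\<exists>U F. open U \<and> 0 \<in> U \<and> holomorphic_sev F U \<and>
        (\<forall>p\<in>U. frechet_derivative F (at p) \<noteq> (\<lambda>v. 0)) \<and>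
        (\<forall>p\<in>M \<inter> U. F p \<in> \<real>))"

section \<open>The graph and its quadratic part\<close>

definition graph_over ::
  "(complex^'n::finite \<Rightarrow> complex) \<Rightarrow> (complex^'n) set \<Rightarrow> ('n cspace) set" where
  "graph_over \<rho> \<Omega> = (\<lambda>z. (z, \<rho> z)) ` \<Omega>"

definition conj_transpose :: "complex^'n^'m \<Rightarrow> complex^'m^'n" where
  "conj_transpose A = (\<chi> i j. cnj (A $ j $ i))"

definition stack :: "'a^'n^'m \<Rightarrow> 'a^'n^'k \<Rightarrow> 'a^'n^('m + 'k)" where
  "stack A B = (\<chi> r. case r of Inl i \<Rightarrow> A $ i | Inr i \<Rightarrow> B $ i)"

definition sesq_form :: "complex^'n^'n \<Rightarrow> complex^'n::finite \<Rightarrow> complex" where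
  "sesq_form A z = (\<Sum>i\<in>UNIV. cnj (z $ i) * (A *v z) $ i)"

definition bilin_form :: "complex^'n^'n \<Rightarrow> complex^'n::finite \<Rightarrow> complex" where
  "bilin_form B z = (\<Sum>i\<in>UNIV. z $ i * (B *v z) $ i)"

end

theory Submission
  imports Defs "HOL-Complex_Analysis.Complex_Analysis" "HOL-Real_Asymp.Real_Asymp"
begin

text \<open>
  A real-analytic function of \<open>z\<close> is the restriction of a holomorphic function of \<open>(z, \<zeta>)\<close> to the
  totally real subspace \<open>\<zeta> = cnj z\<close>. A first integral \<open>g\<close> satisfies \<open>g\<^sub>j \<rho>\<^sub>k = g\<^sub>k \<rho>\<^sub>j\<close> for the partial
  derivatives in \<open>\<zeta>\<close>. By the rank condition some \<open>\<rho>\<^sub>i\<close> and \<open>\<rho>\<^sub>j\<close> have linearly independent linear parts at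
  the origin, so that \<open>g\<^sub>k = h \<rho>\<^sub>k\<close> for all \<open>k\<close> with a holomorphic \<open>h\<close>, which satisfies the same equations
  as \<open>g\<close>. Iterating gives functions \<open>h\<^sub>m\<close> with \<open>\<bar>h\<^sub>m\<bar> \<le> M L\<^sup>m m!\<close>, by Cauchy's estimate and the maximum
  principle, and \<open>F (z, w) = (\<Sum>m. h\<^sub>m (z, 0) / m! * (w - \<rho> (z, 0))\<^sup>m)\<close> is a holomorphic function with
  \<open>F (z, \<rho>) = g\<close>. It flattens \<open>M\<close> as soon as \<open>\<partial>F/\<partial>w \<noteq> 0\<close> at the origin. For real \<open>g\<close> this
  means that the second-order jet of \<open>g\<close> does not vanish, because \<open>\<partial>F/\<partial>z = 0\<close> there and the second
  derivatives of \<open>g\<close> are those of \<open>\<rho>\<close> multiplied by \<open>\<partial>F/\<partial>w\<close>; the same computation gives the converse.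
\<close>

text \<open>The obstacle is the division that yields h: it must be holomorphic across the zeros of
  the \<rho>_k, and it must be repeatable infinitely often near the origin. Independence of two
  linear parts makes the common zeros of \<rho>_i and \<rho>_j so thin that the quotient, which is
  given by either of two fractions, can be recovered as a Cauchy integral over circles in a
  direction \<open>a\<close> on which \<rho>_i does not vanish. The maximum principle on the same
  discs bounds the quotient without loss of domain, so that only the Cauchy estimates for the
  derivatives shrink it; k of them at cost \<delta>/(2k) each produce k^k, hence k! up to a
  geometric factor. This is why the domains are tubes made of discs in direction \<open>a\<close>.
  The equations for g come from integral curves through CR points, which include all points where
  some \<rho>_k is nonzero; where all \<rho>_k vanish they read 0 = 0. The rank condition enters
  through the \<zeta>-gradient of Q: its components are linear forms whose coefficients are the
  columns of the stacked matrix, up to conjugation and a factor 2 on the block B.\<close>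

no_notation fps_nth (infixl \<open>$\<close> 75)

section \<open>Holomorphic functions of several variables\<close>

text \<open>One calculus has to serve \<open>complex^'n\<close>, the doubled space of pairs (z,
  \<zeta>) and the ambient space of pairs (z, w). The Euclidean structure underneath supplies real
  derivatives and compact balls; \<open>norm_cscale\<close> controls how far a complex line travels
  per unit of its parameter.\<close>

class complex_space = euclidean_space +
  fixes cscale :: "complex \<Rightarrow> 'a \<Rightarrow> 'a"  (infixr \<open>*\<^sub>C\<close> 75)
  assumes cscale_add_right: "c *\<^sub>C (x + y) = c *\<^sub>C x + c *\<^sub>C y"
    and cscale_add_left: "(c + d) *\<^sub>C x = c *\<^sub>C x + d *\<^sub>C x"
    and cscale_cscale: "c *\<^sub>C d *\<^sub>C x = (c * d) *\<^sub>C x"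
    and cscale_of_real: "of_real r *\<^sub>C x = r *\<^sub>R x"
    and norm_cscale: "norm (c *\<^sub>C x) = cmod c * norm x"

instantiation complex :: complex_space
begin
definition "c *\<^sub>C (x::complex) = c * x"
instance
  by standard (auto simp: cscale_complex_def algebra_simps norm_mult scaleR_conv_of_real)
end

instantiation vec :: (complex_space, finite) complex_space
begin
definition "c *\<^sub>C (x::'a^'b) = (\<chi> i. c *\<^sub>C x $ i)"
instance
proof
  show "norm (c *\<^sub>C x) = cmod c * norm x" for c and x :: "'a^'b"
    by (simp add: norm_vec_def cscale_vec_def norm_cscale L2_set_right_distrib)
qed (auto simp: cscale_vec_def vec_eq_iff cscale_add_right cscale_add_left cscale_cscale cscale_of_real)
end

instantiation prod :: (complex_space, complex_space) complex_space
begin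
definition "c *\<^sub>C (x::'a \<times> 'b) = (c *\<^sub>C fst x, c *\<^sub>C snd x)"
instance
proof
  show "norm (c *\<^sub>C x) = cmod c * norm x" for c and x :: "'a \<times> 'b"
    by (simp add: norm_prod_def cscale_prod_def norm_cscale power_mult_distrib real_sqrt_mult
             flip: distrib_left)
qed (auto simp: cscale_prod_def prod_eq_iff cscale_add_right cscale_add_left cscale_cscale cscale_of_real)
end

lemma cscale_eq_vector_scalar_mult: "c *\<^sub>C (v :: complex^'n::finite) = c *s v"
  by (simp add: vec_eq_iff cscale_vec_def cscale_complex_def)

lemma cscale_zero_right [simp]: "c *\<^sub>C (0::'a::complex_space) = 0"
  by (metis norm_cscale norm_eq_zero norm_zero mult_zero_right)

lemma cscale_zero_left [simp]: "0 *\<^sub>C (v::'a::complex_space) = 0"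
  by (metis norm_cscale norm_eq_zero norm_zero mult_zero_left)

lemma cscale_one [simp]: "1 *\<^sub>C (v::'a::complex_space) = v"
  using cscale_of_real[of 1 v] by simp

lemma cscale_minus_left [simp]: "(- c) *\<^sub>C (v::'a::complex_space) = - (c *\<^sub>C v)"
  using cscale_add_left[of c "-c" v] by (simp add: eq_neg_iff_add_eq_0 add.commute)

lemma cscale_minus_right [simp]: "c *\<^sub>C (- v::'a::complex_space) = - (c *\<^sub>C v)"
  using cscale_add_right[of c v "-v"] by (simp add: eq_neg_iff_add_eq_0 add.commute)

lemma cscale_diff_left: "(c - d) *\<^sub>C (v::'a::complex_space) = c *\<^sub>C v - d *\<^sub>C v"
  using cscale_add_left[of c "-d" v] by simp

lemma cscale_diff_right: "c *\<^sub>C (v - w::'a::complex_space) = c *\<^sub>C v - c *\<^sub>C w"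
  using cscale_add_right[of c v "-w"] by simp

lemma cscale_scaleR: "c *\<^sub>C (r *\<^sub>R v::'a::complex_space) = (c * of_real r) *\<^sub>C v"
  by (simp add: cscale_of_real [symmetric] cscale_cscale)

lemma scaleR_cscale: "r *\<^sub>R (c *\<^sub>C (v::'a::complex_space)) = (of_real r * c) *\<^sub>C v"
  by (simp add: cscale_of_real [symmetric] cscale_cscale)

lemma bounded_bilinear_cscale: "bounded_bilinear ((*\<^sub>C) :: complex \<Rightarrow> 'a \<Rightarrow> 'a::complex_space)"
  by standard (auto simp: cscale_add_left cscale_add_right cscale_scaleR scaleR_cscale norm_cscale
      scaleR_conv_of_real mult_ac intro!: exI[of _ 1])

interpretation cscale: bounded_bilinear "(*\<^sub>C) :: complex \<Rightarrow> 'a \<Rightarrow> 'a::complex_space"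
  by (rule bounded_bilinear_cscale)

lemmas [continuous_intros] =
  bounded_bilinear.continuous_on[OF bounded_bilinear_cscale]

definition complex_linear :: "('a::complex_space \<Rightarrow> 'b::complex_space) \<Rightarrow> bool" where
  "complex_linear f \<longleftrightarrow> bounded_linear f \<and> (\<forall>c x. f (c *\<^sub>C x) = c *\<^sub>C f x)"

text \<open>The derivative is taken in the full space and not within \<open>S\<close>, so that on a
  closed ball this is complex differentiability at every point, boundary included.\<close>

definition holo_on :: "('a::complex_space \<Rightarrow> 'b::complex_space) \<Rightarrow> 'a set \<Rightarrow> bool"
  (infixl \<open>holo'_on\<close> 50) where
  "f holo_on S \<longleftrightarrow> (\<forall>x\<in>S. \<exists>f'. complex_linear f' \<and> (f has_derivative f') (at x))"

text \<open>Only the restriction to one complex line enters, so the definition makes sense before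
  total differentiability is known. For holomorphic functions it is the differential evaluated at
  \<open>v\<close> (\<open>dird_eq\<close>); the partial derivatives in z, \<zeta> and w are all
  written with it.\<close>

definition dird :: "'a::complex_space \<Rightarrow> ('a \<Rightarrow> complex) \<Rightarrow> 'a \<Rightarrow> complex" where
  "dird v f x = deriv (\<lambda>t. f (x + t *\<^sub>C v)) 0"

text \<open>By Osgood's lemma (\<open>holo_on_iff_line_holo_on\<close> below) this is equivalent to \<^const>\<open>holo_on\<close> on
  open sets; it is the form that passes to uniform limits.\<close>

definition line_holo_on :: "('a::complex_space \<Rightarrow> complex) \<Rightarrow> 'a set \<Rightarrow> bool"
  (infixl \<open>line'_holo'_on\<close> 50) where
  "f line_holo_on S \<longleftrightarrow> continuous_on S f \<and>
     (\<forall>x\<in>S. \<forall>v. (\<lambda>t. f (x + t *\<^sub>C v)) field_differentiable (at 0))"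

section \<open>Holomorphy along complex lines\<close>

lemma complex_linearD:
  assumes "complex_linear f"
  shows "bounded_linear f" "f (c *\<^sub>C x) = c *\<^sub>C f x"
  using assms by (auto simp: complex_linear_def)

lemma complex_linear_compose:
  assumes "complex_linear f" "complex_linear g" shows "complex_linear (\<lambda>x. f (g x))"
  using assms by (auto simp: complex_linear_def intro: bounded_linear_compose)

lemma holo_on_subset: "f holo_on S \<Longrightarrow> T \<subseteq> S \<Longrightarrow> f holo_on T"
  by (auto simp: holo_on_def)

lemma line_holo_on_subset: "f line_holo_on S \<Longrightarrow> T \<subseteq> S \<Longrightarrow> f line_holo_on T"
  by (auto simp: line_holo_on_def intro: continuous_on_subset)

lemma has_derivative_line:
  assumes "(f has_derivative f') (at x)" "complex_linear f'"
  shows "((\<lambda>t. f (x + t *\<^sub>C v)) has_field_derivative f' v) (at 0)"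
proof -
  have "((\<lambda>t. x + t *\<^sub>C v) has_derivative (\<lambda>t. t *\<^sub>C v)) (at 0)"
    by (auto intro!: derivative_eq_intros bounded_linear_imp_has_derivative
        bounded_bilinear.bounded_linear_left[OF bounded_bilinear_cscale])
  then have "((\<lambda>t. f (x + t *\<^sub>C v)) has_derivative (\<lambda>t. f' (t *\<^sub>C v))) (at 0)"
    by (rule has_derivative_compose) (use assms in simp)
  then show ?thesis
    using assms(2) by (simp add: has_field_derivative_def complex_linear_def cscale_complex_def mult_commute_abs)
qed

lemma dird_eq:
  assumes "(f has_derivative f') (at x)" "complex_linear f'"
  shows "dird v f x = f' v"
  unfolding dird_def by (rule DERIV_imp_deriv) (rule has_derivative_line[OF assms])

lemma holo_on_has_derivative:
  fixes f :: "'a::complex_space \<Rightarrow> complex"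
  assumes "f holo_on S" "x \<in> S"
  shows "(f has_derivative (\<lambda>v. dird v f x)) (at x)" "complex_linear (\<lambda>v. dird v f x)"
proof -
  obtain f' where f': "complex_linear f'" "(f has_derivative f') (at x)"
    using assms unfolding holo_on_def by auto
  then have "(\<lambda>v. dird v f x) = f'"
    by (auto simp: dird_eq)
  then show "(f has_derivative (\<lambda>v. dird v f x)) (at x)" "complex_linear (\<lambda>v. dird v f x)"
    using f' by auto
qed

lemma holo_on_imp_continuous_on: "f holo_on S \<Longrightarrow> continuous_on S f"
  by (meson continuous_at_imp_continuous_on has_derivative_continuous holo_on_def)

lemma holo_on_imp_line_holo_on:
  assumes "f holo_on S" shows "f line_holo_on S"
  unfolding line_holo_on_def
proof (intro conjI ballI allI)
  show "continuous_on S f" using assms by (rule holo_on_imp_continuous_on)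
next
  fix x v assume "x \<in> S"
  then obtain f' where "complex_linear f'" "(f has_derivative f') (at x)"
    using assms by (auto simp: holo_on_def)
  then show "(\<lambda>t. f (x + t *\<^sub>C v)) field_differentiable (at 0)"
    using has_derivative_line field_differentiable_def by blast
qed

lemma line_has_field_derivative:
  assumes "f line_holo_on S" "x + t *\<^sub>C v \<in> S"
  shows "((\<lambda>t. f (x + t *\<^sub>C v)) has_field_derivative dird v f (x + t *\<^sub>C v)) (at t)"
proof -
  have "((\<lambda>s. f ((x + t *\<^sub>C v) + s *\<^sub>C v)) has_field_derivative dird v f (x + t *\<^sub>C v)) (at 0)"
    unfolding dird_def using assms
    by (simp add: line_holo_on_def field_differentiable_derivI)
  then have "((\<lambda>s. f ((x + t *\<^sub>C v) + (s - t) *\<^sub>C v)) has_field_derivative dird v f (x + t *\<^sub>C v)) (at t)"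
    using DERIV_shift[of "\<lambda>s. f ((x + t *\<^sub>C v) + (s - t) *\<^sub>C v)" _ 0 t] by simp
  then show ?thesis
    by (simp add: cscale_diff_left)
qed

lemma line_holomorphic_on:
  assumes "f line_holo_on S" "\<And>t. t \<in> T \<Longrightarrow> x + t *\<^sub>C v \<in> S"
  shows "(\<lambda>t. f (x + t *\<^sub>C v)) holomorphic_on T"
  unfolding holomorphic_on_def
  using line_has_field_derivative[OF assms(1)] assms(2) field_differentiable_at_within field_differentiable_def
  by blast

lemma dird_bound:
  assumes f: "f line_holo_on S" and r: "r > 0"
    and S: "\<And>t. cmod t \<le> r \<Longrightarrow> x + t *\<^sub>C v \<in> S"
    and M: "\<And>t. cmod t \<le> r \<Longrightarrow> cmod (f (x + t *\<^sub>C v)) \<le> M"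
  shows "cmod (dird v f x) \<le> M / r"
proof -
  have h: "(\<lambda>t. f (x + t *\<^sub>C v)) holomorphic_on cball 0 r"
    by (rule line_holomorphic_on[OF f]) (use S in auto)
  have "cmod ((deriv ^^ 1) (\<lambda>t. f (x + t *\<^sub>C v)) 0) \<le> fact 1 * M / r ^ 1"
    by (rule Cauchy_inequality)
      (use h r M in \<open>auto intro: holomorphic_on_subset holomorphic_on_imp_continuous_on\<close>)
  then show ?thesis by (simp add: dird_def)
qed

text \<open>Taylor's formula of order one on the line. The constant is Cauchy's estimate for the
  second derivative on discs of radius r/2 about points of the smaller disc: 2! M / (r/2)^2 = 8 M /
  r^2.\<close>

lemma line_taylor_bound:
  assumes f: "f line_holo_on S" and r: "r > 0"
    and S: "\<And>t. cmod t \<le> r \<Longrightarrow> x + t *\<^sub>C v \<in> S"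
    and M: "\<And>t. cmod t \<le> r \<Longrightarrow> cmod (f (x + t *\<^sub>C v)) \<le> M"
    and t: "cmod t \<le> r / 2"
  shows "cmod (f (x + t *\<^sub>C v) - f x - t * dird v f x) \<le> 8 * M / r^2 * (cmod t)^2"
proof -
  define \<phi> where "\<phi> = (\<lambda>t. f (x + t *\<^sub>C v))"
  have h: "\<phi> holomorphic_on cball 0 r"
    unfolding \<phi>_def by (rule line_holomorphic_on[OF f]) (use S in auto)
  have h1: "deriv \<phi> holomorphic_on ball 0 r"
    using h by (meson ball_subset_cball holomorphic_deriv holomorphic_on_subset open_ball)
  have B: "cmod ((deriv ^^ 2) \<phi> s) \<le> 8 * M / r^2" if "s \<in> cball 0 (r/2)" for s
  proof -
    have sub: "cball s (r/2) \<subseteq> cball 0 r"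
      using that by (simp add: cball_subset_cball_iff)
    have "cmod ((deriv ^^ 2) \<phi> s) \<le> fact 2 * M / (r/2) ^ 2"
    proof (rule Cauchy_inequality)
      show "\<phi> holomorphic_on ball s (r / 2)" "continuous_on (cball s (r / 2)) \<phi>"
        using h sub by (auto intro: holomorphic_on_subset holomorphic_on_imp_continuous_on
            intro!: subset_trans[OF ball_subset_cball])
      show "cmod (\<phi> x) \<le> M" if "cmod (s - x) = r / 2" for x
      proof -
        have "x \<in> cball 0 r" using that sub by (auto simp: dist_norm subset_iff)
        then show ?thesis using M by (simp add: \<phi>_def)
      qed
    qed (use r in auto)
    then show ?thesis by (simp add: power2_eq_square field_simps)
  qed
  have "cmod ((\<lambda>i. (deriv ^^ i) \<phi>) 0 t - (\<Sum>i\<le>1. (deriv ^^ i) \<phi> 0 * (t - 0) ^ i / fact i))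
      \<le> (8 * M / r^2) * cmod (t - 0) ^ Suc 1 / fact 1"
  proof (rule complex_Taylor[where S = "cball 0 (r/2)"])
    fix i x assume ix: "x \<in> cball (0::complex) (r/2)" "i \<le> (1::nat)"
    then have "x \<in> ball 0 r" using r by auto
    have hi: "(deriv ^^ i) \<phi> holomorphic_on ball 0 r"
      using h by (meson ball_subset_cball holomorphic_higher_deriv holomorphic_on_subset open_ball)
    show "((deriv ^^ i) \<phi> has_field_derivative (deriv ^^ Suc i) \<phi> x) (at x within cball 0 (r/2))"
      using holomorphic_derivI[OF hi open_ball \<open>x \<in> ball 0 r\<close>] by simp
  next
    show "cmod ((deriv ^^ Suc 1) \<phi> x) \<le> 8 * M / r^2" if "x \<in> cball 0 (r/2)" for x
      using B[OF that] by (simp add: numeral_2_eq_2)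
  qed (use r t in auto)
  then show ?thesis
    by (simp add: \<phi>_def dird_def algebra_simps numeral_2_eq_2)
qed

text \<open>Weierstrass's theorem in one variable, applied on each complex line. The filter is
  general because the limits below run over sequences as well as over finite sets of
  multi-indices.\<close>

lemma line_holo_on_uniform_limit:
  fixes f :: "'b \<Rightarrow> 'a::complex_space \<Rightarrow> complex"
  assumes F: "F \<noteq> bot"
    and lim: "\<And>x. x \<in> S \<Longrightarrow> \<exists>r>0. (\<forall>\<^sub>F n in F. f n line_holo_on (ball x r)) \<and> uniform_limit (ball x r) f g F"
  shows "g line_holo_on S"
  unfolding line_holo_on_def
proof (intro conjI ballI allI)
  have "isCont g x" if x: "x \<in> S" for x
  proof -
    obtain r where r: "r > 0" "\<forall>\<^sub>F n in F. f n line_holo_on (ball x r)" "uniform_limit (ball x r) f g F"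
      using lim[OF x] by auto
    have "continuous_on (ball x r) g"
      by (rule uniform_limit_theorem[OF _ r(3) F]) (use r(2) in \<open>auto simp: line_holo_on_def elim: eventually_mono\<close>)
    then show ?thesis using r(1) by (simp add: continuous_on_eq_continuous_at)
  qed
  then show "continuous_on S g" by (simp add: continuous_at_imp_continuous_on)
next
  fix x v :: 'a assume x: "x \<in> S"
  obtain r where r: "r > 0" "\<forall>\<^sub>F n in F. f n line_holo_on (ball x r)" "uniform_limit (ball x r) f g F"
    using lim[OF x] by auto
  \<comment> \<open>The summand 1 covers \<open>v = 0\<close> without a case distinction.\<close>
  define s where "s = r / 2 / (norm v + 1)"
  have s: "s > 0" using r(1) by (auto simp: s_def add_nonneg_pos)
  have sub: "x + t *\<^sub>C v \<in> ball x r" if "t \<in> cball 0 s" for t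
  proof -
    have "cmod t * norm v \<le> s * (norm v + 1)"
      using that s by (intro mult_mono) auto
    also have "\<dots> = r / 2" using nonzero_eq_divide_eq[of "norm v + 1" s "r/2"] add_nonneg_pos[OF norm_ge_zero zero_less_one, of v] s_def by simp
    finally show ?thesis using r(1) by (simp add: dist_norm norm_cscale)
  qed
  obtain "continuous_on (cball 0 s) (\<lambda>t. g (x + t *\<^sub>C v))" "(\<lambda>t. g (x + t *\<^sub>C v)) holomorphic_on ball 0 s"
  proof (rule holomorphic_uniform_limit[where F = F and f = "\<lambda>n t. f n (x + t *\<^sub>C v)" and z = 0 and r = s])
    show "\<forall>\<^sub>F n in F. continuous_on (cball 0 s) (\<lambda>t. f n (x + t *\<^sub>C v)) \<and> (\<lambda>t. f n (x + t *\<^sub>C v)) holomorphic_on ball 0 s"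
      using r(2)
    proof eventually_elim
      case (elim n)
      have "(\<lambda>t. f n (x + t *\<^sub>C v)) holomorphic_on cball 0 s"
        by (rule line_holomorphic_on[OF elim]) (use sub in auto)
      then show ?case by (meson ball_subset_cball holomorphic_on_imp_continuous_on holomorphic_on_subset)
    qed
    show "uniform_limit (cball 0 s) (\<lambda>n t. f n (x + t *\<^sub>C v)) (\<lambda>t. g (x + t *\<^sub>C v)) F"
      by (rule uniform_limit_compose'[OF r(3)]) (use sub in auto)
  qed (use F in auto)
  then show "(\<lambda>t. g (x + t *\<^sub>C v)) field_differentiable (at 0)"
    using s by (simp add: holomorphic_on_open field_differentiable_def)
qed

section \<open>Osgood's lemma: holomorphy on lines gives total differentiability\<close>

lemma continuous_on_locally_bounded:
  fixes f :: "'a::euclidean_space \<Rightarrow> 'b::real_normed_vector"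
  assumes "continuous_on S f" "open S" "x \<in> S"
  obtains r M where "r > 0" "cball x r \<subseteq> S" "M > 0" "\<And>y. y \<in> cball x r \<Longrightarrow> norm (f y) \<le> M"
proof -
  obtain r where r: "r > 0" "cball x r \<subseteq> S" using assms open_contains_cball by blast
  have "compact (f ` cball x r)"
    using assms(1) r by (meson compact_cball compact_continuous_image continuous_on_subset)
  then obtain M where "M > 0" "\<forall>y\<in>f ` cball x r. norm y \<le> M"
    using compact_imp_bounded bounded_pos by blast
  then show ?thesis using r that[of r M] by simp
qed

text \<open>The point is uniformity in the direction: the error is measured by the displacement
  \<open>t *\<^sub>C v\<close> alone. On the line through y the parameter disc of radius r / (2 |v|)
  stays in the ball, which turns the constant 8 into 8 * 4 = 32.\<close>

lemma line_holo_on_scaled_line_taylor: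
  fixes f :: "'a::complex_space \<Rightarrow> complex"
  assumes f: "f line_holo_on cball x r" and r: "r > 0"
    and M: "\<And>y. y \<in> cball x r \<Longrightarrow> cmod (f y) \<le> M"
    and y: "y \<in> cball x (r/2)" and t: "norm (t *\<^sub>C v) \<le> r/4"
  shows "cmod (f (y + t *\<^sub>C v) - f y - t * dird v f y) \<le> 32 * M / r^2 * (norm (t *\<^sub>C v))^2"
proof (cases "norm v = 0")
  case True
  then have "dird v f y = 0" by (simp add: dird_def)
  then show ?thesis using True by simp
next
  case False
  define R where "R = r / (2 * norm v)"
  have in_ball: "y + s *\<^sub>C v \<in> cball x r" if "cmod s \<le> R" for s
  proof -
    have "norm (s *\<^sub>C v) \<le> R * norm v"
      unfolding norm_cscale using that by (intro mult_right_mono) auto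
    also have "\<dots> = r/2" using False by (simp add: R_def)
    finally have "norm (s *\<^sub>C v) \<le> r/2" .
    moreover have "norm (x - y) \<le> r/2" using y by (simp add: dist_norm)
    ultimately show ?thesis
      using norm_triangle_ineq4[of "x - y" "s *\<^sub>C v"] by (simp add: dist_norm algebra_simps)
  qed
  have "cmod (f (y + t *\<^sub>C v) - f y - t * dird v f y) \<le> 8 * M / R^2 * (cmod t)^2"
  proof (rule line_taylor_bound[OF f])
    show "R > 0" using r False by (simp add: R_def)
    show "cmod t \<le> R / 2" using t False by (simp add: R_def norm_cscale field_simps)
  qed (use in_ball M in auto)
  also have "\<dots> = 32 * M / r^2 * (norm (t *\<^sub>C v))^2"
    using False r by (simp add: R_def norm_cscale power_mult_distrib power_divide)
  finally show ?thesis .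
qed

text \<open>By the second-order bound the difference quotients with step 1/(n+1) converge uniformly
  near x, with an error of order 1/n. This expresses the derivative through translates of f, to
  which the theorem on uniform limits applies.\<close>

lemma dird_uniform_limit:
  fixes f :: "'a::complex_space \<Rightarrow> complex"
  assumes f: "f line_holo_on S" "open S" and x: "x \<in> S"
  obtains r where "r > 0" "cball x r \<subseteq> S"
    "uniform_limit (ball x r) (\<lambda>n y. of_nat (Suc n) * (f (y + (1 / of_nat (Suc n)) *\<^sub>C v) - f y)) (dird v f) sequentially"
    "\<forall>\<^sub>F n in sequentially. \<forall>y\<in>ball x r. y + (1 / of_nat (Suc n)) *\<^sub>C v \<in> S"
proof -
  obtain r M where r: "r > 0" "cball x r \<subseteq> S" "M > 0" and M: "\<And>y. y \<in> cball x r \<Longrightarrow> norm (f y) \<le> M"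
    using continuous_on_locally_bounded[of S f x] assms by (auto simp: line_holo_on_def)
  have f': "f line_holo_on cball x r" using f r line_holo_on_subset by blast
  have small: "\<forall>\<^sub>F n in sequentially. (1 / real (Suc n)) * norm v \<le> d" if "d > 0" for d :: real
  proof -
    have "(\<lambda>n. (1 / real (Suc n)) * norm v) \<longlonglongrightarrow> 0 * norm v"
      by (intro tendsto_intros LIMSEQ_Suc[OF lim_1_over_n])
    then have "\<forall>\<^sub>F n in sequentially. (1 / real (Suc n)) * norm v < d"
      by (rule order_tendstoD(2)) (use that in simp)
    then show ?thesis by (rule eventually_mono) simp
  qed
  have cn: "norm ((1 / of_nat (Suc n)) *\<^sub>C v) = (1 / real (Suc n)) * norm v" for n
    by (simp add: norm_cscale norm_divide del: of_nat_Suc)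
  have sub: "\<forall>\<^sub>F n in sequentially. \<forall>y\<in>ball x (r/2). y + (1 / of_nat (Suc n)) *\<^sub>C v \<in> cball x r"
    using small[OF half_gt_zero[OF r(1)]]
  proof (rule eventually_mono, intro ballI)
    fix n y assume n: "(1 / real (Suc n)) * norm v \<le> r/2" and y: "y \<in> ball x (r/2)"
    have "dist y (y + (1 / of_nat (Suc n)) *\<^sub>C v) \<le> r/2"
      using n cn[of n] by (simp only: dist_norm) simp
    then show "y + (1 / of_nat (Suc n)) *\<^sub>C v \<in> cball x r"
      using y dist_triangle[of x "y + (1 / of_nat (Suc n)) *\<^sub>C v" y] unfolding mem_ball mem_cball by linarith
  qed
  have "uniform_limit (ball x (r/2)) (\<lambda>n y. of_nat (Suc n) * (f (y + (1 / of_nat (Suc n)) *\<^sub>C v) - f y)) (dird v f) sequentially"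
  proof (rule uniform_limitI)
    fix e :: real assume e: "e > 0"
    define K where "K = 32 * M / r^2 * norm v"
    have K: "K \<ge> 0" using r by (simp add: K_def)
    define d where "d = e / (K + 1)"
    have d: "d > 0" using e K by (simp add: d_def)
    have dK: "K * d < e"
      unfolding d_def using e K by (simp add: field_simps)
    show "\<forall>\<^sub>F n in sequentially. \<forall>y\<in>ball x (r/2).
        dist (of_nat (Suc n) * (f (y + (1 / of_nat (Suc n)) *\<^sub>C v) - f y)) (dird v f y) < e"
      using eventually_conj[OF small[of "r/4"] small[OF d]]
    proof (rule eventually_mono, use r(1) in simp, intro ballI)
      fix n y assume "(1 / real (Suc n)) * norm v \<le> r/4 \<and> (1 / real (Suc n)) * norm v \<le> d" and y: "y \<in> ball x (r/2)"
      then have n: "norm v / real (Suc n) \<le> r/4" "norm v / real (Suc n) \<le> d" by simp_all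
      let ?t = "1 / of_nat (Suc n) :: complex"
      have "cmod (f (y + ?t *\<^sub>C v) - f y - ?t * dird v f y) \<le> 32 * M / r^2 * (norm (?t *\<^sub>C v))^2"
        by (rule line_holo_on_scaled_line_taylor[OF f' r(1) M]) (use y n cn[of n] in auto)
      also have "\<dots> = (K * (norm v / real (Suc n))) / real (Suc n)"
        unfolding cn K_def by (simp add: power2_eq_square mult.assoc)
      also have "\<dots> \<le> (K * d) / real (Suc n)"
        using K n by (intro divide_right_mono mult_left_mono) auto
      finally have *: "cmod (f (y + ?t *\<^sub>C v) - f y - ?t * dird v f y) * real (Suc n) \<le> K * d"
        by (simp add: field_simps del: of_nat_Suc)
      have "of_nat (Suc n) * (f (y + ?t *\<^sub>C v) - f y) - dird v f y = (f (y + ?t *\<^sub>C v) - f y - ?t * dird v f y) * of_nat (Suc n)"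
        by (simp add: field_simps del: of_nat_Suc)
      then have "dist (of_nat (Suc n) * (f (y + ?t *\<^sub>C v) - f y)) (dird v f y) = cmod (f (y + ?t *\<^sub>C v) - f y - ?t * dird v f y) * real (Suc n)"
        unfolding dist_norm by (simp only: norm_mult norm_of_nat)
      then show "dist (of_nat (Suc n) * (f (y + ?t *\<^sub>C v) - f y)) (dird v f y) < e"
        using * dK by linarith
    qed
  qed
  moreover have "\<forall>\<^sub>F n in sequentially. \<forall>y\<in>ball x (r/2). y + (1 / of_nat (Suc n)) *\<^sub>C v \<in> S"
    using sub by (rule eventually_mono) (use r in auto)
  moreover have "cball x (r/2) \<subseteq> S" using r by (auto simp: subset_iff)
  ultimately show ?thesis using that[of "r/2"] r(1) by auto
qed


lemma dird_line_holo_on: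
  assumes "f line_holo_on S" "open S"
  shows "dird v f line_holo_on S"
proof (rule line_holo_on_uniform_limit[OF sequentially_bot])
  fix x assume x: "x \<in> S"
  obtain r where r: "r > 0" "cball x r \<subseteq> S"
    "uniform_limit (ball x r) (\<lambda>n y. of_nat (Suc n) * (f (y + (1 / of_nat (Suc n)) *\<^sub>C v) - f y)) (dird v f) sequentially"
    "\<forall>\<^sub>F n in sequentially. \<forall>y\<in>ball x r. y + (1 / of_nat (Suc n)) *\<^sub>C v \<in> S"
    by (rule dird_uniform_limit[OF assms x, of v])
  have "\<forall>\<^sub>F n in sequentially. (\<lambda>y. of_nat (Suc n) * (f (y + (1 / of_nat (Suc n)) *\<^sub>C v) - f y)) line_holo_on ball x r"
    using r(4)
  proof (rule eventually_mono)
    fix n assume n: "\<forall>y\<in>ball x r. y + (1 / of_nat (Suc n)) *\<^sub>C v \<in> S"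
    let ?t = "(1 / of_nat (Suc n)) *\<^sub>C v"
    show "(\<lambda>y. of_nat (Suc n) * (f (y + ?t) - f y)) line_holo_on ball x r"
      unfolding line_holo_on_def
    proof (intro conjI ballI allI)
      have c: "continuous_on S f" using assms by (simp add: line_holo_on_def)
      have "continuous_on (ball x r) (\<lambda>y. f (y + ?t))"
        by (rule continuous_on_compose2[OF c]) (use n in \<open>auto intro!: continuous_intros\<close>)
      moreover have "continuous_on (ball x r) f"
        using c r(2) by (meson ball_subset_cball continuous_on_subset)
      ultimately show "continuous_on (ball x r) (\<lambda>y. of_nat (Suc n) * (f (y + ?t) - f y))"
        by (intro continuous_intros)
    next
      fix y w assume y: "y \<in> ball x r"
      then have y': "y \<in> S" "y + ?t \<in> S" using n r(2) by auto
      have "(\<lambda>s. f ((y + ?t) + s *\<^sub>C w)) field_differentiable at 0" "(\<lambda>s. f (y + s *\<^sub>C w)) field_differentiable at 0"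
        using assms(1) y' by (auto simp: line_holo_on_def)
      moreover have "(y + ?t) + s *\<^sub>C w = y + s *\<^sub>C w + ?t" for s
        by simp
      ultimately show "(\<lambda>s. of_nat (Suc n) * (f (y + s *\<^sub>C w + ?t) - f (y + s *\<^sub>C w))) field_differentiable at 0"
        by (auto intro!: derivative_intros simp del: of_nat_Suc)
    qed
  qed
  with r show "\<exists>r>0. (\<forall>\<^sub>F n in sequentially. (\<lambda>y. of_nat (Suc n) * (f (y + (1 / of_nat (Suc n)) *\<^sub>C v) - f y)) line_holo_on ball x r)
     \<and> uniform_limit (ball x r) (\<lambda>n y. of_nat (Suc n) * (f (y + (1 / of_nat (Suc n)) *\<^sub>C v) - f y)) (dird v f) sequentially"
    by blast
qed

lemma dird_cscale:
  assumes "f line_holo_on S" "x \<in> S"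
  shows "dird (c *\<^sub>C v) f x = c * dird v f x"
proof -
  have "((\<lambda>t. f (x + t *\<^sub>C v)) has_field_derivative dird v f x) (at (0 * c))"
    using line_has_field_derivative[OF assms(1), of x 0 v] assms(2) by simp
  moreover have "((\<lambda>t. t * c) has_field_derivative c) (at 0)"
    by (auto intro!: derivative_eq_intros)
  ultimately have "((\<lambda>t. f (x + (t * c) *\<^sub>C v)) has_field_derivative dird v f x * c) (at 0)"
    by (rule DERIV_chain2)
  then show ?thesis
    unfolding dird_def cscale_cscale by (simp add: DERIV_imp_deriv mult.commute)
qed

lemma dird_zero_direction [simp]: "dird 0 f x = 0"
  by (simp add: dird_def)

lemma line_holo_on_imp_quadratic_bound:
  assumes f: "f line_holo_on S" "open S" and x: "x \<in> S"
  obtains r C where "r > 0" "cball x r \<subseteq> S"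
    "\<And>y v. y \<in> cball x r \<Longrightarrow> norm v \<le> r \<Longrightarrow> cmod (f (y + v) - f y - dird v f y) \<le> C * (norm v)^2"
proof -
  obtain r M where r: "r > 0" "cball x r \<subseteq> S" "M > 0" and M: "\<And>y. y \<in> cball x r \<Longrightarrow> norm (f y) \<le> M"
    using continuous_on_locally_bounded[of S f x] assms by (auto simp: line_holo_on_def)
  have f': "f line_holo_on cball x r" using f r line_holo_on_subset by blast
  have *: "cmod (f (y + v) - f y - dird v f y) \<le> 32 * M / r^2 * (norm v)^2"
    if "y \<in> cball x (r/4)" "norm v \<le> r/4" for y v
    using line_holo_on_scaled_line_taylor[OF f' r(1) M, of y 1 v] that r by auto
  have "cball x (r/4) \<subseteq> S" using r by (auto simp: subset_iff)
  then show ?thesis using that[of "r/4" "32 * M / r^2"] * r(1) by auto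
qed

text \<open>The core of Osgood's lemma. The values at x and x + s(u + v) are compared directly and
  by way of x + s u. Each of the three first-order expansions has an error O(s^2), and the
  derivative along v at x + s u tends to the one at x by continuity. A nonzero defect of additivity
  contradicts this for small s.\<close>

lemma dird_add:
  assumes f: "f line_holo_on S" "open S" and x: "x \<in> S"
  shows "dird (u + v) f x = dird u f x + dird v f x"
proof (rule ccontr)
  let ?d = "dird u f x + dird v f x - dird (u + v) f x"
  assume "dird (u + v) f x \<noteq> dird u f x + dird v f x"
  then have d: "cmod ?d > 0" by simp
  obtain r C where r: "r > 0" "cball x r \<subseteq> S"
    and C: "\<And>y v. y \<in> cball x r \<Longrightarrow> norm v \<le> r \<Longrightarrow> cmod (f (y + v) - f y - dird v f y) \<le> C * (norm v)^2"
    using line_holo_on_imp_quadratic_bound[OF assms] by blast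
  have "isCont (dird v f) x"
    using dird_line_holo_on[OF f, of v] f(2) x by (simp add: line_holo_on_def continuous_on_eq_continuous_at)
  then have lim: "((\<lambda>s. dird v f (x + s *\<^sub>R u)) \<longlongrightarrow> dird v f x) (at_right 0)"
    by (rule isCont_tendsto_compose) (auto intro!: tendsto_eq_intros)
  define K where "K = C * ((norm (u+v))^2 + (norm u)^2 + (norm v)^2)"
  have "((\<lambda>s. s * K + cmod (dird v f (x + s *\<^sub>R u) - dird v f x)) \<longlongrightarrow> 0 * K + cmod (dird v f x - dird v f x)) (at_right 0)"
    by (intro tendsto_intros lim)
  then have "\<forall>\<^sub>F s in at_right 0. s * K + cmod (dird v f (x + s *\<^sub>R u) - dird v f x) < cmod ?d"
    by (rule order_tendstoD(2)) (use d in simp)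
  note lim' = this
  have small: "\<forall>\<^sub>F s in at_right 0. norm (s *\<^sub>R w) < r" for w :: 'a
    by (rule order_tendstoD(2)[of _ 0]) (use r(1) in \<open>auto intro!: tendsto_eq_intros\<close>)
  have "\<forall>\<^sub>F s in at_right (0::real). False"
    using lim' small[of u] small[of v] small[of "u+v"] eventually_at_right_less[of 0]
  proof eventually_elim
    case (elim s)
    have D: "dird (s *\<^sub>R w) f y = s * dird w f y" if "y \<in> S" for w y
      using dird_cscale[OF f(1) that, of "of_real s" w] by (simp add: cscale_of_real)
    have y: "x + s *\<^sub>R u \<in> cball x r" using elim by (simp add: dist_norm)
    then have yS: "x + s *\<^sub>R u \<in> S" using r by auto
    have 1: "cmod (f (x + s *\<^sub>R (u+v)) - f x - s * dird (u+v) f x) \<le> C * (norm (s *\<^sub>R (u+v)))^2"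
      using C[of x "s *\<^sub>R (u+v)"] elim r D[OF x] by auto
    have 2: "cmod (f (x + s *\<^sub>R u) - f x - s * dird u f x) \<le> C * (norm (s *\<^sub>R u))^2"
      using C[of x "s *\<^sub>R u"] elim r D[OF x] by auto
    have 3: "cmod (f (x + s *\<^sub>R (u+v)) - f (x + s *\<^sub>R u) - s * dird v f (x + s *\<^sub>R u)) \<le> C * (norm (s *\<^sub>R v))^2"
      using C[of "x + s *\<^sub>R u" "s *\<^sub>R v"] elim y D[OF yS] by (auto simp: scaleR_add_right add.assoc)
    have "s * cmod ?d = cmod (s * ?d)"
      using elim by (simp add: norm_mult)
    also have "s * ?d = (f (x + s *\<^sub>R (u+v)) - f x - s * dird (u+v) f x) - (f (x + s *\<^sub>R u) - f x - s * dird u f x)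
        - (f (x + s *\<^sub>R (u+v)) - f (x + s *\<^sub>R u) - s * dird v f (x + s *\<^sub>R u)) - s * (dird v f (x + s *\<^sub>R u) - dird v f x)"
      by (simp add: algebra_simps)
    also have "cmod \<dots> \<le> C * (norm (s *\<^sub>R (u+v)))^2 + C * (norm (s *\<^sub>R u))^2 + C * (norm (s *\<^sub>R v))^2
        + cmod (s * (dird v f (x + s *\<^sub>R u) - dird v f x))"
      by (intro order_trans[OF norm_triangle_ineq4] add_mono 1 2 3 order_refl)
    also have "\<dots> = s * (s * K + cmod (dird v f (x + s *\<^sub>R u) - dird v f x))"
      using elim by (simp only: K_def norm_mult norm_scaleR norm_of_real abs_of_pos power_mult_distrib)
        (simp add: algebra_simps power2_eq_square)
    finally have "cmod ?d \<le> s * K + cmod (dird v f (x + s *\<^sub>R u) - dird v f x)"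
      using elim by (simp add: mult_le_cancel_left_pos)
    then show ?case using elim by linarith
  qed
  then show False by simp
qed

text \<open>Once the directional derivatives are additive they form a linear map, and the bound of
  \<open>line_holo_on_imp_quadratic_bound\<close> says that this map is the total
  derivative.\<close>

lemma line_holo_on_imp_holo_on:
  fixes f :: "'a::complex_space \<Rightarrow> complex"
  assumes f: "f line_holo_on S" "open S"
  shows "f holo_on S"
  unfolding holo_on_def
proof
  fix x assume x: "x \<in> S"
  have lin: "linear (\<lambda>v. dird v f x)"
  proof
    show "dird (u + v) f x = dird u f x + dird v f x" for u v by (rule dird_add[OF f x])
    show "dird (r *\<^sub>R v) f x = r *\<^sub>R dird v f x" for r v
      using dird_cscale[OF f(1) x, of "of_real r" v] by (simp add: cscale_of_real scaleR_conv_of_real)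
  qed
  then have bl: "bounded_linear (\<lambda>v. dird v f x)" by (simp add: linear_conv_bounded_linear)
  obtain r C where r: "r > 0" "cball x r \<subseteq> S"
    and C: "\<And>y v. y \<in> cball x r \<Longrightarrow> norm v \<le> r \<Longrightarrow> cmod (f (y + v) - f y - dird v f y) \<le> C * (norm v)^2"
    using line_holo_on_imp_quadratic_bound[OF assms x] by blast
  have "(f has_derivative (\<lambda>v. dird v f x)) (at x)"
    unfolding has_derivative_at
  proof (intro conjI bl)
    show "(\<lambda>h. norm (f (x + h) - f x - dird h f x) / norm h) \<midarrow>0\<rightarrow> 0"
    proof (rule Lim_null_comparison)
      show "((\<lambda>h. \<bar>C\<bar> * norm h) \<longlongrightarrow> 0) (at 0)"
        by (auto intro!: tendsto_eq_intros)
      have "\<forall>\<^sub>F h in at 0. norm h < r \<and> h \<noteq> (0::'a)"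
        using r(1) by (auto simp: eventually_at intro!: exI[of _ r])
      then show "\<forall>\<^sub>F h in at 0. norm (norm (f (x + h) - f x - dird h f x) / norm h) \<le> \<bar>C\<bar> * norm h"
      proof eventually_elim
        case (elim h)
        have "cmod (f (x + h) - f x - dird h f x) \<le> C * (norm h)^2" using C[of x h] elim r(1) by auto
        also have "\<dots> \<le> \<bar>C\<bar> * (norm h)^2" by (intro mult_right_mono) auto
        finally show ?case using elim by (simp add: field_simps power2_eq_square)
      qed
    qed
  qed
  moreover have "complex_linear (\<lambda>v. dird v f x)"
    using bl dird_cscale[OF f(1) x] by (simp add: complex_linear_def cscale_complex_def)
  ultimately show "\<exists>f'. complex_linear f' \<and> (f has_derivative f') (at x)" by blast
qed

lemma holo_on_iff_line_holo_on: "open S \<Longrightarrow> f holo_on S \<longleftrightarrow> f line_holo_on S"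
  using holo_on_imp_line_holo_on line_holo_on_imp_holo_on by blast

lemma holo_on_dird: "f holo_on S \<Longrightarrow> open S \<Longrightarrow> dird v f holo_on S"
  by (simp add: holo_on_iff_line_holo_on dird_line_holo_on)

lemma small_on_line:
  fixes v :: "'a::complex_space"
  assumes "e > 0"
  obtains s where "s > 0" "\<And>t. cmod t \<le> s \<Longrightarrow> norm (t *\<^sub>C v) < e"
proof -
  define s where "s = e / 2 / (norm v + 1)"
  have v: "norm v + 1 > 0" by (simp add: add_nonneg_pos)
  have s: "s > 0" using assms v by (simp add: s_def)
  have "norm (t *\<^sub>C v) < e" if "cmod t \<le> s" for t
  proof -
    have "norm (t *\<^sub>C v) \<le> s * (norm v + 1)"
      unfolding norm_cscale using that s by (intro mult_mono) auto
    also have "\<dots> = e / 2" using nonzero_eq_divide_eq[of "norm v + 1" s "e/2"] v s_def by simp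
    finally show ?thesis using assms by simp
  qed
  then show ?thesis using that s by blast
qed

text \<open>The u-derivative commutes with each difference quotient in direction v. These quotients
  converge uniformly, and Weierstrass's theorem on the u-line lets the derivative pass to the
  limit.\<close>

lemma dird_commute:
  assumes f: "f holo_on S" and S: "open S" and x: "x \<in> S"
  shows "dird u (dird v f) x = dird v (dird u f) x"
proof -
  have lf: "f line_holo_on S" and lu: "dird u f line_holo_on S"
    using f S by (auto simp: holo_on_iff_line_holo_on dird_line_holo_on)
  define t :: "nat \<Rightarrow> complex" where "t n = 1 / of_nat (Suc n)" for n
  define q where "q g n w = of_nat (Suc n) * (g (w + t n *\<^sub>C v) - g w)"
    for g :: "'a \<Rightarrow> complex" and n w
  obtain r where r: "r > 0" "cball x r \<subseteq> S"
    and q_lim: "uniform_limit (ball x r) (q f) (dird v f) sequentially"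
    and q_dom: "\<forall>\<^sub>F n in sequentially. \<forall>y\<in>ball x r. y + t n *\<^sub>C v \<in> S"
    unfolding q_def t_def by (rule dird_uniform_limit[OF lf S x, of v])
  obtain r' where r': "r' > 0" "uniform_limit (ball x r') (q (dird u f)) (dird v (dird u f)) sequentially"
    unfolding q_def t_def by (rule dird_uniform_limit[OF lu S x, of v])
  have lim: "(\<lambda>n. q (dird u f) n x) \<longlonglongrightarrow> dird v (dird u f) x"
    by (rule tendsto_uniform_limitI[OF r'(2)]) (use r' in simp)
  obtain s where s: "s > 0" "\<And>z. cmod z \<le> s \<Longrightarrow> norm (z *\<^sub>C u) < r"
    using small_on_line[OF r(1), of u] by blast
  have sub: "x + z *\<^sub>C u \<in> ball x r" if "z \<in> cball 0 s" for z
    using s(2)[of z] that by (simp add: dist_norm)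
  have q_deriv: "\<forall>\<^sub>F n in sequentially. \<forall>z\<in>cball 0 s.
       ((\<lambda>z. q f n (x + z *\<^sub>C u)) has_field_derivative q (dird u f) n (x + z *\<^sub>C u)) (at z)"
    using q_dom
  proof (rule eventually_mono, intro ballI)
    fix n and z :: complex assume n: "\<forall>y\<in>ball x r. y + t n *\<^sub>C v \<in> S" and z: "z \<in> cball 0 s"
    have 1: "x + z *\<^sub>C u \<in> S" using sub[OF z] r(2) by auto
    have 2: "(x + t n *\<^sub>C v) + z *\<^sub>C u = x + z *\<^sub>C u + t n *\<^sub>C v" for z by simp
    have "x + z *\<^sub>C u + t n *\<^sub>C v \<in> S" using n sub[OF z] by blast
    then have 3: "((\<lambda>z. f (x + z *\<^sub>C u + t n *\<^sub>C v)) has_field_derivative dird u f (x + z *\<^sub>C u + t n *\<^sub>C v)) (at z)"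
      using line_has_field_derivative[OF lf, of "x + t n *\<^sub>C v" z u] unfolding 2 by simp
    show "((\<lambda>z. q f n (x + z *\<^sub>C u)) has_field_derivative q (dird u f) n (x + z *\<^sub>C u)) (at z)"
      unfolding q_def by (intro DERIV_cmult DERIV_diff 3 line_has_field_derivative[OF lf 1])
  qed
  obtain g' where "continuous_on (cball 0 s) (\<lambda>z. dird v f (x + z *\<^sub>C u))"
    and g': "\<And>z. z \<in> ball 0 s \<Longrightarrow> ((\<lambda>z. dird v f (x + z *\<^sub>C u)) has_field_derivative g' z) (at z) \<and>
       (\<lambda>n. q (dird u f) n (x + z *\<^sub>C u)) \<longlonglongrightarrow> g' z"
  proof (rule has_complex_derivative_uniform_limit)
    show "\<forall>\<^sub>F n in sequentially. continuous_on (cball 0 s) (\<lambda>z. q f n (x + z *\<^sub>C u)) \<and>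
       (\<forall>z\<in>ball 0 s. ((\<lambda>z. q f n (x + z *\<^sub>C u)) has_field_derivative q (dird u f) n (x + z *\<^sub>C u)) (at z))"
      using q_deriv
    proof (rule eventually_mono, intro conjI)
      fix n assume n: "\<forall>z\<in>cball 0 s.
         ((\<lambda>z. q f n (x + z *\<^sub>C u)) has_field_derivative q (dird u f) n (x + z *\<^sub>C u)) (at z)"
      show "continuous_on (cball 0 s) (\<lambda>z. q f n (x + z *\<^sub>C u))"
        using n by (intro DERIV_continuous_on) (blast intro: has_field_derivative_at_within)
      show "\<forall>z\<in>ball 0 s. ((\<lambda>z. q f n (x + z *\<^sub>C u)) has_field_derivative q (dird u f) n (x + z *\<^sub>C u)) (at z)"
        using n by (meson ball_subset_cball subsetD)
    qed
    show "uniform_limit (cball 0 s) (\<lambda>n z. q f n (x + z *\<^sub>C u)) (\<lambda>z. dird v f (x + z *\<^sub>C u)) sequentially"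
      by (rule uniform_limit_compose'[OF q_lim]) (use sub in auto)
  qed (use s in auto)
  have "dird u (dird v f) x = g' 0"
    unfolding dird_def[of u] using g'[of 0] s(1) by (intro DERIV_imp_deriv) auto
  moreover have "g' 0 = dird v (dird u f) x"
    using g'[of 0] s(1) lim by (intro LIMSEQ_unique[OF _ lim]) auto
  ultimately show ?thesis by simp
qed

section \<open>Complex linear maps and the rules of differentiation\<close>

lemma complex_linear_fst: "complex_linear (fst :: 'a::complex_space \<times> 'b::complex_space \<Rightarrow> 'a)"
  by (simp add: complex_linear_def cscale_prod_def bounded_linear_fst)

lemma complex_linear_snd: "complex_linear (snd :: 'a::complex_space \<times> 'b::complex_space \<Rightarrow> 'b)"
  by (simp add: complex_linear_def cscale_prod_def bounded_linear_snd)

lemma complex_linear_Pair: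
  assumes "complex_linear f" "complex_linear g" shows "complex_linear (\<lambda>x. (f x, g x))"
  using assms by (auto simp: complex_linear_def cscale_prod_def intro: bounded_linear_Pair)

lemma complex_linear_zero: "complex_linear (\<lambda>x. 0)"
  by (simp add: complex_linear_def)

lemma complex_linear_ident: "complex_linear (\<lambda>x. x)"
  by (simp add: complex_linear_def)

lemma complex_linear_add:
  assumes "complex_linear f" "complex_linear g" shows "complex_linear (\<lambda>x. f x + g x)"
  using assms by (auto simp: complex_linear_def cscale_add_right intro: bounded_linear_add)

lemma complex_linear_sum:
  assumes "\<And>i. i \<in> I \<Longrightarrow> complex_linear (f i)" shows "complex_linear (\<lambda>x. \<Sum>i\<in>I. f i x)"
  using assms by (induction I rule: infinite_finite_induct) (auto intro: complex_linear_zero complex_linear_add)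

lemma complex_linear_mult_left:
  assumes "complex_linear f" shows "complex_linear (\<lambda>x. c * f x :: complex)"
  using assms by (auto simp: complex_linear_def cscale_complex_def intro: bounded_linear_const_mult)

lemma complex_linear_vec_nth:
  assumes "complex_linear f" shows "complex_linear (\<lambda>x. f x $ i)"
  using assms by (auto simp: complex_linear_def cscale_vec_def
      intro: bounded_linear_compose[OF bounded_linear_vec_nth])

lemma complex_linear_axis: "complex_linear (axis i :: complex \<Rightarrow> complex^'n::finite)"
  by (auto simp: complex_linear_def cscale_vec_def cscale_complex_def axis_def vec_eq_iff scaleR_vec_def
      intro!: linear_conv_bounded_linear[THEN iffD1] linearI)

lemmas complex_linear_intros = complex_linear_zero complex_linear_ident complex_linear_add
  complex_linear_sum complex_linear_mult_left complex_linear_vec_nth complex_linear_Pair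
  complex_linear_fst complex_linear_snd complex_linear_compose[OF complex_linear_fst]
  complex_linear_compose[OF complex_linear_snd] complex_linear_compose[OF complex_linear_axis]

lemma complex_linear_imp_holo_on: "complex_linear f \<Longrightarrow> f holo_on S"
  unfolding holo_on_def by (auto simp: complex_linear_def bounded_linear_imp_has_derivative intro!: exI[of _ f])

lemma holo_on_const [intro]: "(\<lambda>x. c) holo_on S"
  unfolding holo_on_def using complex_linear_zero has_derivative_const by blast

lemma holo_on_Pair:
  assumes "f holo_on S" "g holo_on S" shows "(\<lambda>x. (f x, g x)) holo_on S"
  using assms unfolding holo_on_def by (blast intro: complex_linear_Pair has_derivative_Pair)

lemma holo_on_add:
  assumes "f holo_on S" "g holo_on S" shows "(\<lambda>x. f x + g x) holo_on S"
  using assms unfolding holo_on_def by (blast intro: complex_linear_add has_derivative_add)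

lemma holo_on_compose:
  assumes "f holo_on T" "g holo_on S" "\<And>x. x \<in> S \<Longrightarrow> g x \<in> T"
  shows "(\<lambda>x. f (g x)) holo_on S"
  unfolding holo_on_def
proof
  fix x assume x: "x \<in> S"
  obtain g' where g: "complex_linear g'" "(g has_derivative g') (at x)"
    using assms(2) x unfolding holo_on_def by blast
  obtain f' where f: "complex_linear f'" "(f has_derivative f') (at (g x))"
    using assms(1) assms(3)[OF x] unfolding holo_on_def by blast
  show "\<exists>h'. complex_linear h' \<and> ((\<lambda>x. f (g x)) has_derivative h') (at x)"
    using complex_linear_compose[OF f(1) g(1)] has_derivative_compose[OF g(2) f(2)] by blast
qed

lemma dird_compose:
  assumes "f holo_on T" "(g has_derivative g') (at x)" "complex_linear g'" "g x \<in> T"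
  shows "dird v (\<lambda>x. f (g x)) x = dird (g' v) f (g x)"
proof -
  have "((\<lambda>x. f (g x)) has_derivative (\<lambda>v. dird (g' v) f (g x))) (at x)"
    using has_derivative_compose[OF assms(2) holo_on_has_derivative(1)[OF assms(1,4)]] .
  moreover have "complex_linear (\<lambda>v. dird (g' v) f (g x))"
    using complex_linear_compose[OF holo_on_has_derivative(2)[OF assms(1,4)] assms(3)] .
  ultimately show ?thesis by (rule dird_eq)
qed

lemma dird_linear_map: "complex_linear f \<Longrightarrow> dird v f x = f v"
  by (rule dird_eq) (auto simp: complex_linear_def bounded_linear_imp_has_derivative)

lemma dird_const [simp]: "dird v (\<lambda>x. c) x = 0"
  by (simp add: dird_def)

lemma dird_line_0:
  assumes "f holo_on S" "x \<in> S"
  shows "((\<lambda>t. f (x + t *\<^sub>C v)) has_field_derivative dird v f x) (at 0)"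
  using line_has_field_derivative[OF holo_on_imp_line_holo_on[OF assms(1)], of x 0 v] assms(2) by simp

context
  fixes f g :: "'a::complex_space \<Rightarrow> complex" and S
  assumes f: "f holo_on S" and g: "g holo_on S"
begin

lemma holo_on_mult:
  shows "(\<lambda>x. f x * g x) holo_on S"
  unfolding holo_on_def
proof
  fix x assume x: "x \<in> S"
  show "\<exists>f'. complex_linear f' \<and> ((\<lambda>x. f x * g x) has_derivative f') (at x)"
    by (intro exI[of _ "\<lambda>h. f x * dird h g x + dird h f x * g x"] conjI has_derivative_mult holo_on_has_derivative(1)[OF f x] holo_on_has_derivative(1)[OF g x])
      (use holo_on_has_derivative(2)[OF f x] holo_on_has_derivative(2)[OF g x] in
        \<open>auto simp: mult.commute[of "dird _ f x"] intro!: complex_linear_intros\<close>)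
qed

lemma dird_mult:
  "x \<in> S \<Longrightarrow> dird v (\<lambda>x. f x * g x) x = f x * dird v g x + dird v f x * g x"
  using DERIV_mult[OF dird_line_0[OF f, of x v] dird_line_0[OF g, of x v]]
  unfolding dird_def[of v "\<lambda>x. f x * g x"] by (auto simp: algebra_simps intro!: DERIV_imp_deriv)

lemma dird_add_fun: "x \<in> S \<Longrightarrow> dird v (\<lambda>x. f x + g x) x = dird v f x + dird v g x"
  using DERIV_add[OF dird_line_0[OF f, of x v] dird_line_0[OF g, of x v]]
  unfolding dird_def[of v "\<lambda>x. f x + g x"] by (intro DERIV_imp_deriv)

end

lemma holo_on_cmult: "f holo_on S \<Longrightarrow> (\<lambda>x. c * f x :: complex) holo_on S"
  by (rule holo_on_mult[OF holo_on_const])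

lemma holo_on_diff:
  assumes "f holo_on S" "g holo_on S" shows "(\<lambda>x. f x - g x :: complex) holo_on S"
  using holo_on_add[OF assms(1) holo_on_cmult[OF assms(2), of "-1"]] by simp

lemma dird_cmult: "f holo_on S \<Longrightarrow> x \<in> S \<Longrightarrow> dird v (\<lambda>x. c * f x) x = c * dird v f x"
  using dird_mult[OF holo_on_const, of f S x v c] by simp

lemma dird_diff_fun:
  assumes "f holo_on S" "g holo_on S" "x \<in> S"
  shows "dird v (\<lambda>x. f x - g x) x = dird v f x - dird v g x"
  using dird_add_fun[OF assms(1) holo_on_cmult[OF assms(2), of "-1"] assms(3), of v] dird_cmult[OF assms(2,3), of v "-1"]
  by simp

lemma holo_on_sum:
  assumes "\<And>i. i \<in> I \<Longrightarrow> f i holo_on S" shows "(\<lambda>x. \<Sum>i\<in>I. f i x) holo_on S"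
  using assms by (induction I rule: infinite_finite_induct) (auto intro: holo_on_add)

lemma dird_sum_fun:
  assumes "\<And>i. i \<in> I \<Longrightarrow> (f i :: _ \<Rightarrow> complex) holo_on S" "x \<in> S"
  shows "dird v (\<lambda>x. \<Sum>i\<in>I. f i x) x = (\<Sum>i\<in>I. dird v (f i) x)"
  using assms by (induction I rule: infinite_finite_induct) (auto simp: dird_add_fun[where S = S] holo_on_sum)

lemma holo_on_prod:
  assumes "\<And>i. i \<in> I \<Longrightarrow> (f i :: _ \<Rightarrow> complex) holo_on S" shows "(\<lambda>x. \<Prod>i\<in>I. f i x) holo_on S"
  using assms by (induction I rule: infinite_finite_induct) (auto intro: holo_on_mult)

lemma holo_on_power:
  assumes "f holo_on S" shows "(\<lambda>x. f x ^ n :: complex) holo_on S"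
  by (induction n) (auto intro: holo_on_mult assms)

lemma dird_sum_direction:
  assumes "f holo_on S" "x \<in> S"
  shows "dird (\<Sum>i\<in>I. v i) f x = (\<Sum>i\<in>I. dird (v i) f x)"
  by (rule linear_sum) (use holo_on_has_derivative(2)[OF assms] in \<open>simp add: complex_linear_def bounded_linear.linear\<close>)

lemma dird_direction:
  assumes "f holo_on S" "x \<in> S"
  shows "dird (u + v) f x = dird u f x + dird v f x" "dird (c *\<^sub>C v) f x = c * dird v f x"
    "dird (r *\<^sub>R v) f x = of_real r * dird v f x" "dird (u - v) f x = dird u f x - dird v f x"
    "dird (- v) f x = - dird v f x"
proof -
  have cl: "dird (c *\<^sub>C v) f x = c * dird v f x" for c v
    using holo_on_has_derivative(2)[OF assms] by (simp add: complex_linear_def cscale_complex_def)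
  interpret linear "\<lambda>v. dird v f x"
    using holo_on_has_derivative(2)[OF assms] by (simp add: complex_linear_def bounded_linear.linear)
  show "dird (u + v) f x = dird u f x + dird v f x" "dird (c *\<^sub>C v) f x = c * dird v f x"
    "dird (r *\<^sub>R v) f x = of_real r * dird v f x" "dird (u - v) f x = dird u f x - dird v f x"
    "dird (- v) f x = - dird v f x"
    by (auto simp: cl add scaleR diff neg scaleR_conv_of_real)
qed

lemma dird_cong:
  assumes "open S" "x \<in> S" "\<And>y. y \<in> S \<Longrightarrow> f y = g y"
  shows "dird v f x = dird v g x"
proof -
  obtain e where e: "e > 0" "ball x e \<subseteq> S" using assms openE by blast
  obtain s where s: "s > 0" "\<And>t. cmod t \<le> s \<Longrightarrow> norm (t *\<^sub>C v) < e"
    using small_on_line[OF e(1), of v] by blast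
  have "\<forall>\<^sub>F t in nhds 0. t \<in> ball 0 s" using s(1) by (intro eventually_nhds_in_open) auto
  then have "\<forall>\<^sub>F t in nhds 0. f (x + t *\<^sub>C v) = g (x + t *\<^sub>C v)"
  proof (rule eventually_mono)
    fix t :: complex assume "t \<in> ball 0 s"
    then have "x + t *\<^sub>C v \<in> ball x e" using s(2)[of t] by (simp add: dist_norm)
    then show "f (x + t *\<^sub>C v) = g (x + t *\<^sub>C v)" using e assms by auto
  qed
  then show ?thesis unfolding dird_def by (rule deriv_cong_ev) simp
qed

lemma holo_on_cong:
  assumes "open S" "\<And>x. x \<in> S \<Longrightarrow> f x = g x" "f holo_on S"
  shows "g holo_on S"
  unfolding holo_on_def
proof
  fix x assume x: "x \<in> S"
  then obtain f' where "complex_linear f'" "(f has_derivative f') (at x)"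
    using assms(3) by (auto simp: holo_on_def)
  moreover from this(2) have "(g has_derivative f') (at x)"
    by (rule has_derivative_transform_within_open[OF _ assms(1) x assms(2)])
  ultimately show "\<exists>f'. complex_linear f' \<and> (g has_derivative f') (at x)" by blast
qed

section \<open>The totally real subspace\<close>

definition vec_cnj :: "complex^'n \<Rightarrow> complex^'n::finite" where
  "vec_cnj z = (\<chi> i. cnj (z $ i))"

definition emb :: "complex^'n::finite \<Rightarrow> (complex^'n) \<times> (complex^'n)" where
  "emb z = (z, vec_cnj z)"

lemma vec_cnj_nth [simp]: "vec_cnj z $ i = cnj (z $ i)"
  by (simp add: vec_cnj_def)

lemma norm_vec_cnj [simp]: "norm (vec_cnj z) = norm z"
  by (simp add: norm_vec_def)

lemma vec_cnj_vec_cnj [simp]: "vec_cnj (vec_cnj z) = z"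
  by (simp add: vec_eq_iff)

lemma bounded_linear_vec_cnj: "bounded_linear vec_cnj"
  by (auto intro!: linear_conv_bounded_linear[THEN iffD1] linearI simp: vec_eq_iff)

lemma bounded_linear_emb: "bounded_linear emb"
  unfolding emb_def by (intro bounded_linear_Pair bounded_linear_ident bounded_linear_vec_cnj)

lemma emb_simps: "emb (x + y) = emb x + emb y" "emb (r *\<^sub>R x) = r *\<^sub>R emb x" "emb 0 = 0"
  "emb (x - y) = emb x - emb y"
  by (simp_all add: emb_def vec_eq_iff zero_prod_def)

lemma norm_emb_le: "norm (emb z) \<le> 2 * norm z"
  using norm_Pair_le[of z "vec_cnj z"] by (simp add: emb_def)

lemma norm_le_norm_emb: "norm z \<le> norm (emb z)"
  using norm_fst_le[of z "vec_cnj z"] by (simp add: emb_def)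

lemma vec_cnj_cscale: "vec_cnj (c *\<^sub>C z) = cnj c *\<^sub>C vec_cnj z"
  by (simp add: vec_eq_iff cscale_vec_def cscale_complex_def)

text \<open>The image of \<open>emb\<close> is a real form of the doubled space: x = (z + cnj
  \<zeta>)/2 and y = (z - cnj \<zeta>)/(2i). Information on the totally real subspace therefore
  spreads to all complex directions; the norm bounds keep \<open>emb x\<close> in a comparable
  ball.\<close>

lemma emb_complexify:
  obtains x y where "p = emb x + \<i> *\<^sub>C emb y" "norm x \<le> norm p" "norm y \<le> norm p"
proof -
  obtain z \<zeta> where p: "p = (z, \<zeta>)" by (cases p)
  define x where "x = (1/2) *\<^sub>C (z + vec_cnj \<zeta>)"
  define y where "y = (-\<i>/2) *\<^sub>C (z - vec_cnj \<zeta>)"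
  have z: "norm z \<le> norm p" "norm \<zeta> \<le> norm p"
    using norm_fst_le[of z \<zeta>] norm_snd_le[of \<zeta> z] by (auto simp: p)
  have "p = emb x + \<i> *\<^sub>C emb y"
    by (simp add: p emb_def x_def y_def cscale_prod_def cscale_vec_def cscale_complex_def vec_eq_iff field_simps)
  moreover have "norm x \<le> norm p" "norm y \<le> norm p"
    using norm_triangle_ineq[of z "vec_cnj \<zeta>"] norm_triangle_ineq4[of z "vec_cnj \<zeta>"] z
    by (auto simp: x_def y_def norm_cscale norm_divide)
  ultimately show ?thesis by (rule that)
qed

text \<open>Restrict to a complex line through two points of the totally real subspace and apply the
  identity theorem in one variable.\<close>

lemma holo_on_vanishing_on_emb:
  assumes f: "f holo_on ball 0 r" and 0: "\<And>z. emb z \<in> ball 0 r \<Longrightarrow> f (emb z) = 0"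
    and p: "p \<in> ball 0 (r/2)"
  shows "f p = (0 :: complex)"
proof -
  obtain x y where xy: "p = emb x + \<i> *\<^sub>C emb y" "norm x \<le> norm p"
    by (rule emb_complexify)
  \<comment> \<open>Parameters of a complex line: the real ones give points of the totally real
    subspace, and t = i gives p.\<close>
  define T where "T = {t. emb x + t *\<^sub>C emb y \<in> ball 0 r}"
  have h: "(\<lambda>t. f (emb x + t *\<^sub>C emb y)) holomorphic_on T"
    by (rule line_holomorphic_on[OF holo_on_imp_line_holo_on[OF f]]) (auto simp: T_def)
  have "p \<in> ball 0 r"
    using p norm_ge_zero[of p] by (simp del: norm_ge_zero)
  then have "\<i> \<in> T"
    using xy by (simp add: T_def)
  have oT: "open T"
    unfolding T_def by (intro open_vimage[unfolded vimage_def] open_ball continuous_intros)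
  have "convex T"
  proof (rule convexI)
    fix s t :: complex and u v :: real
    assume st: "s \<in> T" "t \<in> T" and uv: "0 \<le> u" "0 \<le> v" "u + v = 1"
    have "u *\<^sub>R (emb x + s *\<^sub>C emb y) + v *\<^sub>R (emb x + t *\<^sub>C emb y) \<in> ball 0 r"
      using st uv convex_ball unfolding T_def by (intro convexD) auto
    moreover have "u *\<^sub>R (emb x + s *\<^sub>C emb y) + v *\<^sub>R (emb x + t *\<^sub>C emb y)
       = (u + v) *\<^sub>R emb x + (u *\<^sub>R s + v *\<^sub>R t) *\<^sub>C emb y"
      by (simp add: algebra_simps scaleR_cscale cscale_add_left scaleR_conv_of_real)
    ultimately show "u *\<^sub>R s + v *\<^sub>R t \<in> T"
      using uv by (simp add: T_def)
  qed
  \<comment> \<open>\<open>emb\<close> at most doubles norms, which is why p is confined to half the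
    radius.\<close>
  moreover have "0 \<in> T"
    using norm_emb_le[of x] xy(2) p by (simp add: T_def)
  moreover have "0 islimpt (T \<inter> \<real>)"
    unfolding islimpt_approachable
  proof (intro allI impI)
    fix e :: real assume "e > 0"
    obtain d where d: "d > 0" "ball 0 d \<subseteq> T" using oT \<open>0 \<in> T\<close> openE by blast
    let ?s = "of_real (min e d / 2) :: complex"
    have "?s \<in> T" using d \<open>e > 0\<close> by (intro subsetD[OF d(2)]) auto
    then show "\<exists>t\<in>T \<inter> \<real>. t \<noteq> 0 \<and> dist t 0 < e"
      using d \<open>e > 0\<close> by (intro bexI[of _ ?s]) auto
  qed
  moreover have "f (emb x + t *\<^sub>C emb y) = 0" if t: "t \<in> T \<inter> \<real>" for t
  proof -
    obtain s where s: "t = of_real s" using t by (auto elim: Reals_cases)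
    have "emb x + t *\<^sub>C emb y = emb (x + s *\<^sub>R y)"
      by (simp add: s cscale_of_real emb_simps)
    then show ?thesis using 0 t unfolding T_def by auto
  qed
  ultimately have "f (emb x + \<i> *\<^sub>C emb y) = 0"
    using \<open>\<i> \<in> T\<close> by (intro analytic_continuation[OF h oT convex_connected, of "T \<inter> \<real>" 0 \<i>])
      auto
  then show ?thesis using xy by simp
qed

text \<open>The reflection across the totally real subspace: an antilinear involution whose fixed
  points are exactly the points \<open>emb z\<close>.\<close>

definition conj_swap :: "(complex^'n) \<times> (complex^'n) \<Rightarrow> (complex^'n::finite) \<times> (complex^'n)" where
  "conj_swap p = (vec_cnj (snd p), vec_cnj (fst p))"

lemma conj_swap_emb [simp]: "conj_swap (emb z) = emb z"
  by (simp add: conj_swap_def emb_def)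

lemma norm_conj_swap [simp]: "norm (conj_swap p) = norm p"
  by (simp add: conj_swap_def norm_prod_def add.commute)

lemma bounded_linear_conj_swap: "bounded_linear conj_swap"
  unfolding conj_swap_def
  by (intro bounded_linear_Pair bounded_linear_compose[OF bounded_linear_vec_cnj] bounded_linear_fst bounded_linear_snd)

text \<open>Two conjugations cancel: \<open>cnj\<close> outside and \<open>conj_swap\<close> inside
  are both antilinear, so the differential of the composite is complex linear again.\<close>

lemma holo_on_conj_swap:
  fixes f :: "(complex^'n::finite) \<times> (complex^'n) \<Rightarrow> complex"
  assumes "f holo_on ball 0 r"
  shows "(\<lambda>p. cnj (f (conj_swap p))) holo_on ball 0 r"
  unfolding holo_on_def
proof
  fix p :: "(complex^'n) \<times> (complex^'n)" assume "p \<in> ball 0 r"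
  then have p: "conj_swap p \<in> ball 0 r" by simp
  let ?f' = "\<lambda>v. dird v f (conj_swap p)"
  have "((\<lambda>p. cnj (f (conj_swap p))) has_derivative (\<lambda>v. cnj (?f' (conj_swap v)))) (at p)"
    by (intro bounded_linear.has_derivative[OF bounded_linear_cnj]
        has_derivative_compose[OF bounded_linear_imp_has_derivative[OF bounded_linear_conj_swap]]
        holo_on_has_derivative(1)[OF assms p])
  moreover have "complex_linear (\<lambda>v. cnj (?f' (conj_swap v)))"
    unfolding complex_linear_def
  proof (intro conjI allI)
    show "bounded_linear (\<lambda>v. cnj (?f' (conj_swap v)))"
      using holo_on_has_derivative(2)[OF assms p]
      by (intro bounded_linear_compose[OF bounded_linear_cnj] bounded_linear_compose[OF _ bounded_linear_conj_swap])
        (simp add: complex_linear_def)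
    show "cnj (?f' (conj_swap (c *\<^sub>C v))) = c *\<^sub>C cnj (?f' (conj_swap v))" for c v
    proof -
      have "conj_swap (c *\<^sub>C v) = cnj c *\<^sub>C conj_swap v"
        by (simp add: conj_swap_def cscale_prod_def vec_cnj_cscale)
      then show ?thesis
        using dird_direction(2)[OF assms p] by (simp add: cscale_complex_def)
    qed
  qed
  ultimately show "\<exists>f'. complex_linear f' \<and> ((\<lambda>p. cnj (f (conj_swap p))) has_derivative f') (at p)" by blast
qed

section \<open>Real-analytic functions and their holomorphic extensions\<close>

text \<open>The complex linear extension, from the totally real subspace, of the real functional
  with values \<open>h \<bullet> b\<close>: the real part of cnj b * h in each coordinate, with cnj
  h replaced by \<zeta>.\<close>

definition lin_ext :: "complex^'n \<Rightarrow> (complex^'n::finite) \<times> (complex^'n) \<Rightarrow> complex" where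
  "lin_ext b p = (1/2) * (\<Sum>j\<in>UNIV. cnj (b $ j) * fst p $ j + b $ j * snd p $ j)"

lemma complex_linear_lin_ext: "complex_linear (lin_ext b)"
  unfolding lin_ext_def by (intro complex_linear_intros)

lemma lin_ext_emb: "lin_ext b (emb h) = of_real (h \<bullet> b)"
proof -
  have "(1/2) * (cnj (b $ j) * h $ j + b $ j * cnj (h $ j)) = of_real (h $ j \<bullet> b $ j)" for j
    by (simp add: complex_eq_iff inner_complex_def)
  then show ?thesis
    by (simp add: lin_ext_def emb_def inner_vec_def sum_distrib_left del: mult_eq_0_iff)
qed

lemma norm_lin_ext_le:
  fixes b :: "complex^'n::finite"
  assumes "b \<in> Basis" shows "cmod (lin_ext b p) \<le> norm p"
proof -
  obtain i u where b: "b = axis i u" "u \<in> Basis"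
    using assms by (auto simp: Basis_vec_def)
  have u: "cmod u = 1" using b(2) by (auto simp: Basis_complex_def)
  have *: "(\<Sum>j\<in>UNIV. f j (axis i u $ j)) = f i u" if "\<And>j. f j 0 = 0" for f :: "'n \<Rightarrow> complex \<Rightarrow> complex"
  proof -
    have "(\<Sum>j\<in>UNIV. f j (axis i u $ j)) = (\<Sum>j\<in>UNIV. if j = i then f i u else 0)"
      by (rule sum.cong) (auto simp: axis_def that)
    then show ?thesis by simp
  qed
  have "lin_ext b p = (1/2) * (cnj u * fst p $ i + u * snd p $ i)"
    unfolding lin_ext_def b using *[of "\<lambda>j c. cnj c * fst p $ j + c * snd p $ j"] by simp
  then have "cmod (lin_ext b p) = (1/2) * cmod (cnj u * fst p $ i + u * snd p $ i)"
    by (simp only: norm_mult) simp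
  also have "\<dots> \<le> (1/2) * (cmod (fst p $ i) + cmod (snd p $ i))"
    using norm_triangle_ineq[of "cnj u * fst p $ i" "u * snd p $ i"] u by (simp add: norm_mult)
  also have "\<dots> \<le> (1/2) * (norm p + norm p)"
    using norm_fst_le[of "fst p" "snd p"] norm_snd_le[of "snd p" "fst p"]
      Finite_Cartesian_Product.norm_nth_le[of "fst p" i] Finite_Cartesian_Product.norm_nth_le[of "snd p" i] by simp
  finally show ?thesis by simp
qed

lemma real_analytic_on_bounded_linear:
  assumes "real_analytic_on f S" "bounded_linear L"
  shows "real_analytic_on (\<lambda>x. L (f x)) S"
  unfolding real_analytic_on_def
proof
  fix x assume "x \<in> S"
  then obtain r c where r: "r > 0" and c: "\<And>h. norm h < r \<Longrightarrow>
      ((\<lambda>\<alpha>. (\<Prod>b\<in>Basis. (h \<bullet> b) ^ \<alpha> b) *\<^sub>R c \<alpha>) has_sum f (x + h)) (Basis \<rightarrow>\<^sub>E UNIV)"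
    using assms(1) unfolding real_analytic_on_def by blast
  have "((\<lambda>\<alpha>. (\<Prod>b\<in>Basis. (h \<bullet> b) ^ \<alpha> b) *\<^sub>R L (c \<alpha>)) has_sum L (f (x + h))) (Basis \<rightarrow>\<^sub>E UNIV)"
    if "norm h < r" for h
    using has_sum_bounded_linear[OF assms(2) c[OF that]] bounded_linear.linear[OF assms(2)]
    by (simp add: linear_scale)
  then show "\<exists>r>0. \<exists>c. \<forall>h. norm h < r \<longrightarrow>
      ((\<lambda>\<alpha>. (\<Prod>b\<in>Basis. (h \<bullet> b) ^ \<alpha> b) *\<^sub>R c \<alpha>) has_sum L (f (x + h))) (Basis \<rightarrow>\<^sub>E UNIV)"
    using r by (intro exI[of _ r] conjI exI[of _ "\<lambda>\<alpha>. L (c \<alpha>)"]) auto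
qed

text \<open>In the power series each real coordinate is replaced by its complex linear extension. On
  the ball of radius s the terms are dominated by those of the original series at the real point
  whose coordinates all equal s. That series converges absolutely, so the Weierstrass test
  applies.\<close>

lemma real_analytic_on_imp_holo_ext:
  fixes f :: "complex^'n::finite \<Rightarrow> complex"
  assumes "real_analytic_on f S" "x \<in> S"
  obtains r F where "r > 0" "F holo_on ball 0 r" "\<And>h. emb h \<in> ball 0 r \<Longrightarrow> F (emb h) = f (x + h)"
proof -
  obtain r and c :: "(complex^'n \<Rightarrow> nat) \<Rightarrow> complex" where r: "r > 0" and c: "\<And>h. norm h < r \<Longrightarrow>
      ((\<lambda>\<alpha>. (\<Prod>b\<in>Basis. (h \<bullet> b) ^ \<alpha> b) *\<^sub>R c \<alpha>) has_sum f (x + h)) (Basis \<rightarrow>\<^sub>E UNIV)"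
    using assms unfolding real_analytic_on_def by blast
  define N where "N = real (card (Basis :: (complex^'n) set))"
  have N: "N \<ge> 1" unfolding N_def using DIM_positive[where 'a = "complex^'n"] by linarith
  \<comment> \<open>The point with all coordinates s has norm at most N s = r/2, hence lies in the
    domain of convergence.\<close>
  define s where "s = r / (2 * N)"
  have s: "s > 0" "s \<le> r" "N * s < r"
    using r N mult_left_mono[of 1 N r] by (auto simp: s_def field_simps)
  define h0 :: "complex^'n" where "h0 = (\<Sum>b\<in>Basis. s *\<^sub>R b)"
  have h0b: "h0 \<bullet> b = s" if "b \<in> Basis" for b
    using that by (simp add: h0_def inner_sum_left inner_Basis if_distrib cong: if_cong)
  have "norm h0 \<le> (\<Sum>b\<in>(Basis::(complex^'n) set). s)"
    unfolding h0_def by (rule sum_norm_le) (use s in simp)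
  also have "\<dots> = N * s" by (simp add: N_def)
  finally have "norm h0 < r" using s by simp
  define M where "M \<alpha> = norm ((\<Prod>b\<in>Basis. s ^ \<alpha> b) *\<^sub>R c \<alpha>)" for \<alpha>
  let ?I = "(Basis :: (complex^'n) set) \<rightarrow>\<^sub>E (UNIV :: nat set)"
  have "((\<lambda>\<alpha>. (\<Prod>b\<in>Basis. s ^ \<alpha> b) *\<^sub>R c \<alpha>) has_sum f (x + h0)) ?I"
    using c[OF \<open>norm h0 < r\<close>] by (simp add: h0b)
  then have "(\<lambda>\<alpha>. (\<Prod>b\<in>Basis. s ^ \<alpha> b) *\<^sub>R c \<alpha>) summable_on ?I"
    by (auto simp: summable_on_def)
  then have M: "M summable_on ?I"
    unfolding M_def by (simp only: summable_on_iff_abs_summable_on_complex)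
  define T where "T \<alpha> p = (\<Prod>b\<in>Basis. lin_ext b p ^ \<alpha> b) * c \<alpha>" for \<alpha> p
  define F where "F p = (\<Sum>\<^sub>\<infinity>\<alpha>\<in>?I. T \<alpha> p)" for p
  have TM: "norm (T \<alpha> p) \<le> M \<alpha>" if "p \<in> ball 0 s" for \<alpha> p
  proof -
    have "cmod (lin_ext b p ^ \<alpha> b) \<le> s ^ \<alpha> b" if "b \<in> Basis" for b
      using norm_lin_ext_le[OF that, of p] \<open>p \<in> ball 0 s\<close> unfolding norm_power by (intro power_mono) auto
    then have "cmod (\<Prod>b\<in>Basis. lin_ext b p ^ \<alpha> b) \<le> (\<Prod>b\<in>Basis. s ^ \<alpha> b)"
      unfolding prod_norm[symmetric] by (intro prod_mono) auto
    then show ?thesis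
      using s by (auto simp: T_def M_def norm_mult abs_mult abs_prod intro!: mult_right_mono order_trans[OF _ abs_ge_self])
  qed
  have ulim: "uniform_limit (ball 0 s) (\<lambda>A p. \<Sum>\<alpha>\<in>A. T \<alpha> p) F (finite_subsets_at_top ?I)"
    unfolding F_def by (rule Weierstrass_m_test_general[OF TM M])
  have "F line_holo_on ball 0 s"
  proof (rule line_holo_on_uniform_limit[OF finite_subsets_at_top_neq_bot])
    fix p :: "(complex^'n) \<times> (complex^'n)" assume "p \<in> ball 0 s"
    then obtain e where e: "e > 0" "ball p e \<subseteq> ball 0 s"
      using openE[OF open_ball] by blast
    have "(\<lambda>p. \<Sum>\<alpha>\<in>A. T \<alpha> p) line_holo_on ball p e" for A
      unfolding T_def
      by (intro holo_on_imp_line_holo_on holo_on_sum holo_on_mult holo_on_prod holo_on_power holo_on_const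
          complex_linear_imp_holo_on complex_linear_lin_ext)
    then show "\<exists>r>0. (\<forall>\<^sub>F A in finite_subsets_at_top ?I. (\<lambda>p. \<Sum>\<alpha>\<in>A. T \<alpha> p) line_holo_on ball p r) \<and>
       uniform_limit (ball p r) (\<lambda>A p. \<Sum>\<alpha>\<in>A. T \<alpha> p) F (finite_subsets_at_top ?I)"
      using uniform_limit_on_subset[OF ulim e(2)] e(1) by auto
  qed
  then have hF: "F holo_on ball 0 s" by (rule line_holo_on_imp_holo_on) simp
  have "F (emb h) = f (x + h)" if "emb h \<in> ball 0 s" for h
  proof -
    have "norm h < r" using that norm_le_norm_emb[of h] s by simp
    have "T \<alpha> (emb h) = (\<Prod>b\<in>Basis. (h \<bullet> b) ^ \<alpha> b) *\<^sub>R c \<alpha>" for \<alpha>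
      by (simp add: T_def lin_ext_emb scaleR_conv_of_real)
    then show ?thesis
      unfolding F_def using infsumI[OF c[OF \<open>norm h < r\<close>]] by simp
  qed
  then show ?thesis using that[OF s(1) hF] by blast
qed

text \<open>Applied twice to the same sum over words: grouped by length it is the Taylor series
  along a line, grouped by letter counts it is a power series in several real variables.\<close>

lemma has_sum_lists_fibres:
  fixes T :: "'a list \<Rightarrow> complex"
  assumes T: "(T has_sum S) (lists A)" and "\<phi> ` lists A \<subseteq> K"
    and fin: "\<And>k. k \<in> K \<Longrightarrow> finite {w \<in> lists A. \<phi> w = k}"
  shows "((\<lambda>k. \<Sum>w\<in>{w \<in> lists A. \<phi> w = k}. T w) has_sum S) K"
proof -
  have "bij_betw snd (SIGMA k:K. {w \<in> lists A. \<phi> w = k}) (lists A)"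
    using assms(2) by (auto intro!: bij_betwI[where g = "\<lambda>w. (\<phi> w, w)"])
  then have "((\<lambda>x. T (snd x)) has_sum S) (SIGMA k:K. {w \<in> lists A. \<phi> w = k})"
    using has_sum_reindex_bij_betw T by blast
  then show ?thesis
    by (rule has_sum_SigmaD) (use fin in auto)
qed

text \<open>There are \<open>card A ^ k\<close> words of length k, so together they contribute at
  most M (card A * q)^k \<le> M / 2^k.\<close>

lemma summable_on_lists:
  fixes T :: "'a list \<Rightarrow> complex"
  assumes A: "finite A" and T: "\<And>w. w \<in> lists A \<Longrightarrow> cmod (T w) \<le> M * q ^ length w"
    and q: "q \<ge> 0" "real (card A) * q \<le> 1/2" and M: "M \<ge> 0"
  shows "T summable_on lists A"
proof (rule abs_summable_summable, rule nonneg_bdd_above_summable_on)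
  show "bdd_above (sum (\<lambda>w. cmod (T w)) ` {F. F \<subseteq> lists A \<and> finite F})"
  proof (rule bdd_aboveI2)
    fix F assume F: "F \<in> {F. F \<subseteq> lists A \<and> finite F}"
    define W where "W k = {w. set w \<subseteq> A \<and> length w = k}" for k
    have fW: "finite (W k)" for k unfolding W_def by (rule finite_lists_length_eq[OF A])
    obtain K where K: "length ` F \<subseteq> {..<K}"
      using F finite_nat_iff_bounded[of "length ` F"] by auto
    have "(\<Sum>w\<in>F. cmod (T w)) \<le> (\<Sum>w\<in>(\<Union>k<K. W k). cmod (T w))"
    proof (rule sum_mono2)
      show "F \<subseteq> (\<Union>k<K. W k)"
      proof
        fix w assume "w \<in> F"
        then have "w \<in> lists A" "length w < K" using F K by auto
        then show "w \<in> (\<Union>k<K. W k)" by (auto simp: W_def)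
      qed
    qed (use fW in auto)
    also have "\<dots> = (\<Sum>k<K. \<Sum>w\<in>W k. cmod (T w))"
      using fW by (intro sum.UNION_disjoint) (auto simp: W_def)
    also have "\<dots> \<le> (\<Sum>k<K. M * (1/2) ^ k)"
    proof (rule sum_mono)
      fix k
      have "(\<Sum>w\<in>W k. cmod (T w)) \<le> (\<Sum>w\<in>W k. M * q ^ k)"
        by (rule sum_mono) (use T in \<open>auto simp: W_def\<close>)
      also have "\<dots> = M * (real (card A) * q) ^ k"
        using card_lists_length_eq[OF A, of k] by (simp add: W_def power_mult_distrib)
      also have "\<dots> \<le> M * (1/2) ^ k"
        using q M by (intro mult_left_mono power_mono) auto
      finally show "(\<Sum>w\<in>W k. cmod (T w)) \<le> M * (1/2) ^ k" .
    qed
    also have "\<dots> = M * (\<Sum>k<K. (1/2) ^ k)" by (simp add: sum_distrib_left)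
    also have "\<dots> \<le> M * 2"
      using M by (intro mult_left_mono) (auto simp: sum_gp_strict)
    finally show "(\<Sum>w\<in>F. cmod (T w)) \<le> M * 2" .
  qed
qed auto

text \<open>The left-hand side is a single term of the exponential series at k. The estimate trades
  the power k^k, which k successive Cauchy estimates produce, for k! and a geometric factor.\<close>

lemma power_div_fact_le: "real k ^ k / fact k \<le> exp 1 ^ k"
proof -
  have "(\<Sum>n\<in>{k}. real k ^ n /\<^sub>R fact n) \<le> (\<Sum>n. real k ^ n /\<^sub>R fact n)"
    by (rule sum_le_suminf) (use summable_exp_generic[of "real k"] in auto)
  also have "\<dots> = exp (real k * 1)" by (simp add: exp_def)
  also have "\<dots> = exp 1 ^ k" by (rule exp_of_nat_mult)
  finally show ?thesis by (simp add: divide_inverse mult.commute)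
qed

lemma higher_deriv_line:
  assumes f: "f holo_on S" "open S"
  shows "(dird v ^^ k) f holo_on S"
    and "x + t *\<^sub>C v \<in> S \<Longrightarrow> (deriv ^^ k) (\<lambda>t. f (x + t *\<^sub>C v)) t = (dird v ^^ k) f (x + t *\<^sub>C v)"
proof -
  show h: "(dird v ^^ k) f holo_on S" for k
    by (induction k) (use f holo_on_dird in auto)
  show "(deriv ^^ k) (\<lambda>t. f (x + t *\<^sub>C v)) t = (dird v ^^ k) f (x + t *\<^sub>C v)" if "x + t *\<^sub>C v \<in> S" for t
    using that
  proof (induction k arbitrary: t)
    case (Suc k)
    have "open {t. x + t *\<^sub>C v \<in> S}"
      by (intro open_vimage[unfolded vimage_def] f continuous_intros)
    then have "\<forall>\<^sub>F s in nhds t. s \<in> {t. x + t *\<^sub>C v \<in> S}"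
      using Suc.prems by (intro eventually_nhds_in_open) auto
    then have "\<forall>\<^sub>F s in nhds t. (deriv ^^ k) (\<lambda>t. f (x + t *\<^sub>C v)) s = (dird v ^^ k) f (x + s *\<^sub>C v)"
      by (rule eventually_mono) (use Suc.IH in auto)
    then have "deriv ((deriv ^^ k) (\<lambda>t. f (x + t *\<^sub>C v))) t = deriv (\<lambda>s. (dird v ^^ k) f (x + s *\<^sub>C v)) t"
      by (rule deriv_cong_ev) simp
    also have "\<dots> = dird v ((dird v ^^ k) f) (x + t *\<^sub>C v)"
      by (rule DERIV_imp_deriv[OF line_has_field_derivative[OF holo_on_imp_line_holo_on[OF h] Suc.prems]])
    finally show ?case by simp
  qed simp
qed

text \<open>The Taylor series of the restriction to the line through 0 and v is evaluated at
  parameter 1, which lies inside the parameter disc of radius r / |v|.\<close>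

lemma holo_on_line_power_series:
  assumes f: "f holo_on ball 0 r" and v: "norm v < r"
  shows "(\<lambda>k. (dird v ^^ k) f 0 / fact k) sums f v"
proof -
  define R where "R = (if v = 0 then 2 else r / norm v)"
  have R: "R > 1" using v by (simp add: R_def)
  have sub: "0 + t *\<^sub>C v \<in> ball 0 r" if "t \<in> ball 0 R" for t
    using that v by (auto simp: R_def norm_cscale field_simps split: if_splits)
  have "(\<lambda>t. f (0 + t *\<^sub>C v)) holomorphic_on ball 0 R"
    by (rule line_holomorphic_on[OF holo_on_imp_line_holo_on[OF f] sub])
  from holomorphic_power_series[OF this, of 1]
  have "(\<lambda>n. (deriv ^^ n) (\<lambda>t. f (0 + t *\<^sub>C v)) 0 / fact n) sums f v"
    using R by simp
  then show ?thesis
    using higher_deriv_line(2)[OF f open_ball, of 0 0 v] v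
    by (simp add: order_le_less_trans[OF norm_ge_zero v])
qed

text \<open>Expanding over words rather than multi-indices keeps multinomial coefficients and the
  order of differentiation out of the computation; equal letters are collected only later.\<close>

lemma iterated_dird_expansion:
  assumes f: "f holo_on S" "open S" and A: "finite A"
  shows "foldr dird (map e w) f holo_on S"
    and "p \<in> S \<Longrightarrow> (dird (\<Sum>b\<in>A. c b *\<^sub>R e b) ^^ k) f p
      = (\<Sum>w\<in>{w. set w \<subseteq> A \<and> length w = k}. of_real (\<Prod>b\<leftarrow>w. c b) * foldr dird (map e w) f p)"
proof -
  show h: "foldr dird (map e w) f holo_on S" for w
    by (induction w) (use f holo_on_dird in auto)
  let ?v = "\<Sum>b\<in>A. c b *\<^sub>R e b"
  show "(dird ?v ^^ k) f p
      = (\<Sum>w\<in>{w. set w \<subseteq> A \<and> length w = k}. of_real (\<Prod>b\<leftarrow>w. c b) * foldr dird (map e w) f p)" if "p \<in> S" for p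
    using that
  proof (induction k arbitrary: p)
    case 0
    have "{w. set w \<subseteq> A \<and> length w = 0} = {[]}" by auto
    then show ?case by simp
  next
    case (Suc k)
    let ?W = "\<lambda>k. {w. set w \<subseteq> A \<and> length w = k}"
    have "(dird ?v ^^ Suc k) f p = dird ?v ((dird ?v ^^ k) f) p" by simp
    also have "\<dots> = dird ?v (\<lambda>p. \<Sum>w\<in>?W k. of_real (\<Prod>b\<leftarrow>w. c b) * foldr dird (map e w) f p) p"
      by (rule dird_cong[OF f(2) Suc.prems]) (use Suc.IH in simp)
    also have "\<dots> = (\<Sum>w\<in>?W k. of_real (\<Prod>b\<leftarrow>w. c b) * dird ?v (foldr dird (map e w) f) p)"
      using Suc.prems by (subst dird_sum_fun[where S = S]) (auto simp: dird_cmult[OF h] intro: holo_on_cmult h)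
    also have "\<dots> = (\<Sum>w\<in>?W k. \<Sum>b\<in>A. of_real (\<Prod>b\<leftarrow>b # w. c b) * foldr dird (map e (b # w)) f p)"
      using Suc.prems by (simp add: dird_sum_direction[OF h] dird_direction[OF h] sum_distrib_left mult_ac)
    also have "\<dots> = (\<Sum>(w, b)\<in>?W k \<times> A. of_real (\<Prod>b\<leftarrow>b # w. c b) * foldr dird (map e (b # w)) f p)"
      by (simp only: sum.cartesian_product)
    also have "\<dots> = (\<Sum>w\<in>?W (Suc k). of_real (\<Prod>b\<leftarrow>w. c b) * foldr dird (map e w) f p)"
      by (rule sum.reindex_bij_witness[of _ "\<lambda>w. (tl w, hd w)" "\<lambda>(w, b). b # w"])
        (auto simp: length_Suc_conv)
    finally show ?case .
  qed
qed

text \<open>One Cauchy estimate of radius d per letter. Each letter moves the point by at most d B,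
  so \<open>length w\<close> such moves must fit into the ball.\<close>

lemma iterated_dird_bound:
  fixes d B r M :: real
  assumes f: "f holo_on ball 0 r" and M: "\<And>p. p \<in> ball 0 r \<Longrightarrow> cmod (f p) \<le> M"
    and d: "d > 0" and e: "\<And>b. b \<in> set w \<Longrightarrow> norm (e b) \<le> B"
    and p: "norm p + length w * (d * B) < r"
  shows "cmod (foldr dird (map e w) f p) \<le> M / d ^ length w"
  using e p
proof (induction w arbitrary: p)
  case (Cons b w)
  have h: "foldr dird (map e w) f line_holo_on ball 0 r"
    by (rule holo_on_imp_line_holo_on, rule iterated_dird_expansion(1)[OF f open_ball, of "{}"]) simp
  have t: "norm (p + t *\<^sub>C e b) + length w * (d * B) < r" if "cmod t \<le> d" for t
  proof -
    have "norm (t *\<^sub>C e b) \<le> d * B"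
      unfolding norm_cscale using that d Cons.prems(1) by (intro mult_mono) auto
    then show ?thesis
      using Cons.prems(2) norm_triangle_ineq[of p "t *\<^sub>C e b"] by (simp add: algebra_simps)
  qed
  have B: "B \<ge> 0" using Cons.prems(1)[of b] norm_ge_zero[of "e b"] by (simp del: norm_ge_zero)
  have "cmod (dird (e b) (foldr dird (map e w) f) p) \<le> (M / d ^ length w) / d"
  proof (rule dird_bound[OF h d])
    show "p + t *\<^sub>C e b \<in> ball 0 r" if "cmod t \<le> d" for t
    proof -
      have "0 \<le> length w * (d * B)" using B d by simp
      then show ?thesis using t[OF that] by simp
    qed
    show "cmod (foldr dird (map e w) f (p + t *\<^sub>C e b)) \<le> M / d ^ length w" if "cmod t \<le> d" for t
      by (rule Cons.IH) (use Cons.prems t[OF that] in auto)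
  qed
  then show ?case by (simp add: mult.commute)
qed (use M in simp)


lemma prod_list_eq_prod_count_list:
  fixes g :: "'a \<Rightarrow> real"
  assumes "finite A" "set w \<subseteq> A"
  shows "(\<Prod>b\<leftarrow>w. g b) = (\<Prod>b\<in>A. g b ^ count_list w b)"
  using assms(2)
proof (induction w)
  case (Cons a w)
  have "(\<Prod>b\<in>A. g b ^ count_list (a # w) b) = (\<Prod>b\<in>A. (if b = a then g b else 1) * g b ^ count_list w b)"
    by (rule prod.cong) auto
  also have "\<dots> = g a * (\<Prod>b\<in>A. g b ^ count_list w b)"
    using Cons.prems assms(1) by (simp add: prod.distrib)
  finally show ?case using Cons by simp
qed simp

lemma emb_expansion: "emb h = (\<Sum>b\<in>Basis. (h \<bullet> b) *\<^sub>R emb b)"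
  using linear_sum[OF bounded_linear.linear[OF bounded_linear_emb], of "\<lambda>b. (h \<bullet> b) *\<^sub>R b" Basis]
  by (simp add: emb_simps euclidean_representation)

text \<open>The coefficient of a multi-index collects the iterated derivatives along all words in the basis
  with the corresponding letter counts.\<close>

lemma holo_ext_imp_power_series:
  fixes f :: "complex^'n::finite \<Rightarrow> complex"
  assumes r: "r > 0" and F: "F holo_on ball 0 r" and Ff: "\<And>h. emb h \<in> ball 0 r \<Longrightarrow> F (emb h) = f (x + h)"
  shows "\<exists>r>0. \<exists>c. \<forall>h. norm h < r \<longrightarrow>
        ((\<lambda>\<alpha>. (\<Prod>b\<in>Basis. (h \<bullet> b) ^ \<alpha> b) *\<^sub>R c \<alpha>) has_sum f (x + h)) (Basis \<rightarrow>\<^sub>E UNIV)"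
proof -
  let ?A = "Basis :: (complex^'n) set"
  have "0 \<in> ball (0::(complex^'n) \<times> (complex^'n)) r" using r by simp
  then obtain r1 M where r1: "r1 > 0" "cball 0 r1 \<subseteq> ball (0::(complex^'n) \<times> (complex^'n)) r" "M > 0"
    and M: "\<And>p. p \<in> cball 0 r1 \<Longrightarrow> cmod (F p) \<le> M"
    using continuous_on_locally_bounded[OF holo_on_imp_continuous_on[OF F] open_ball] by blast
  have F1: "F holo_on ball 0 r1" using F r1 by (meson ball_subset_cball holo_on_subset subset_trans)
  define D where "D w = foldr dird (map emb w) F 0" for w
  define a where "a w = D w / fact (length w)" for w
  \<comment> \<open>A word of length k is estimated with discs of radius r1/(4k). Since
    \<open>emb b\<close> has norm at most 2, the k moves use up only r1/2, and the resulting
    (4k/r1)^k / k! is at most K^k.\<close>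
  define K where "K = 4 / r1 * exp 1"
  have K: "K > 0" using r1 by (simp add: K_def)
  have aK: "cmod (a w) \<le> M * K ^ length w" if "w \<in> lists ?A" for w
  proof (cases "w = []")
    case True
    then show ?thesis using M[of 0] r1 by (simp add: a_def D_def)
  next
    case False
    define k where "k = length w"
    have k: "k > 0" using False by (simp add: k_def)
    have "cmod (D w) \<le> M / (r1 / (4 * k)) ^ k"
      unfolding D_def k_def
    proof (rule iterated_dird_bound[OF F1])
      show "norm (emb b) \<le> 2" if "b \<in> set w" for b
        using norm_emb_le[of b] that \<open>w \<in> lists ?A\<close> by (simp add: in_lists_conv_set)
      show "norm (0::(complex^'n) \<times> (complex^'n)) + real (length w) * (r1 / real (4 * length w) * 2) < r1"
        using k r1 by (simp add: k_def)
    qed (use M r1 k in \<open>auto simp: k_def\<close>)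
    also have "\<dots> = M * (4 / r1) ^ k * real k ^ k"
      by (simp add: power_divide power_mult_distrib)
    finally have "cmod (a w) \<le> M * (4 / r1) ^ k * (real k ^ k / fact k)"
      by (simp add: a_def norm_divide k_def divide_right_mono)
    also have "\<dots> \<le> M * (4 / r1) ^ k * exp 1 ^ k"
      using r1 by (intro mult_left_mono power_div_fact_le) auto
    finally show ?thesis by (simp only: K_def power_mult_distrib k_def mult.assoc)
  qed
  define N where "N = real (card ?A)"
  have N: "N > 0" unfolding N_def using DIM_positive[where 'a = "complex^'n"] by linarith
  \<comment> \<open>The first entry keeps \<open>emb h\<close> in the ball of radius r1, the second
    makes the sum over words geometric with ratio at most 1/2.\<close>
  define s where "s = min (r1 / 4) (1 / (2 * N * K))"
  have s: "s > 0" "s \<le> r1 / 4" "N * (K * s) \<le> 1/2"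
    using r1 N K mult_left_mono[of s "1 / (2 * N * K)" "N * K"] by (auto simp: s_def mult.assoc)
  define \<phi> where "\<phi> w = (\<lambda>b\<in>?A. count_list w b)" for w
  define c where "c \<alpha> = (\<Sum>w\<in>{w \<in> lists ?A. \<phi> w = \<alpha>}. a w)" for \<alpha>
  have "((\<lambda>\<alpha>. (\<Prod>b\<in>Basis. (h \<bullet> b) ^ \<alpha> b) *\<^sub>R c \<alpha>) has_sum f (x + h)) (Basis \<rightarrow>\<^sub>E UNIV)"
    if h: "norm h < s" for h
  proof -
    have eh: "norm (emb h) < r1" using norm_emb_le[of h] h s r1 by simp
    define T where "T w = of_real (\<Prod>b\<leftarrow>w. h \<bullet> b) * a w" for w
    have "cmod (T w) \<le> M * (K * s) ^ length w" if w: "w \<in> lists ?A" for w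
    proof -
      have "\<bar>\<Prod>b\<leftarrow>w. h \<bullet> b\<bar> \<le> s ^ length w"
        using w
      proof (induction w)
        case (Cons b w)
        have "\<bar>h \<bullet> b\<bar> \<le> s" using Basis_le_norm[of b h] Cons h by auto
        then show ?case using Cons s by (auto simp: abs_mult intro!: mult_mono)
      qed simp
      then have "cmod (T w) \<le> s ^ length w * (M * K ^ length w)"
        unfolding T_def norm_mult norm_of_real using aK[OF w] s by (intro mult_mono) auto
      then show ?thesis by (simp add: power_mult_distrib mult_ac)
    qed
    then have "T summable_on lists ?A"
      by (rule summable_on_lists[OF finite_Basis]) (use K s r1 in \<open>auto simp: N_def\<close>)
    then obtain S where S: "(T has_sum S) (lists ?A)" by (auto simp: summable_on_def)
    have W: "{w \<in> lists ?A. length w = k} = {w. set w \<subseteq> ?A \<and> length w = k}" for k by auto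
    \<comment> \<open>Grouping by length yields the Taylor series along \<open>emb h\<close>, which
      identifies the total as F (emb h).\<close>
    have "((\<lambda>k. \<Sum>w\<in>{w \<in> lists ?A. length w = k}. T w) has_sum S) UNIV"
      by (rule has_sum_lists_fibres[OF S]) (auto simp: W finite_lists_length_eq)
    moreover have "(\<Sum>w\<in>{w \<in> lists ?A. length w = k}. T w) = (dird (emb h) ^^ k) F 0 / fact k" for k
      using iterated_dird_expansion(2)[OF F1 open_ball finite_Basis, where p = 0 and c = "\<lambda>b. h \<bullet> b" and e = emb and k = k] r1
      by (simp add: W emb_expansion[of h, symmetric] T_def a_def D_def sum_divide_distrib)
    ultimately have "(\<lambda>k. (dird (emb h) ^^ k) F 0 / fact k) sums S"
      by (simp add: has_sum_imp_sums)
    then have "S = F (emb h)"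
      using holo_on_line_power_series[OF F1 eh] sums_unique2 by blast
    also have "\<dots> = f (x + h)"
    proof (rule Ff)
      have "emb h \<in> cball 0 r1" using eh by simp
      then show "emb h \<in> ball 0 r" using r1(2) by (rule set_mp[rotated])
    qed
    finally have "S = f (x + h)" .
    have fin: "finite {w \<in> lists ?A. \<phi> w = \<alpha>}" for \<alpha>
    proof (rule finite_subset)
      show "{w \<in> lists ?A. \<phi> w = \<alpha>} \<subseteq> {w. set w \<subseteq> ?A \<and> length w = (\<Sum>b\<in>?A. \<alpha> b)}"
      proof
        fix w assume w: "w \<in> {w \<in> lists ?A. \<phi> w = \<alpha>}"
        then have "(\<Sum>b\<in>?A. \<alpha> b) = (\<Sum>b\<in>?A. count_list w b)"
          by (intro sum.cong) (auto simp: \<phi>_def)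
        moreover have "set w \<subseteq> ?A" using w by auto
        ultimately show "w \<in> {w. set w \<subseteq> ?A \<and> length w = (\<Sum>b\<in>?A. \<alpha> b)}"
          using sum_count_set[of w ?A] by simp
      qed
    qed (rule finite_lists_length_eq[OF finite_Basis])
    \<comment> \<open>Grouping the same sum by letter counts yields the series over
      multi-indices.\<close>
    have "((\<lambda>\<alpha>. \<Sum>w\<in>{w \<in> lists ?A. \<phi> w = \<alpha>}. T w) has_sum S) (?A \<rightarrow>\<^sub>E UNIV)"
      by (rule has_sum_lists_fibres[OF S _ fin]) (auto simp: \<phi>_def)
    moreover have "(\<Sum>w\<in>{w \<in> lists ?A. \<phi> w = \<alpha>}. T w) = (\<Prod>b\<in>?A. (h \<bullet> b) ^ \<alpha> b) *\<^sub>R c \<alpha>" for \<alpha>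
      unfolding c_def scaleR_conv_of_real sum_distrib_left
    proof (rule sum.cong[OF refl])
      fix w assume w: "w \<in> {w \<in> lists ?A. \<phi> w = \<alpha>}"
      have "(\<Prod>b\<leftarrow>w. h \<bullet> b) = (\<Prod>b\<in>?A. (h \<bullet> b) ^ count_list w b)"
        by (rule prod_list_eq_prod_count_list) (use w in auto)
      also have "\<dots> = (\<Prod>b\<in>?A. (h \<bullet> b) ^ \<alpha> b)"
        by (rule prod.cong) (use w in \<open>auto simp: \<phi>_def\<close>)
      finally show "T w = of_real (\<Prod>b\<in>?A. (h \<bullet> b) ^ \<alpha> b) * a w" by (simp add: T_def)
    qed
    ultimately show ?thesis using \<open>S = f (x + h)\<close> by simp
  qed
  then show ?thesis using s(1) by blast
qed

section \<open>Smoothness\<close>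

lemma Ck_on_cong:
  assumes "open U" "\<And>x. x \<in> U \<Longrightarrow> f x = g x" "Ck_on k f U"
  shows "Ck_on k g U"
  using assms(2,3)
proof (induction k arbitrary: f g)
  case 0
  then show ?case using continuous_on_cong[of U U f g] by simp
next
  case (Suc k)
  have *: "(g has_derivative f') (at x)" if "(f has_derivative f') (at x)" "x \<in> U" for f' x
    by (rule has_derivative_transform_within_open[OF that(1) assms(1) that(2)]) (use Suc.prems in auto)
  have d: "f differentiable at x" if "x \<in> U" for x
    using Suc.prems(2) that assms(1) by (simp add: differentiable_on_eq_differentiable_at)
  have "g differentiable_on U"
    using * d assms(1) by (meson differentiable_def differentiable_on_eq_differentiable_at)
  moreover have "Ck_on k (\<lambda>x. frechet_derivative g (at x) v) U" for v
  proof (rule Suc.IH)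
    show "Ck_on k (\<lambda>x. frechet_derivative f (at x) v) U" using Suc.prems(2) by simp
    show "frechet_derivative f (at x) v = frechet_derivative g (at x) v" if "x \<in> U" for x
      using frechet_derivative_at[OF *[OF frechet_derivative_works[THEN iffD1, OF d[OF that]] that]] by simp
  qed
  ultimately show ?case by simp
qed

lemma Ck_on_add:
  assumes "open U" "Ck_on k f U" "Ck_on k g U"
  shows "Ck_on k (\<lambda>x. f x + g x) U"
  using assms(2,3)
proof (induction k arbitrary: f g)
  case 0
  then show ?case by (simp add: continuous_on_add)
next
  case (Suc k)
  have d: "(f has_derivative frechet_derivative f (at x)) (at x)" "(g has_derivative frechet_derivative g (at x)) (at x)"
    if "x \<in> U" for x
    using Suc.prems that assms(1) by (auto simp: differentiable_on_eq_differentiable_at frechet_derivative_works)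
  have e: "frechet_derivative (\<lambda>x. f x + g x) (at x) = (\<lambda>v. frechet_derivative f (at x) v + frechet_derivative g (at x) v)"
    if "x \<in> U" for x
    using frechet_derivative_at[OF has_derivative_add[OF d[OF that]]] by simp
  have "Ck_on k (\<lambda>x. frechet_derivative (\<lambda>x. f x + g x) (at x) v) U" for v
    by (rule Ck_on_cong[OF assms(1) _ Suc.IH]) (use Suc.prems e in auto)
  then show ?case using Suc.prems by (simp add: differentiable_on_add)
qed

lemma Ck_on_bounded_linear:
  assumes "open U" "bounded_linear L" "Ck_on k f U"
  shows "Ck_on k (\<lambda>x. L (f x)) U"
  using assms(3)
proof (induction k arbitrary: f)
  case 0
  then show ?case using assms(2) by (simp add: linear_continuous_on continuous_on_compose2[OF linear_continuous_on[of L UNIV]])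
next
  case (Suc k)
  have d: "(f has_derivative frechet_derivative f (at x)) (at x)" if "x \<in> U" for x
    using Suc.prems that assms(1) by (auto simp: differentiable_on_eq_differentiable_at frechet_derivative_works)
  have dL: "((\<lambda>x. L (f x)) has_derivative (\<lambda>v. L (frechet_derivative f (at x) v))) (at x)" if "x \<in> U" for x
    by (rule bounded_linear.has_derivative[OF assms(2) d[OF that]])
  have "Ck_on k (\<lambda>x. frechet_derivative (\<lambda>x. L (f x)) (at x) v) U" for v
    by (rule Ck_on_cong[OF assms(1) _ Suc.IH]) (use Suc.prems frechet_derivative_at[OF dL] in \<open>auto simp: fun_eq_iff\<close>)
  moreover have "(\<lambda>x. L (f x)) differentiable_on U"
    using dL assms(1) by (auto simp: differentiable_on_eq_differentiable_at differentiable_def)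
  ultimately show ?case by simp
qed

lemma holo_on_compose_affine_has_derivative:
  assumes "F holo_on S" "bounded_linear e" "e x + a \<in> S"
  shows "((\<lambda>x. F (e x + a)) has_derivative (\<lambda>v. dird (e v) F (e x + a))) (at x)"
proof -
  have "((\<lambda>x. e x + a) has_derivative e) (at x)"
    using has_derivative_add[OF bounded_linear_imp_has_derivative[OF assms(2)] has_derivative_const[of a]] by simp
  then show ?thesis
    by (rule has_derivative_compose) (rule holo_on_has_derivative(1)[OF assms(1,3)])
qed

text \<open>Differentiating along v replaces F by \<open>dird (e v) F\<close>, which is holomorphic
  again, and leaves the affine map as it is; so the induction on the order closes.\<close>

lemma Ck_on_holo_compose_affine:
  fixes F :: "'a::complex_space \<Rightarrow> complex" and e :: "'b::euclidean_space \<Rightarrow> 'a"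
  assumes "F holo_on S" "open S" "bounded_linear e" "open U" "\<And>x. x \<in> U \<Longrightarrow> e x + a \<in> S"
  shows "Ck_on k (\<lambda>x. F (e x + a)) U"
  using assms(1)
proof (induction k arbitrary: F)
  case 0
  have "continuous_on U (\<lambda>x. F (e x + a))"
    by (rule continuous_on_compose2[OF holo_on_imp_continuous_on[OF 0]])
      (use assms in \<open>auto intro!: continuous_intros bounded_linear.continuous_on[OF assms(3)]\<close>)
  then show ?case by simp
next
  case (Suc k)
  have d: "((\<lambda>x. F (e x + a)) has_derivative (\<lambda>v. dird (e v) F (e x + a))) (at x)" if "x \<in> U" for x
    by (rule holo_on_compose_affine_has_derivative[OF Suc.prems assms(3) assms(5)[OF that]])
  have "Ck_on k (\<lambda>x. frechet_derivative (\<lambda>x. F (e x + a)) (at x) v) U" for v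
    by (rule Ck_on_cong[OF assms(4) _ Suc.IH[OF holo_on_dird[OF Suc.prems assms(2), of "e v"]]])
      (use frechet_derivative_at[OF d] in \<open>auto simp: fun_eq_iff\<close>)
  then show ?case
    using d assms(4) by (auto simp: differentiable_on_eq_differentiable_at differentiable_def)
qed

section \<open>Division by a function with transversal zero set\<close>

lemma holo_on_divide:
  fixes f g :: "'a::complex_space \<Rightarrow> complex"
  assumes f: "f holo_on S" and g: "g holo_on S" and "open S" and nz: "\<And>x. x \<in> S \<Longrightarrow> g x \<noteq> 0"
  shows "(\<lambda>x. f x / g x) holo_on S"
proof (rule line_holo_on_imp_holo_on[OF _ \<open>open S\<close>])
  show "(\<lambda>x. f x / g x) line_holo_on S"
    unfolding line_holo_on_def
  proof (intro conjI ballI allI)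
    show "continuous_on S (\<lambda>x. f x / g x)"
      using nz by (intro continuous_intros holo_on_imp_continuous_on f g) auto
    show "(\<lambda>t. f (x + t *\<^sub>C v) / g (x + t *\<^sub>C v)) field_differentiable at 0" if "x \<in> S" for x v
      using dird_line_0[OF f that] dird_line_0[OF g that] nz[OF that]
      by (intro field_differentiable_divide) (auto simp: field_differentiable_def)
  qed
qed

text \<open>On each complex line this is the Leibniz rule. The intended integral is Cauchy's formula
  over a circle carried along with p: \<open>\<kappa>\<close> is the circle relative to p and m the
  kernel.\<close>

lemma holo_on_integral:
  fixes R :: "'a::complex_space \<Rightarrow> complex" and \<kappa> :: "real \<Rightarrow> 'a"
  assumes R: "R holo_on W" "open W" and \<kappa>: "continuous_on {0..1} \<kappa>" and m: "continuous_on {0..1} m"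
    and S: "open S" and W: "\<And>p \<theta>. p \<in> S \<Longrightarrow> \<theta> \<in> {0..1} \<Longrightarrow> p + \<kappa> \<theta> \<in> W"
  shows "(\<lambda>p. integral {0..1} (\<lambda>\<theta>. R (p + \<kappa> \<theta>) * m \<theta>)) holo_on S"
proof (rule line_holo_on_imp_holo_on[OF _ S])
  have cont: "continuous_on (S \<times> {0..1}) (\<lambda>(p, \<theta>). G (p + \<kappa> \<theta>) * m \<theta>)" if "continuous_on W G" for G
    unfolding split_beta
    by (intro continuous_intros continuous_on_compose2[OF that] continuous_on_compose2[OF \<kappa>] continuous_on_compose2[OF m])
      (use W in auto)
  have cont': "continuous_on {0..1} (\<lambda>\<theta>. G (p + \<kappa> \<theta>) * m \<theta>)" if "continuous_on W G" "p \<in> S" for G p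
    by (intro continuous_intros continuous_on_compose2[OF that(1)] \<kappa> m) (use W that in auto)
  show "(\<lambda>p. integral {0..1} (\<lambda>\<theta>. R (p + \<kappa> \<theta>) * m \<theta>)) line_holo_on S"
    unfolding line_holo_on_def
  proof (intro conjI ballI allI)
    show "continuous_on S (\<lambda>p. integral {0..1} (\<lambda>\<theta>. R (p + \<kappa> \<theta>) * m \<theta>))"
      using integral_continuous_on_param[of S 0 1 "\<lambda>p \<theta>. R (p + \<kappa> \<theta>) * m \<theta>"] cont[OF holo_on_imp_continuous_on[OF R(1)]]
      by simp
  next
    fix p v :: 'a assume p: "p \<in> S"
    obtain e where e: "e > 0" "ball p e \<subseteq> S" using openE[OF S p] by blast
    obtain d where d: "d > 0" "\<And>t. cmod t \<le> d \<Longrightarrow> norm (t *\<^sub>C v) < e"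
      using small_on_line[OF e(1), of v] by blast
    have sub: "p + t *\<^sub>C v \<in> S" if "t \<in> ball 0 d" for t
      using d(2)[of t] that by (intro subsetD[OF e(2)]) (simp add: dist_norm)
    have "(\<lambda>t. integral (cbox 0 1) (\<lambda>\<theta>. R (p + t *\<^sub>C v + \<kappa> \<theta>) * m \<theta>)) holomorphic_on ball 0 d"
    proof (rule leibniz_rule_holomorphic)
      fix t \<theta> assume t: "t \<in> ball (0::complex) d" and \<theta>: "\<theta> \<in> cbox 0 (1::real)"
      have "p + \<kappa> \<theta> + t *\<^sub>C v \<in> W" using W[OF sub[OF t], of \<theta>] \<theta> by (simp add: add_ac)
      from line_has_field_derivative[OF holo_on_imp_line_holo_on[OF R(1)] this]
      have "((\<lambda>t. R (p + t *\<^sub>C v + \<kappa> \<theta>)) has_field_derivative dird v R (p + t *\<^sub>C v + \<kappa> \<theta>)) (at t)"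
        by (simp add: add_ac)
      then show "((\<lambda>t. R (p + t *\<^sub>C v + \<kappa> \<theta>) * m \<theta>) has_field_derivative dird v R (p + t *\<^sub>C v + \<kappa> \<theta>) * m \<theta>)
          (at t within ball 0 d)"
        by (rule has_field_derivative_at_within[OF DERIV_cmult_right])
    next
      show "(\<lambda>\<theta>. R (p + t *\<^sub>C v + \<kappa> \<theta>) * m \<theta>) integrable_on cbox 0 1" if "t \<in> ball 0 d" for t
        using cont'[OF holo_on_imp_continuous_on[OF R(1)] sub[OF that]] by (intro integrable_continuous) simp
      have "continuous_on (ball 0 d \<times> {0..1}) (\<lambda>x. (\<lambda>(p, \<theta>). dird v R (p + \<kappa> \<theta>) * m \<theta>) (p + fst x *\<^sub>C v, snd x))"
        by (rule continuous_on_compose2[OF cont[OF holo_on_imp_continuous_on[OF holo_on_dird[OF R]]]])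
          (use sub in \<open>auto intro!: continuous_intros\<close>)
      then show "continuous_on (ball 0 d \<times> cbox 0 1) (\<lambda>(t, \<theta>). dird v R (p + t *\<^sub>C v + \<kappa> \<theta>) * m \<theta>)"
        by (simp add: split_beta)
    qed simp
    then show "(\<lambda>t. integral {0..1} (\<lambda>\<theta>. R (p + t *\<^sub>C v + \<kappa> \<theta>) * m \<theta>)) field_differentiable at 0"
      using d(1) by (simp add: holomorphic_on_open field_differentiable_def)
  qed
qed

text \<open>Strict differentiability at 0: by continuity of the derivative, f minus its linear part
  at 0 has a differential of norm at most \<eta> near 0, and the mean value inequality applies on
  the convex ball.\<close>

lemma holo_on_near_linear:
  fixes f :: "'a::complex_space \<Rightarrow> complex"
  assumes f: "f holo_on ball 0 r" and r: "r > 0" and \<eta>: "\<eta> > 0"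
  obtains R where "R > 0" "R \<le> r"
    "\<And>p p'. p \<in> ball 0 R \<Longrightarrow> p' \<in> ball 0 R \<Longrightarrow> cmod (f p' - f p - dird (p' - p) f 0) \<le> \<eta> * norm (p' - p)"
proof -
  define N where "N = real (card (Basis :: 'a set))"
  have N: "N > 0" unfolding N_def using DIM_positive[where 'a = 'a] by linarith
  have 0: "0 \<in> ball (0::'a) r" using r by simp
  \<comment> \<open>Continuity is used for the finitely many basis directions, with tolerance
    \<eta>/N each, which add up to \<eta>.\<close>
  have "\<forall>\<^sub>F p in nhds 0. \<forall>b\<in>(Basis::'a set). cmod (dird b f p - dird b f 0) < \<eta> / N"
  proof (rule eventually_ball_finite[OF finite_Basis], rule ballI)
    fix b :: 'a
    have "isCont (dird b f) 0"
      using holo_on_imp_continuous_on[OF holo_on_dird[OF f open_ball, of b]] 0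
      by (simp add: continuous_on_eq_continuous_at)
    then have "((\<lambda>p. cmod (dird b f p - dird b f 0)) \<longlongrightarrow> cmod (dird b f 0 - dird b f 0)) (nhds 0)"
      by (intro tendsto_intros) (simp add: isCont_def tendsto_nhds_iff)
    then show "\<forall>\<^sub>F p in nhds 0. cmod (dird b f p - dird b f 0) < \<eta> / N"
      by (rule order_tendstoD(2)) (use \<eta> N in simp)
  qed
  then obtain R0 where R0: "R0 > 0"
    "\<And>p. p \<in> ball 0 R0 \<Longrightarrow> \<forall>b\<in>(Basis::'a set). cmod (dird b f p - dird b f 0) < \<eta> / N"
    by (auto simp: eventually_nhds_metric dist_commute)
  define R where "R = min R0 r"
  have R: "R > 0" "R \<le> r" using R0 r by (auto simp: R_def)
  have bound: "cmod (dird v f p - dird v f 0) \<le> \<eta> * norm v" if p: "p \<in> ball 0 R" for v p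
  proof -
    have p': "p \<in> ball 0 r" "p \<in> ball 0 R0" using p by (auto simp: R_def)
    have E: "dird v f q = (\<Sum>b\<in>Basis. of_real (v \<bullet> b) * dird b f q)" if "q \<in> ball 0 r" for q
    proof -
      have "dird (\<Sum>b\<in>Basis. (v \<bullet> b) *\<^sub>R b) f q = (\<Sum>b\<in>Basis. of_real (v \<bullet> b) * dird b f q)"
        by (simp only: dird_sum_direction[OF f that] dird_direction(3)[OF f that])
      then show ?thesis by (simp only: euclidean_representation)
    qed
    have "dird v f p - dird v f 0 = (\<Sum>b\<in>Basis. of_real (v \<bullet> b) * (dird b f p - dird b f 0))"
      by (simp add: E[OF p'(1)] E[OF 0] sum_subtractf algebra_simps)
    also have "cmod \<dots> \<le> (\<Sum>b\<in>(Basis::'a set). norm v * (\<eta> / N))"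
    proof (rule sum_norm_le)
      show "cmod (of_real (v \<bullet> b) * (dird b f p - dird b f 0)) \<le> norm v * (\<eta> / N)" if "b \<in> Basis" for b
        unfolding norm_mult using R0(2)[OF p'(2)] Basis_le_norm[OF that, of v] that
        by (intro mult_mono) (auto intro: less_imp_le)
    qed
    also have "\<dots> = \<eta> * norm v" using N by (simp add: N_def)
    finally show ?thesis .
  qed
  have "cmod (f p' - f p - dird (p' - p) f 0) \<le> \<eta> * norm (p' - p)" if pp: "p \<in> ball 0 R" "p' \<in> ball 0 R" for p p'
  proof -
    have bl: "bounded_linear (\<lambda>v. dird v f 0)"
      using holo_on_has_derivative(2)[OF f 0] by (simp add: complex_linear_def)
    have "norm ((\<lambda>p. f p - dird p f 0) p' - (\<lambda>p. f p - dird p f 0) p) \<le> \<eta> * norm (p' - p)"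
    proof (rule differentiable_bound[OF convex_ball[of 0 R] _ _ pp(2) pp(1)])
      fix x assume x: "x \<in> ball (0::'a) R"
      then have "x \<in> ball 0 r" using R by simp
      then show "((\<lambda>p. f p - dird p f 0) has_derivative (\<lambda>v. dird v f x - dird v f 0)) (at x within ball 0 R)"
        by (intro has_derivative_diff has_derivative_at_withinI[OF holo_on_has_derivative(1)[OF f]]
            has_derivative_at_withinI[OF bounded_linear_imp_has_derivative[OF bl]])
      show "onorm (\<lambda>v. dird v f x - dird v f 0) \<le> \<eta>"
        by (rule onorm_le) (rule bound[OF x])
    qed
    then show ?thesis
      unfolding dird_direction(4)[OF f 0, of p' p] by (simp add: algebra_simps)
  qed
  then show ?thesis using that R by blast
qed

text \<open>The union of discs of radius \<sigma> in direction \<open>a\<close>, with centres in a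
  ball whose radius is tied to \<sigma> by the ratio c. Shrinking \<sigma> preserves the shape, and
  the discs carry both Cauchy's formula and the maximum principle.\<close>

definition tube :: "'a::complex_space \<Rightarrow> real \<Rightarrow> real \<Rightarrow> 'a set" where
  "tube a c \<sigma> = {q + t *\<^sub>C a |q t. norm q < c * \<sigma> \<and> cmod t < \<sigma>}"

lemma tubeI: "norm q < c * \<sigma> \<Longrightarrow> cmod t < \<sigma> \<Longrightarrow> q + t *\<^sub>C a \<in> tube a c \<sigma>"
  by (auto simp: tube_def)

lemma tubeE:
  assumes "p \<in> tube a c \<sigma>"
  obtains q t where "p = q + t *\<^sub>C a" "norm q < c * \<sigma>" "cmod t < \<sigma>"
  using assms by (auto simp: tube_def)

lemma open_tube: "open (tube a c \<sigma>)"
proof -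
  have "tube a c \<sigma> = (\<Union>t\<in>ball 0 \<sigma>. ball (t *\<^sub>C a) (c * \<sigma>))"
  proof (intro equalityI subsetI)
    fix p assume "p \<in> tube a c \<sigma>"
    then obtain q t where "p = q + t *\<^sub>C a" "norm q < c * \<sigma>" "cmod t < \<sigma>" by (rule tubeE)
    then show "p \<in> (\<Union>t\<in>ball 0 \<sigma>. ball (t *\<^sub>C a) (c * \<sigma>))"
      by (auto simp: dist_norm intro!: bexI[of _ t])
  next
    fix p assume "p \<in> (\<Union>t\<in>ball 0 \<sigma>. ball (t *\<^sub>C a) (c * \<sigma>))"
    then obtain t where "t \<in> ball 0 \<sigma>" "p \<in> ball (t *\<^sub>C a) (c * \<sigma>)" by auto
    then show "p \<in> tube a c \<sigma>"
      using tubeI[of "p - t *\<^sub>C a" c \<sigma> t a] by (simp add: dist_norm norm_minus_commute)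
  qed
  then show ?thesis by auto
qed

lemma tube_mono: "c \<ge> 0 \<Longrightarrow> \<sigma> \<le> \<sigma>' \<Longrightarrow> tube a c \<sigma> \<subseteq> tube a c \<sigma>'"
  unfolding tube_def by (blast intro: order_less_le_trans mult_left_mono)

text \<open>The geometry needed for division: \<open>\<phi>\<^sub>1\<close> is bounded below on the part of the boundary swept out
  by the direction \<open>a\<close>, and the common zeros of \<open>\<phi>\<^sub>1\<close> and \<open>\<phi>\<^sub>2\<close> have codimension two.\<close>

locale transversal =
  fixes a b :: "'a::complex_space" and c \<delta> :: real and \<phi>\<^sub>1 \<phi>\<^sub>2 :: "'a \<Rightarrow> complex"
  assumes a: "a \<noteq> 0" and c: "c > 0" and \<delta>: "\<delta> > 0"
    and holo1: "\<phi>\<^sub>1 holo_on tube a c \<delta>" and holo2: "\<phi>\<^sub>2 holo_on tube a c \<delta>"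
    and lower: "norm q < c * \<delta> \<Longrightarrow> cmod t < \<delta> \<Longrightarrow> cmod (\<phi>\<^sub>1 (q + t *\<^sub>C a)) \<ge> 3/4 * cmod t - norm q / (4 * c)"
    and one_zero: "p \<in> tube a c \<delta> \<Longrightarrow> p + t *\<^sub>C a \<in> tube a c \<delta> \<Longrightarrow>
       \<phi>\<^sub>1 p = 0 \<Longrightarrow> \<phi>\<^sub>1 (p + t *\<^sub>C a) = 0 \<Longrightarrow> t = 0"
    and one_common_zero: "p \<in> tube a c \<delta> \<Longrightarrow> p + t *\<^sub>C a + s *\<^sub>R b \<in> tube a c \<delta> \<Longrightarrow>
       \<phi>\<^sub>1 p = 0 \<Longrightarrow> \<phi>\<^sub>2 p = 0 \<Longrightarrow> \<phi>\<^sub>1 (p + t *\<^sub>C a + s *\<^sub>R b) = 0 \<Longrightarrow> \<phi>\<^sub>2 (p + t *\<^sub>C a + s *\<^sub>R b) = 0 \<Longrightarrow> s = 0"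
begin

text \<open>By \<open>one_zero\<close> a line in direction \<open>a\<close> meets the zero set of
  \<open>\<phi>\<^sub>1\<close> at most once in the tube, so of two points close to p on that line
  at least one is not a zero.\<close>

lemma islimpt_nonzero:
  assumes "p \<in> tube a c \<delta>"
  shows "p islimpt {x \<in> tube a c \<delta>. \<phi>\<^sub>1 x \<noteq> 0}"
  unfolding islimpt_approachable
proof (intro allI impI)
    fix e :: real assume e: "e > 0"
    obtain e' where e': "e' > 0" "ball p e' \<subseteq> tube a c \<delta>" using openE[OF open_tube assms] by blast
    obtain s where s: "s > 0" "\<And>t. cmod t \<le> s \<Longrightarrow> norm (t *\<^sub>C a) < min e e'"
      using small_on_line[of "min e e'" a] e e' by auto
    have in_tube: "p + t *\<^sub>C a \<in> tube a c \<delta>" if "cmod t \<le> s" for t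
      using s(2)[OF that] e' by (intro subsetD[OF e'(2)]) (simp add: dist_norm)
    have "\<phi>\<^sub>1 (p + of_real s *\<^sub>C a) \<noteq> 0 \<or> \<phi>\<^sub>1 (p + of_real (s/2) *\<^sub>C a) \<noteq> 0"
    proof (rule ccontr)
      assume z: "\<not> ?thesis"
      have E: "p + of_real (s/2) *\<^sub>C a + of_real (s/2) *\<^sub>C a = p + of_real s *\<^sub>C a"
        by (simp add: add.assoc flip: cscale_add_left)
      have "of_real (s/2) = (0::complex)"
        using one_zero[of "p + of_real (s/2) *\<^sub>C a" "of_real (s/2)"] in_tube[of "of_real s"] in_tube[of "of_real (s/2)"] z s(1)
        unfolding E by (simp add: norm_divide)
      then show False using s(1) by simp
    qed
    then obtain t where t: "t \<noteq> 0" "cmod t \<le> s" "\<phi>\<^sub>1 (p + t *\<^sub>C a) \<noteq> 0"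
      using s(1) by (elim disjE) (auto intro: that[of "of_real s"] that[of "of_real (s/2)"])
    moreover have "t *\<^sub>C a \<noteq> 0" using t a norm_cscale[of t a] by auto
    ultimately show "\<exists>x'\<in>{x \<in> tube a c \<delta>. \<phi>\<^sub>1 x \<noteq> 0}. x' \<noteq> p \<and> dist x' p < e"
      using in_tube s(2)[of t] by (intro bexI[of _ "p + t *\<^sub>C a"]) (auto simp: dist_norm)
qed

text \<open>Off the zeros of \<open>\<phi>\<^sub>1\<close> the factor cancels, and those points are
  dense.\<close>

lemma eq_0_of_mult_eq_0:
  assumes "continuous_on (tube a c \<delta>) f" "\<And>x. x \<in> tube a c \<delta> \<Longrightarrow> f x * \<phi>\<^sub>1 x = 0" "p \<in> tube a c \<delta>"
  shows "f p = (0::complex)"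
proof -
  let ?W = "{x \<in> tube a c \<delta>. \<phi>\<^sub>1 x \<noteq> 0}"
  have "(f \<longlongrightarrow> f p) (at p within ?W)"
    using assms(1,3) by (rule_tac tendsto_within_subset[where S = "tube a c \<delta>"]) (auto simp: continuous_on_def)
  moreover have "(f \<longlongrightarrow> 0) (at p within ?W)"
    using assms(2) by (intro tendsto_eventually) (auto simp: eventually_at_filter intro!: always_eventually)
  ultimately show ?thesis
    by (rule tendsto_unique[rotated]) (use islimpt_nonzero[OF assms(3)] in \<open>simp add: trivial_limit_within\<close>)
qed

text \<open>An argument of Hartogs type. H is the Cauchy integral of
  \<open>f\<^sub>1 / \<phi>\<^sub>1\<close> over a circle in direction \<open>a\<close> on which
  \<open>lower\<close> keeps the denominator away from zero. If the disc contains no common zero of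
  \<open>\<phi>\<^sub>1\<close> and \<open>\<phi>\<^sub>2\<close>, the two fractions together form a
  holomorphic function on it, and Cauchy's formula shows that H is its value. Discs with a common
  zero are approached in direction \<open>b\<close>.\<close>

lemma local_quotient:
  assumes f1: "f\<^sub>1 holo_on tube a c \<delta>" and f2: "f\<^sub>2 holo_on tube a c \<delta>"
    and eq: "\<And>p. p \<in> tube a c \<delta> \<Longrightarrow> f\<^sub>1 p * \<phi>\<^sub>2 p = f\<^sub>2 p * \<phi>\<^sub>1 p"
    and p0: "p0 \<in> tube a c \<delta>"
  obtains \<epsilon> H where "\<epsilon> > 0" "ball p0 \<epsilon> \<subseteq> tube a c \<delta>" "H holo_on ball p0 \<epsilon>"
    "\<forall>p\<in>ball p0 \<epsilon>. f\<^sub>1 p = H p * \<phi>\<^sub>1 p \<and> f\<^sub>2 p = H p * \<phi>\<^sub>2 p"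
proof -
  let ?D = "tube a c \<delta>"
  obtain q0 t0 where qt: "p0 = q0 + t0 *\<^sub>C a" "norm q0 < c * \<delta>" "cmod t0 < \<delta>"
    using p0 by (rule tubeE)
  \<comment> \<open>Midway between max(|t0|, \<delta>/2) and \<delta>: the circle encloses t0, stays
    in the tube, and its radius exceeds \<delta>/2, so that in \<open>lower\<close> the term 3/4 |t|
    beats |q|/(4c) < \<delta>/4.\<close>
  define \<tau> where "\<tau> = (max (cmod t0) (\<delta>/2) + \<delta>) / 2"
  have \<tau>: "\<delta>/2 < \<tau>" "\<tau> < \<delta>" "cmod t0 < \<tau>" "\<tau> > 0"
    using qt(3) \<delta> by (auto simp: \<tau>_def max_def)
  define \<epsilon> where "\<epsilon> = c * \<delta> - norm q0"
  have \<epsilon>: "\<epsilon> > 0" using qt(2) by (simp add: \<epsilon>_def)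
  have q: "norm (p - t0 *\<^sub>C a) < c * \<delta>" if "p \<in> ball p0 \<epsilon>" for p
    using that norm_triangle_ineq[of "p - p0" q0] by (simp add: qt(1) \<epsilon>_def dist_norm norm_minus_commute)
  have in_D: "p - t0 *\<^sub>C a + t *\<^sub>C a \<in> ?D" if "p \<in> ball p0 \<epsilon>" "cmod t < \<delta>" for p t
    by (rule tubeI) (use q that in auto)
  have sub: "ball p0 \<epsilon> \<subseteq> ?D"
    using in_D[of _ t0] qt(3) by auto
  define W where "W = {x \<in> ?D. \<phi>\<^sub>1 x \<noteq> 0}"
  define W' where "W' = {x \<in> ?D. \<phi>\<^sub>2 x \<noteq> 0}"
  have open_ne: "open {x \<in> ?D. \<phi> x \<noteq> 0}" if "\<phi> holo_on ?D" for \<phi> :: "'a \<Rightarrow> complex"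
  proof -
    have "{x \<in> ?D. \<phi> x \<noteq> 0} = ?D \<inter> \<phi> -` (- {0})" by auto
    then show ?thesis
      using continuous_open_preimage[OF holo_on_imp_continuous_on[OF that] open_tube, of "- {0}"] by (simp add: open_Compl)
  qed
  have oW: "open W" "open W'" using open_ne holo1 holo2 by (auto simp: W_def W'_def)
  define R where "R x = f\<^sub>1 x / \<phi>\<^sub>1 x" for x
  define R' where "R' x = f\<^sub>2 x / \<phi>\<^sub>2 x" for x
  have R: "R holo_on W" unfolding R_def
    by (rule holo_on_divide) (use oW f1 holo1 in \<open>auto simp: W_def intro: holo_on_subset\<close>)
  have R': "R' holo_on W'" unfolding R'_def
    by (rule holo_on_divide) (use oW f2 holo2 in \<open>auto simp: W'_def intro: holo_on_subset\<close>)
  \<comment> \<open>Each line is parametrised so that p has parameter t0; then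
    \<open>p + \<kappa> \<theta>\<close> is its point with parameter u on the circle. As du = 2 pi i
    u d\<theta>, the weight \<open>m\<close> below is the Cauchy kernel du/(u - t0) stripped of 2 pi
    i.\<close>
  define \<kappa> where "\<kappa> \<theta> = (circlepath 0 \<tau> \<theta> - t0) *\<^sub>C a" for \<theta>
  define m where "m \<theta> = circlepath 0 \<tau> \<theta> / (circlepath 0 \<tau> \<theta> - t0)" for \<theta>
  have cc: "continuous_on {0..1} (circlepath 0 \<tau>)"
    using path_circlepath[of 0 \<tau>] by (simp add: path_def)
  have nc: "cmod (circlepath 0 \<tau> \<theta>) = \<tau>" for \<theta>
    using \<tau> by (simp add: circlepath norm_mult)
  have ne: "circlepath 0 \<tau> \<theta> - t0 \<noteq> 0" for \<theta>
    using nc[of \<theta>] \<tau> by auto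
  have \<kappa>W: "p + \<kappa> \<theta> \<in> W" and \<kappa>E: "p + \<kappa> \<theta> = p - t0 *\<^sub>C a + circlepath 0 \<tau> \<theta> *\<^sub>C a" if "p \<in> ball p0 \<epsilon>" for p \<theta>
  proof -
    show E: "p + \<kappa> \<theta> = p - t0 *\<^sub>C a + circlepath 0 \<tau> \<theta> *\<^sub>C a"
      by (simp add: \<kappa>_def cscale_diff_left)
    have "norm (p - t0 *\<^sub>C a) / (4 * c) < \<delta> / 4"
      using q[OF that] c by (simp add: field_simps)
    then have "3/4 * cmod (circlepath 0 \<tau> \<theta>) - norm (p - t0 *\<^sub>C a) / (4 * c) > 0"
      using \<tau> by (simp add: nc)
    then show "p + \<kappa> \<theta> \<in> W"
      using lower[OF q[OF that], of "circlepath 0 \<tau> \<theta>"] in_D[OF that, of "circlepath 0 \<tau> \<theta>"] \<tau> nc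
      unfolding E by (auto simp: W_def)
  qed
  define H where "H p = integral {0..1} (\<lambda>\<theta>. R (p + \<kappa> \<theta>) * m \<theta>)" for p
  have hH: "H holo_on ball p0 \<epsilon>"
    unfolding H_def
    by (rule holo_on_integral[OF R oW(1)]) (use \<kappa>W ne in \<open>auto simp: \<kappa>_def m_def intro!: continuous_intros cc\<close>)
  \<comment> \<open>Bad points are those whose disc contains a common zero, at which neither
    fraction defines the quotient.\<close>
  define bad where "bad p \<longleftrightarrow> (\<exists>t. cmod t < \<delta> \<and> \<phi>\<^sub>1 (p - t0 *\<^sub>C a + t *\<^sub>C a) = 0 \<and> \<phi>\<^sub>2 (p - t0 *\<^sub>C a + t *\<^sub>C a) = 0)" for p
  have good: "f\<^sub>1 p = H p * \<phi>\<^sub>1 p \<and> f\<^sub>2 p = H p * \<phi>\<^sub>2 p" if p: "p \<in> ball p0 \<epsilon>" and nb: "\<not> bad p" for p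
  proof -
    let ?l = "\<lambda>t. p - t0 *\<^sub>C a + t *\<^sub>C a"
    \<comment> \<open>The two fractions agree where both are defined, and on the disc of a good
      point at least one of them is.\<close>
    define \<psi> where "\<psi> t = (if \<phi>\<^sub>1 (?l t) \<noteq> 0 then R (?l t) else R' (?l t))" for t
    have RR': "R x = R' x" if "x \<in> W" "x \<in> W'" for x
      using that eq by (auto simp: W_def W'_def R_def R'_def field_simps)
    have "\<exists>d. (\<psi> has_field_derivative d) (at t)" if t: "cmod t < \<delta>" for t
    proof (cases "\<phi>\<^sub>1 (?l t) = 0")
      case False
      then have w: "?l t \<in> W" using in_D[OF p t] by (simp add: W_def)
      have o: "open {s. ?l s \<in> W}" by (intro open_vimage[unfolded vimage_def] oW continuous_intros)
      have "(\<psi> has_field_derivative dird a R (?l t)) (at t)"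
        by (rule has_field_derivative_transform_within_open[OF line_has_field_derivative[OF holo_on_imp_line_holo_on[OF R] w] o])
          (use w in \<open>auto simp: \<psi>_def W_def\<close>)
      then show ?thesis by blast
    next
      case True
      then have w: "?l t \<in> W'" using in_D[OF p t] nb t by (auto simp: W'_def bad_def)
      have o: "open {s. ?l s \<in> W'}" by (intro open_vimage[unfolded vimage_def] oW continuous_intros)
      have "(\<psi> has_field_derivative dird a R' (?l t)) (at t)"
      proof (rule has_field_derivative_transform_within_open[OF line_has_field_derivative[OF holo_on_imp_line_holo_on[OF R'] w] o])
        fix s assume s: "s \<in> {s. ?l s \<in> W'}"
        show "R' (?l s) = \<psi> s"
        proof (cases "\<phi>\<^sub>1 (?l s) = 0")
          case False
          then have "?l s \<in> W" using s by (auto simp: W_def W'_def)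
          then show ?thesis using RR'[of "?l s"] s by (auto simp: \<psi>_def)
        qed (simp add: \<psi>_def)
      qed (use w in auto)
      then show ?thesis by blast
    qed
    then have "\<psi> field_differentiable at t" if "cmod t < \<delta>" for t
      using that by (auto simp: field_differentiable_def)
    then have "\<psi> field_differentiable at t within cball 0 \<tau>" if "t \<in> cball 0 \<tau>" for t
      by (rule field_differentiable_at_within) (use that \<tau> in simp)
    then have "\<psi> holomorphic_on cball 0 \<tau>"
      unfolding holomorphic_on_def by blast
    then have "((\<lambda>u. \<psi> u / (u - t0)) has_contour_integral 2 * of_real pi * \<i> * \<psi> t0) (circlepath 0 \<tau>)"
      by (rule Cauchy_integral_circlepath_simple) (use \<tau> in auto)
    then have "((\<lambda>\<theta>. \<psi> (circlepath 0 \<tau> \<theta>) / (circlepath 0 \<tau> \<theta> - t0) * vector_derivative (circlepath 0 \<tau>) (at \<theta> within {0..1}))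
        has_integral 2 * of_real pi * \<i> * \<psi> t0) {0..1}"
      by (simp add: has_contour_integral_def)
    then have "((\<lambda>\<theta>. 2 * of_real pi * \<i> * (R (p + \<kappa> \<theta>) * m \<theta>)) has_integral 2 * of_real pi * \<i> * \<psi> t0) {0..1}"
    proof (rule has_integral_eq[rotated])
      fix \<theta> :: real assume \<theta>: "\<theta> \<in> {0..1}"
      have "\<psi> (circlepath 0 \<tau> \<theta>) = R (p + \<kappa> \<theta>)"
        using \<kappa>W[OF p, of \<theta>] unfolding \<psi>_def \<kappa>E[OF p] by (auto simp: W_def)
      moreover have "vector_derivative (circlepath 0 \<tau>) (at \<theta> within {0..1}) = 2 * of_real pi * \<i> * circlepath 0 \<tau> \<theta>"
        using \<theta> by (subst vector_derivative_circlepath01) (auto simp: circlepath)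
      ultimately show "\<psi> (circlepath 0 \<tau> \<theta>) / (circlepath 0 \<tau> \<theta> - t0) * vector_derivative (circlepath 0 \<tau>) (at \<theta> within {0..1})
          = 2 * of_real pi * \<i> * (R (p + \<kappa> \<theta>) * m \<theta>)"
        by (simp add: m_def)
    qed
    then have "((\<lambda>\<theta>. R (p + \<kappa> \<theta>) * m \<theta>) has_integral \<psi> t0) {0..1}"
      by (subst (asm) has_integral_mult_right_iff) auto
    then have "H p = \<psi> t0" by (simp add: H_def integral_unique)
    moreover have "p \<in> ?D" using sub p by blast
    moreover have "\<not> (\<phi>\<^sub>1 (p - t0 *\<^sub>C a + t0 *\<^sub>C a) = 0 \<and> \<phi>\<^sub>2 (p - t0 *\<^sub>C a + t0 *\<^sub>C a) = 0)"
      using nb qt(3) unfolding bad_def by blast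
    ultimately show ?thesis
      using eq[of p] by (auto simp: \<psi>_def R_def R'_def field_simps)
  qed
  have "f\<^sub>1 p = H p * \<phi>\<^sub>1 p \<and> f\<^sub>2 p = H p * \<phi>\<^sub>2 p" if p: "p \<in> ball p0 \<epsilon>" for p
  proof -
    have lim: "((\<lambda>s. p + s *\<^sub>R b) \<longlongrightarrow> p) (at_right 0)" by (auto intro!: tendsto_eq_intros)
    have "\<forall>\<^sub>F s in at_right 0. p + s *\<^sub>R b \<in> ball p0 \<epsilon>"
      using topological_tendstoD[OF lim open_ball p] .
    \<comment> \<open>If some s > 0 is bad, \<open>one_common_zero\<close> makes it the only bad
      parameter on the segment; so all sufficiently small s > 0 are good, and the identities pass to
      the limit s = 0.\<close>
    moreover have "\<forall>\<^sub>F s in at_right 0. \<not> (p + s *\<^sub>R b \<in> ball p0 \<epsilon> \<and> bad (p + s *\<^sub>R b))"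
    proof (cases "\<exists>s>0. p + s *\<^sub>R b \<in> ball p0 \<epsilon> \<and> bad (p + s *\<^sub>R b)")
      case True
      then obtain s where s: "s > 0" "p + s *\<^sub>R b \<in> ball p0 \<epsilon>" "bad (p + s *\<^sub>R b)" by blast
      obtain t where t: "cmod t < \<delta>" "\<phi>\<^sub>1 (p + s *\<^sub>R b - t0 *\<^sub>C a + t *\<^sub>C a) = 0" "\<phi>\<^sub>2 (p + s *\<^sub>R b - t0 *\<^sub>C a + t *\<^sub>C a) = 0"
        using s(3) unfolding bad_def by blast
      have uniq: "s' = s" if s': "p + s' *\<^sub>R b \<in> ball p0 \<epsilon>" "bad (p + s' *\<^sub>R b)" for s'
      proof -
        obtain t' where t': "cmod t' < \<delta>" "\<phi>\<^sub>1 (p + s' *\<^sub>R b - t0 *\<^sub>C a + t' *\<^sub>C a) = 0" "\<phi>\<^sub>2 (p + s' *\<^sub>R b - t0 *\<^sub>C a + t' *\<^sub>C a) = 0"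
          using s'(2) unfolding bad_def by blast
        have E: "p + s *\<^sub>R b - t0 *\<^sub>C a + t *\<^sub>C a + (t' - t) *\<^sub>C a + (s' - s) *\<^sub>R b = p + s' *\<^sub>R b - t0 *\<^sub>C a + t' *\<^sub>C a"
          by (simp add: cscale_diff_left scaleR_diff_left)
        have "s' - s = 0"
          using one_common_zero[of "p + s *\<^sub>R b - t0 *\<^sub>C a + t *\<^sub>C a" "t' - t" "s' - s"]
            in_D[OF s(2) t(1)] in_D[OF s'(1) t'(1)] t t' unfolding E by blast
        then show ?thesis by simp
      qed
      have "\<forall>\<^sub>F s' in at_right 0. s' < s" using s(1) by (simp add: eventually_at_right_less order_tendstoD(2)[OF tendsto_ident_at])
      then show ?thesis by (rule eventually_mono) (use uniq in auto)
    next
      case False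
      then show ?thesis using eventually_at_right_less[of 0] by (auto elim!: eventually_mono)
    qed
    ultimately have ev: "\<forall>\<^sub>F s in at_right 0. f\<^sub>1 (p + s *\<^sub>R b) = H (p + s *\<^sub>R b) * \<phi>\<^sub>1 (p + s *\<^sub>R b) \<and>
        f\<^sub>2 (p + s *\<^sub>R b) = H (p + s *\<^sub>R b) * \<phi>\<^sub>2 (p + s *\<^sub>R b)"
      by eventually_elim (use good in blast)
    have L: "((\<lambda>s. G (p + s *\<^sub>R b)) \<longlongrightarrow> G p) (at_right 0)" if "G holo_on ball p0 \<epsilon>" for G :: "'a \<Rightarrow> complex"
      using holo_on_imp_continuous_on[OF that] p
      by (intro isCont_tendsto_compose[OF _ lim]) (simp add: continuous_on_eq_continuous_at)
    note Ls = L[OF holo_on_subset[OF f1 sub]] L[OF holo_on_subset[OF f2 sub]]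
      tendsto_mult[OF L[OF hH] L[OF holo_on_subset[OF holo1 sub]]] tendsto_mult[OF L[OF hH] L[OF holo_on_subset[OF holo2 sub]]]
    have "((\<lambda>s. f\<^sub>1 (p + s *\<^sub>R b)) \<longlongrightarrow> H p * \<phi>\<^sub>1 p) (at_right 0)"
      by (rule Lim_transform_eventually[OF Ls(3)]) (use ev in \<open>auto elim: eventually_mono\<close>)
    moreover have "((\<lambda>s. f\<^sub>2 (p + s *\<^sub>R b)) \<longlongrightarrow> H p * \<phi>\<^sub>2 p) (at_right 0)"
      by (rule Lim_transform_eventually[OF Ls(4)]) (use ev in \<open>auto elim: eventually_mono\<close>)
    ultimately show ?thesis
      using tendsto_unique[OF trivial_limit_at_right_real] Ls(1,2) by blast
  qed
  then show ?thesis using that[OF \<epsilon> sub hH] by blast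
qed

text \<open>Each local quotient is the limit of \<open>f\<^sub>1 / \<phi>\<^sub>1\<close> through
  the nonzeros of \<open>\<phi>\<^sub>1\<close>. Taking this limit as the definition of h glues them
  without further comparison.\<close>

lemma quotient:
  assumes f1: "f\<^sub>1 holo_on tube a c \<delta>" and f2: "f\<^sub>2 holo_on tube a c \<delta>"
    and eq: "\<And>p. p \<in> tube a c \<delta> \<Longrightarrow> f\<^sub>1 p * \<phi>\<^sub>2 p = f\<^sub>2 p * \<phi>\<^sub>1 p"
  obtains h where "h holo_on tube a c \<delta>" "\<forall>p\<in>tube a c \<delta>. f\<^sub>1 p = h p * \<phi>\<^sub>1 p"
proof -
  let ?D = "tube a c \<delta>"
  define W where "W = {x \<in> ?D. \<phi>\<^sub>1 x \<noteq> 0}"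
  define h where "h p = Lim (at p within W) (\<lambda>x. f\<^sub>1 x / \<phi>\<^sub>1 x)" for p
  have loc: "\<exists>\<epsilon>>0. ball p0 \<epsilon> \<subseteq> ?D \<and> h holo_on ball p0 \<epsilon> \<and> f\<^sub>1 p0 = h p0 * \<phi>\<^sub>1 p0" if p0: "p0 \<in> ?D" for p0
  proof -
    obtain \<epsilon> H where H: "\<epsilon> > 0" "ball p0 \<epsilon> \<subseteq> ?D" "H holo_on ball p0 \<epsilon>"
      "\<forall>p\<in>ball p0 \<epsilon>. f\<^sub>1 p = H p * \<phi>\<^sub>1 p \<and> f\<^sub>2 p = H p * \<phi>\<^sub>2 p"
      by (rule local_quotient[OF f1 f2 eq p0])
    have "h p = H p" if p: "p \<in> ball p0 \<epsilon>" for p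
      unfolding h_def
    proof (rule tendsto_Lim)
      show "\<not> trivial_limit (at p within W)"
        using islimpt_nonzero[of p] H(2) p by (auto simp: trivial_limit_within W_def)
      have c: "(H \<longlongrightarrow> H p) (at p within W)"
        using holo_on_imp_continuous_on[OF H(3)] p
        by (rule_tac tendsto_within_subset[where S = UNIV]) (auto simp: continuous_on_eq_continuous_at isCont_def)
      have "\<forall>\<^sub>F x in at p within W. x \<in> ball p0 \<epsilon>"
        by (rule eventually_at_topological[THEN iffD2]) (use p in \<open>blast intro: open_ball\<close>)
      moreover have "\<forall>\<^sub>F x in at p within W. x \<in> W"
        by (auto simp: eventually_at_filter intro: always_eventually)
      ultimately have "\<forall>\<^sub>F x in at p within W. H x = f\<^sub>1 x / \<phi>\<^sub>1 x"
        by eventually_elim (use H(4) in \<open>auto simp: W_def\<close>)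
      then show "((\<lambda>x. f\<^sub>1 x / \<phi>\<^sub>1 x) \<longlongrightarrow> H p) (at p within W)"
        by (rule Lim_transform_eventually[OF c])
    qed
    then have "h holo_on ball p0 \<epsilon>" "f\<^sub>1 p0 = h p0 * \<phi>\<^sub>1 p0"
      using holo_on_cong[OF open_ball _ H(3), of h] H(1,4) by auto
    then show ?thesis using H(1,2) by blast
  qed
  have "h holo_on ?D"
    unfolding holo_on_def
  proof
    fix p assume "p \<in> ?D"
    then obtain \<epsilon> where "\<epsilon> > 0" "h holo_on ball p \<epsilon>" using loc by blast
    then show "\<exists>f'. complex_linear f' \<and> (h has_derivative f') (at p)"
      using centre_in_ball[of p \<epsilon>] unfolding holo_on_def by blast
  qed
  then show ?thesis using that loc by blast
qed

text \<open>The maximum principle on the disc through p in direction \<open>a\<close>. The bound for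
  h holds on the very tube on which f is bounded: division costs no shrinking, which is what the
  iteration depends on.\<close>

lemma quotient_bound:
  assumes h: "h holo_on tube a c \<delta>" and f: "\<And>p. p \<in> tube a c \<delta> \<Longrightarrow> f p = h p * \<phi>\<^sub>1 p"
    and \<sigma>: "\<delta>/2 \<le> \<sigma>" "\<sigma> \<le> \<delta>" and B: "\<And>p. p \<in> tube a c \<sigma> \<Longrightarrow> cmod (f p) \<le> B"
    and p: "p \<in> tube a c \<sigma>"
  shows "cmod (h p) \<le> 8 * B / \<delta>"
proof -
  obtain q t where qt: "p = q + t *\<^sub>C a" "norm q < c * \<sigma>" "cmod t < \<sigma>" using p by (rule tubeE)
  have \<sigma>0: "\<sigma> > 0" using \<sigma> \<delta> by simp
  \<comment> \<open>The disc contains t, and on its boundary \<open>lower\<close> gives at least 3/4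
    * 2/3 \<sigma> - \<sigma>/4 = \<sigma>/4 \<ge> \<delta>/8.\<close>
  define \<tau> where "\<tau> = max (cmod t) (2/3 * \<sigma>)"
  have \<tau>: "cmod t \<le> \<tau>" "2/3 * \<sigma> \<le> \<tau>" "\<tau> < \<sigma>" using qt \<sigma>0 by (auto simp: \<tau>_def)
  have D: "q + s *\<^sub>C a \<in> tube a c \<sigma>" "q + s *\<^sub>C a \<in> tube a c \<delta>" if "cmod s \<le> \<tau>" for s
  proof -
    show "q + s *\<^sub>C a \<in> tube a c \<sigma>" by (rule tubeI) (use qt \<tau> that in auto)
    then show "q + s *\<^sub>C a \<in> tube a c \<delta>" using tube_mono[of c \<sigma> \<delta> a] c \<sigma> by auto
  qed
  have hol: "(\<lambda>s. h (q + s *\<^sub>C a)) holomorphic_on cball 0 \<tau>"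
    by (rule line_holomorphic_on[OF holo_on_imp_line_holo_on[OF h]]) (use D in auto)
  have "cmod (h (q + t *\<^sub>C a)) \<le> 8 * B / \<delta>"
  proof (rule maximum_modulus_frontier[where S = "cball 0 \<tau>" and f = "\<lambda>s. h (q + s *\<^sub>C a)"])
    show "(\<lambda>s. h (q + s *\<^sub>C a)) holomorphic_on interior (cball 0 \<tau>)"
      using hol holomorphic_on_subset interior_subset by blast
    show "continuous_on (closure (cball 0 \<tau>)) (\<lambda>s. h (q + s *\<^sub>C a))"
      using holomorphic_on_imp_continuous_on[OF hol] by simp
    fix s :: complex assume "s \<in> frontier (cball 0 \<tau>)"
    then have s: "cmod s = \<tau>" by simp
    have "c * \<sigma> \<le> c * \<delta>" using \<sigma> c by simp
    then have sub: "norm q < c * \<delta>" "cmod s < \<delta>"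
      using qt \<tau> s \<sigma> by linarith+
    have "norm q / (4 * c) \<le> \<sigma> / 4" using qt(2) c by (simp add: field_simps)
    then have "cmod (\<phi>\<^sub>1 (q + s *\<^sub>C a)) \<ge> \<delta> / 8"
      using lower[OF sub] s \<tau> \<sigma> by simp
    then have "cmod (h (q + s *\<^sub>C a)) * (\<delta> / 8) \<le> cmod (h (q + s *\<^sub>C a)) * cmod (\<phi>\<^sub>1 (q + s *\<^sub>C a))"
      by (intro mult_left_mono) auto
    also have "\<dots> = cmod (f (q + s *\<^sub>C a))" using f D(2)[of s] s by (simp add: norm_mult)
    also have "\<dots> \<le> B" using B D(1)[of s] s by simp
    finally show "cmod (h (q + s *\<^sub>C a)) \<le> 8 * B / \<delta>" using \<delta> by (simp add: field_simps)
  qed (use \<tau> in auto)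
  then show ?thesis using qt(1) by simp
qed

text \<open>Passing from \<sigma> to \<sigma> - \<eta> leaves a margin c \<eta> in the ball of
  centres, hence room for a disc of radius c \<eta> in any direction of norm at most 1.\<close>

lemma dird_bound_tube:
  assumes g: "g holo_on tube a c \<delta>" and \<sigma>: "\<sigma> \<le> \<delta>" and \<eta>: "\<eta> > 0" and u: "norm u \<le> 1"
    and B: "\<And>p. p \<in> tube a c \<sigma> \<Longrightarrow> cmod (g p) \<le> B"
    and p: "p \<in> tube a c (\<sigma> - \<eta>)"
  shows "cmod (dird u g p) \<le> B / (c * \<eta>)"
proof (rule dird_bound[OF holo_on_imp_line_holo_on[OF g]])
  show "c * \<eta> > 0" using c \<eta> by simp
  have "p + t *\<^sub>C u \<in> tube a c \<sigma>" if t: "cmod t \<le> c * \<eta>" for t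
  proof -
    obtain q s where qs: "p = q + s *\<^sub>C a" "norm q < c * (\<sigma> - \<eta>)" "cmod s < \<sigma> - \<eta>" using p by (rule tubeE)
    have "norm (t *\<^sub>C u) \<le> c * \<eta> * 1" unfolding norm_cscale using t u c \<eta> by (intro mult_mono) auto
    then have "norm (q + t *\<^sub>C u) < c * \<sigma>"
      using qs(2) norm_triangle_ineq[of q "t *\<^sub>C u"] by (simp add: algebra_simps)
    then have "(q + t *\<^sub>C u) + s *\<^sub>C a \<in> tube a c \<sigma>"
      by (rule tubeI) (use qs \<eta> in auto)
    then show ?thesis by (simp add: qs(1) add_ac)
  qed
  then show "cmod t \<le> c * \<eta> \<Longrightarrow> p + t *\<^sub>C u \<in> tube a c \<delta>" "cmod t \<le> c * \<eta> \<Longrightarrow> cmod (g (p + t *\<^sub>C u)) \<le> B" for t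
    using tube_mono[of c \<sigma> \<delta> a] c \<sigma> B by auto
qed

end

text \<open>Near 0 both functions differ from their linear parts by an error with Lipschitz constant
  \<eta>. The linear parts send t a + s b to t and s, so the increments of the functions give t and
  s up to max(|t|, |s|)/4. This yields both uniqueness conditions and, with a linear bound for the
  first function on the ball of centres, also \<open>lower\<close>.\<close>

lemma transversal_exists:
  fixes \<phi>\<^sub>1 \<phi>\<^sub>2 :: "'a::complex_space \<Rightarrow> complex"
  assumes h1: "\<phi>\<^sub>1 holo_on ball 0 r" and h2: "\<phi>\<^sub>2 holo_on ball 0 r" and r: "r > 0"
    and z: "\<phi>\<^sub>1 0 = 0"
    and a: "dird a \<phi>\<^sub>1 0 = 1" "dird a \<phi>\<^sub>2 0 = 0" and b: "dird b \<phi>\<^sub>1 0 = 0" "dird b \<phi>\<^sub>2 0 = 1"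
  obtains c \<delta> where "transversal a b c \<delta> \<phi>\<^sub>1 \<phi>\<^sub>2" "tube a c \<delta> \<subseteq> ball 0 r"
proof -
  define \<eta> where "\<eta> = 1 / (4 * (norm a + norm b + 1))"
  have ab: "norm a + norm b + 1 > 0" by (simp add: add_nonneg_pos)
  have \<eta>: "\<eta> > 0" using ab by (simp add: \<eta>_def)
  have \<eta>ab: "\<eta> * (norm a + norm b) \<le> 1/4"
    using ab by (simp add: \<eta>_def divide_simps)
  obtain R1 where R1: "R1 > 0" "R1 \<le> r"
    "\<And>p p'. p \<in> ball 0 R1 \<Longrightarrow> p' \<in> ball 0 R1 \<Longrightarrow> cmod (\<phi>\<^sub>1 p' - \<phi>\<^sub>1 p - dird (p' - p) \<phi>\<^sub>1 0) \<le> \<eta> * norm (p' - p)"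
    using holo_on_near_linear[OF h1 r \<eta>] by blast
  obtain R2 where R2: "R2 > 0" "R2 \<le> r"
    "\<And>p p'. p \<in> ball 0 R2 \<Longrightarrow> p' \<in> ball 0 R2 \<Longrightarrow> cmod (\<phi>\<^sub>2 p' - \<phi>\<^sub>2 p - dird (p' - p) \<phi>\<^sub>2 0) \<le> \<eta> * norm (p' - p)"
    using holo_on_near_linear[OF h2 r \<eta>] by blast
  define R where "R = min R1 R2"
  have R: "R > 0" "R \<le> r" using R1 R2 by (auto simp: R_def)
  have 0: "0 \<in> ball (0::'a) r" using r by simp
  note d1 = dird_direction[OF h1 0] and d2 = dird_direction[OF h2 0]
  have "bounded_linear (\<lambda>v. dird v \<phi>\<^sub>1 0)"
    using holo_on_has_derivative(2)[OF h1 0] by (simp add: complex_linear_def)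
  then obtain C1 where C1: "C1 > 0" "\<And>v. cmod (dird v \<phi>\<^sub>1 0) \<le> norm v * C1"
    using bounded_linear.pos_bounded by blast
  \<comment> \<open>Chosen so that the bound (C1 + \<eta>) |q| for the first function at q equals
    |q|/(4c), as \<open>lower\<close> requires.\<close>
  define c where "c = 1 / (4 * (C1 + \<eta>))"
  have c: "c > 0" using C1 \<eta> by (simp add: c_def)
  \<comment> \<open>Then \<delta> (c + |a|) < R, which puts the tube into the ball where both
    functions are nearly linear.\<close>
  define \<delta> where "\<delta> = R / (norm a + c + 1)"
  have nac: "norm a + c + 1 > 0" using c by (simp add: add_nonneg_pos)
  have \<delta>: "\<delta> > 0" using R nac by (simp add: \<delta>_def)
  have D: "norm (q + t *\<^sub>C a) < R" if "norm q < c * \<delta>" "cmod t < \<delta>" for q t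
  proof -
    have "norm (t *\<^sub>C a) \<le> \<delta> * norm a" unfolding norm_cscale using that by (intro mult_right_mono) auto
    then have "norm (q + t *\<^sub>C a) < c * \<delta> + \<delta> * norm a"
      using norm_triangle_ineq[of q "t *\<^sub>C a"] that by linarith
    also have "\<dots> \<le> \<delta> * (norm a + c + 1)" using \<delta> by (simp add: algebra_simps)
    also have "\<dots> = R" using nac by (simp add: \<delta>_def)
    finally show ?thesis .
  qed
  have sub: "tube a c \<delta> \<subseteq> ball 0 R"
  proof
    fix p assume "p \<in> tube a c \<delta>"
    then obtain q t where "p = q + t *\<^sub>C a" "norm q < c * \<delta>" "cmod t < \<delta>" by (rule tubeE)
    then show "p \<in> ball 0 R" using D by simp
  qed
  have subr: "tube a c \<delta> \<subseteq> ball 0 r" using sub R by (auto simp: subset_iff)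
  have diff: "cmod (\<phi>\<^sub>1 (p + t *\<^sub>C a + s *\<^sub>R b) - \<phi>\<^sub>1 p - t) \<le> max (cmod t) \<bar>s\<bar> / 4"
    "cmod (\<phi>\<^sub>2 (p + t *\<^sub>C a + s *\<^sub>R b) - \<phi>\<^sub>2 p - s) \<le> max (cmod t) \<bar>s\<bar> / 4"
    if p: "p \<in> ball 0 R" "p + t *\<^sub>C a + s *\<^sub>R b \<in> ball 0 R" for p t s
  proof -
    have "norm (t *\<^sub>C a + s *\<^sub>R b) \<le> cmod t * norm a + \<bar>s\<bar> * norm b"
      using norm_triangle_ineq[of "t *\<^sub>C a" "s *\<^sub>R b"] by (simp add: norm_cscale)
    also have "\<dots> \<le> max (cmod t) \<bar>s\<bar> * norm a + max (cmod t) \<bar>s\<bar> * norm b"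
      by (intro add_mono mult_right_mono) auto
    finally have "\<eta> * norm (t *\<^sub>C a + s *\<^sub>R b) \<le> \<eta> * (max (cmod t) \<bar>s\<bar> * norm a + max (cmod t) \<bar>s\<bar> * norm b)"
      using \<eta> by (intro mult_left_mono) auto
    also have "\<dots> = (\<eta> * (norm a + norm b)) * max (cmod t) \<bar>s\<bar>" by (simp add: algebra_simps)
    also have "\<dots> \<le> 1/4 * max (cmod t) \<bar>s\<bar>" by (intro mult_right_mono \<eta>ab) (auto simp: max_def)
    finally have n: "\<eta> * norm (t *\<^sub>C a + s *\<^sub>R b) \<le> max (cmod t) \<bar>s\<bar> / 4" by simp
    have E: "p + t *\<^sub>C a + s *\<^sub>R b - p = t *\<^sub>C a + s *\<^sub>R b" by simp
    have "dird (t *\<^sub>C a + s *\<^sub>R b) \<phi>\<^sub>1 0 = t" "dird (t *\<^sub>C a + s *\<^sub>R b) \<phi>\<^sub>2 0 = s"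
      by (simp_all add: d1(1-3) d2(1-3) a b)
    then show "cmod (\<phi>\<^sub>1 (p + t *\<^sub>C a + s *\<^sub>R b) - \<phi>\<^sub>1 p - t) \<le> max (cmod t) \<bar>s\<bar> / 4"
      "cmod (\<phi>\<^sub>2 (p + t *\<^sub>C a + s *\<^sub>R b) - \<phi>\<^sub>2 p - s) \<le> max (cmod t) \<bar>s\<bar> / 4"
      using R1(3)[of p "p + t *\<^sub>C a + s *\<^sub>R b"] R2(3)[of p "p + t *\<^sub>C a + s *\<^sub>R b"] p n
      unfolding E by (auto simp: R_def)
  qed
  have "transversal a b c \<delta> \<phi>\<^sub>1 \<phi>\<^sub>2"
  proof
    show "a \<noteq> 0" using a(1) by auto
    show "c > 0" "\<delta> > 0" by fact+
    show "\<phi>\<^sub>1 holo_on tube a c \<delta>" "\<phi>\<^sub>2 holo_on tube a c \<delta>"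
      using holo_on_subset[OF h1 subr] holo_on_subset[OF h2 subr] by auto
  next
    fix q :: 'a and t :: complex assume q: "norm q < c * \<delta>" and t: "cmod t < \<delta>"
    have in_R: "q \<in> ball 0 R" "q + t *\<^sub>C a + 0 *\<^sub>R b \<in> ball 0 R" "0 \<in> ball (0::'a) R"
      using D[OF q t] D[OF q, of 0] R \<delta> by auto
    have "cmod (\<phi>\<^sub>1 q) \<le> cmod (\<phi>\<^sub>1 q - \<phi>\<^sub>1 0 - dird (q - 0) \<phi>\<^sub>1 0) + cmod (dird q \<phi>\<^sub>1 0)"
      using norm_triangle_ineq[of "\<phi>\<^sub>1 q - \<phi>\<^sub>1 0 - dird (q - 0) \<phi>\<^sub>1 0" "dird q \<phi>\<^sub>1 0"] z by simp
    also have "\<dots> \<le> \<eta> * norm (q - 0) + norm q * C1"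
      using in_R R1(3)[of 0 q] C1(2)[of q] by (intro add_mono) (auto simp: R_def)
    also have "\<dots> = norm q / (4 * c)"
      using c C1 \<eta> by (simp add: c_def field_simps)
    finally have 1: "cmod (\<phi>\<^sub>1 q) \<le> norm q / (4 * c)" .
    have "cmod (\<phi>\<^sub>1 (q + t *\<^sub>C a) - \<phi>\<^sub>1 q - t) \<le> cmod t / 4"
      using diff(1)[OF in_R(1,2)] by simp
    moreover have "cmod t \<le> cmod (\<phi>\<^sub>1 (q + t *\<^sub>C a)) + cmod (\<phi>\<^sub>1 q) + cmod (\<phi>\<^sub>1 (q + t *\<^sub>C a) - \<phi>\<^sub>1 q - t)"
      using norm_triangle_ineq4[of "\<phi>\<^sub>1 (q + t *\<^sub>C a)" "\<phi>\<^sub>1 q"]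
        norm_triangle_ineq4[of "\<phi>\<^sub>1 (q + t *\<^sub>C a) - \<phi>\<^sub>1 q" "\<phi>\<^sub>1 (q + t *\<^sub>C a) - \<phi>\<^sub>1 q - t"] by simp
    ultimately show "3/4 * cmod t - norm q / (4 * c) \<le> cmod (\<phi>\<^sub>1 (q + t *\<^sub>C a))"
      using 1 by simp
  next
    fix p t assume p: "p \<in> tube a c \<delta>" "p + t *\<^sub>C a \<in> tube a c \<delta>" and "\<phi>\<^sub>1 p = 0" "\<phi>\<^sub>1 (p + t *\<^sub>C a) = 0"
    then show "t = 0" using diff(1)[of p t 0] subsetD[OF sub p(1)] subsetD[OF sub p(2)] by auto
  next
    fix p t s assume p: "p \<in> tube a c \<delta>" "p + t *\<^sub>C a + s *\<^sub>R b \<in> tube a c \<delta>"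
      and "\<phi>\<^sub>1 p = 0" "\<phi>\<^sub>2 p = 0" "\<phi>\<^sub>1 (p + t *\<^sub>C a + s *\<^sub>R b) = 0" "\<phi>\<^sub>2 (p + t *\<^sub>C a + s *\<^sub>R b) = 0"
    then have "cmod t \<le> max (cmod t) \<bar>s\<bar> / 4" "\<bar>s\<bar> \<le> max (cmod t) \<bar>s\<bar> / 4"
      using diff[of p t s] subsetD[OF sub p(1)] subsetD[OF sub p(2)] by auto
    then show "s = 0" by (auto simp: max_def split: if_splits)
  qed
  then show ?thesis using that subr by blast
qed

section \<open>Extension of CR functions\<close>

text \<open>The 2 by 2 minors of the gradients of f and \<rho> in the directions \<open>E\<close>.
  Cross-multiplied, the tangential Cauchy-Riemann equations keep a meaning at zeros of the gradient
  of \<rho>.\<close>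

definition cr_wrt :: "'a::complex_space set \<Rightarrow> ('a \<Rightarrow> complex) \<Rightarrow> 'a set \<Rightarrow> ('a \<Rightarrow> complex) \<Rightarrow> bool" where
  "cr_wrt E \<rho> D f \<longleftrightarrow> (\<forall>u\<in>E. \<forall>v\<in>E. \<forall>p\<in>D. dird u f p * dird v \<rho> p = dird v f p * dird u \<rho> p)"

text \<open>Division in the directions e1 and e2 gives h, and cancelling
  \<open>dird e1 \<rho>\<close> extends f_u = h \<rho>_u to every u in \<open>E\<close>. The mixed
  derivative of f is h_u \<rho>_v + h \<rho>_uv; its symmetry and that of \<rho>_uv leave h_u
  \<rho>_v = h_v \<rho>_u, so h satisfies the equations required for the next division.\<close>

lemma cr_quotient:
  assumes T: "transversal a b c \<delta> (dird e1 \<rho>) (dird e2 \<rho>)" and E: "e1 \<in> E" "e2 \<in> E"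
    and \<rho>: "\<rho> holo_on tube a c \<delta>" and f: "f holo_on tube a c \<delta>" and cr: "cr_wrt E \<rho> (tube a c \<delta>) f"
  obtains h where "h holo_on tube a c \<delta>" "cr_wrt E \<rho> (tube a c \<delta>) h"
    "\<forall>u\<in>E. \<forall>p\<in>tube a c \<delta>. dird u f p = h p * dird u \<rho> p"
proof -
  interpret transversal a b c \<delta> "dird e1 \<rho>" "dird e2 \<rho>" by (rule T)
  let ?D = "tube a c \<delta>"
  note hd = holo_on_dird[OF _ open_tube]
  have eq12: "dird e1 f p * dird e2 \<rho> p = dird e2 f p * dird e1 \<rho> p" if "p \<in> ?D" for p
    using cr that E unfolding cr_wrt_def by blast
  obtain h where h: "h holo_on ?D" "\<forall>p\<in>?D. dird e1 f p = h p * dird e1 \<rho> p"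
    by (rule quotient[OF hd[OF f, of e1] hd[OF f, of e2] eq12])
  have q: "dird u f p = h p * dird u \<rho> p" if u: "u \<in> E" and p: "p \<in> ?D" for u p
  proof -
    have "(\<lambda>p. dird u f p - h p * dird u \<rho> p) p = 0"
    proof (rule eq_0_of_mult_eq_0[OF _ _ p])
      show "continuous_on ?D (\<lambda>p. dird u f p - h p * dird u \<rho> p)"
        by (intro continuous_intros holo_on_imp_continuous_on h hd f \<rho>)
      fix x assume x: "x \<in> ?D"
      have "dird u f x * dird e1 \<rho> x = dird e1 f x * dird u \<rho> x"
        using cr x u E unfolding cr_wrt_def by blast
      then show "(dird u f x - h x * dird u \<rho> x) * dird e1 \<rho> x = 0"
        using h(2) x by (simp add: algebra_simps)
    qed
    then show ?thesis by simp
  qed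
  have "cr_wrt E \<rho> ?D h"
    unfolding cr_wrt_def
  proof (intro ballI)
    fix u v p assume uv: "u \<in> E" "v \<in> E" and p: "p \<in> ?D"
    have *: "dird w (dird x f) p = h p * dird w (dird x \<rho>) p + dird w h p * dird x \<rho> p" if "x \<in> E" for w x
    proof -
      have "dird w (dird x f) p = dird w (\<lambda>p. h p * dird x \<rho> p) p"
        by (rule dird_cong[OF open_tube p]) (use q that in auto)
      also have "\<dots> = h p * dird w (dird x \<rho>) p + dird w h p * dird x \<rho> p"
        by (rule dird_mult[OF h(1) hd[OF \<rho>] p])
      finally show ?thesis .
    qed
    have "dird u (dird v f) p = dird v (dird u f) p" "dird u (dird v \<rho>) p = dird v (dird u \<rho>) p"
      using dird_commute[OF f open_tube p] dird_commute[OF \<rho> open_tube p] by auto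
    then show "dird u h p * dird v \<rho> p = dird v h p * dird u \<rho> p"
      using *[OF uv(1), of v] *[OF uv(2), of u] by simp
  qed
  then show ?thesis using that h(1) q by blast
qed

text \<open>Each new function is the e1-derivative of the previous one divided by that of \<rho>. A
  step costs a width \<eta> through Cauchy's estimate, nothing through the division, and multiplies
  the bound by 8/(\<delta> c \<eta>).\<close>

lemma cr_iterated_quotients:
  assumes T: "transversal a b c \<delta> (dird e1 \<rho>) (dird e2 \<rho>)" and E: "e1 \<in> E" "e2 \<in> E" and e1: "norm e1 \<le> 1"
    and \<rho>: "\<rho> holo_on tube a c \<delta>" and f: "f holo_on tube a c \<delta>" and cr: "cr_wrt E \<rho> (tube a c \<delta>) f"
    and B: "\<And>p. p \<in> tube a c \<delta> \<Longrightarrow> cmod (f p) \<le> B"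
  obtains h L where "h 0 = f" "\<forall>k. h k holo_on tube a c \<delta>" "L > 0"
    "\<forall>k. \<forall>u\<in>E. \<forall>p\<in>tube a c \<delta>. dird u (h k) p = h (Suc k) p * dird u \<rho> p"
    "\<forall>k. \<forall>p\<in>tube a c (\<delta>/2). cmod (h k p) \<le> B * L ^ k * fact k"
proof -
  interpret transversal a b c \<delta> "dird e1 \<rho>" "dird e2 \<rho>" by (rule T)
  let ?D = "tube a c \<delta>"
  have "\<exists>h. \<forall>k. (h k holo_on ?D \<and> cr_wrt E \<rho> ?D (h k) \<and> (k = 0 \<longrightarrow> h k = f)) \<and>
     (\<forall>u\<in>E. \<forall>p\<in>?D. dird u (h k) p = h (Suc k) p * dird u \<rho> p)"
  proof (rule dependent_nat_choice)
    show "\<exists>x. x holo_on ?D \<and> cr_wrt E \<rho> ?D x \<and> (0 = 0 \<longrightarrow> x = f)"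
      using f cr by blast
  next
    fix x :: "'a \<Rightarrow> complex" and n :: nat
    assume "x holo_on ?D \<and> cr_wrt E \<rho> ?D x \<and> (n = 0 \<longrightarrow> x = f)"
    then obtain h where "h holo_on ?D" "cr_wrt E \<rho> ?D h" "\<forall>u\<in>E. \<forall>p\<in>?D. dird u x p = h p * dird u \<rho> p"
      using cr_quotient[OF T E \<rho>] by blast
    then show "\<exists>y. (y holo_on ?D \<and> cr_wrt E \<rho> ?D y \<and> (Suc n = 0 \<longrightarrow> y = f)) \<and>
        (\<forall>u\<in>E. \<forall>p\<in>?D. dird u x p = y p * dird u \<rho> p)"
      by blast
  qed
  then obtain h where h: "\<And>k. h k holo_on ?D" "h 0 = f"
    "\<And>k u p. u \<in> E \<Longrightarrow> p \<in> ?D \<Longrightarrow> dird u (h k) p = h (Suc k) p * dird u \<rho> p"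
    by blast
  define L where "L = 16 / (\<delta>^2 * c) * exp 1"
  have L: "L > 0" using \<delta> c by (simp add: L_def)
  have B0: "B \<ge> 0" using B[OF tubeI[of 0 c \<delta> 0 a]] c \<delta> norm_ge_zero[of "f 0"] by (simp del: norm_ge_zero)
  have step: "\<forall>p\<in>tube a c (\<delta> - real k * \<eta>). cmod (h k p) \<le> B * (8 / (\<delta> * c * \<eta>)) ^ k"
    if \<eta>: "\<eta> > 0" "real k * \<eta> \<le> \<delta> / 2" for k \<eta>
    using that(2)
  proof (induction k)
    case 0
    then show ?case using B h(2) by simp
  next
    case (Suc k)
    let ?\<sigma> = "\<delta> - real k * \<eta>"
    have IH: "\<forall>p\<in>tube a c ?\<sigma>. cmod (h k p) \<le> B * (8 / (\<delta> * c * \<eta>)) ^ k"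
      using Suc \<eta>(1) by (simp add: algebra_simps)
    have \<sigma>: "\<delta>/2 \<le> ?\<sigma> - \<eta>" "?\<sigma> \<le> \<delta>" "?\<sigma> - \<eta> \<le> \<delta>" using Suc.prems \<eta>(1) by (auto simp: algebra_simps)
    have d: "cmod (dird e1 (h k) p) \<le> B * (8 / (\<delta> * c * \<eta>)) ^ k / (c * \<eta>)" if "p \<in> tube a c (?\<sigma> - \<eta>)" for p
      by (rule dird_bound_tube[OF h(1) \<sigma>(2) \<eta>(1) e1 _ that]) (use IH in auto)
    have "cmod (h (Suc k) p) \<le> 8 * (B * (8 / (\<delta> * c * \<eta>)) ^ k / (c * \<eta>)) / \<delta>" if "p \<in> tube a c (?\<sigma> - \<eta>)" for p
      by (rule quotient_bound[OF h(1) h(3)[OF E(1)] \<sigma>(1,3) d that])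
    note b = this
    have E1: "8 * (B * (8 / (\<delta> * c * \<eta>)) ^ k / (c * \<eta>)) / \<delta> = B * (8 / (\<delta> * c * \<eta>)) ^ Suc k"
      by (simp add: mult_ac)
    have E2: "\<delta> - real (Suc k) * \<eta> = ?\<sigma> - \<eta>" by (simp add: algebra_simps)
    show ?case unfolding E2 using b unfolding E1 by blast
  qed
  have "cmod (h k p) \<le> B * L ^ k * fact k" if p: "p \<in> tube a c (\<delta>/2)" for k p
  proof (cases "k = 0")
    case True
    have "p \<in> tube a c \<delta>" using p tube_mono[of c "\<delta>/2" \<delta> a] c \<delta> by auto
    then show ?thesis using B h(2) True by simp
  next
    case False
    \<comment> \<open>With this width k steps end exactly at the tube of size \<delta>/2. The factor
      per step becomes 16 k/(\<delta>^2 c); k^k is absorbed by k! and the factor e in L.\<close>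
    define \<eta> where "\<eta> = \<delta> / (2 * real k)"
    have \<eta>: "\<eta> > 0" "real k * \<eta> = \<delta> / 2" using False \<delta> by (auto simp: \<eta>_def)
    have "cmod (h k p) \<le> B * (8 / (\<delta> * c * \<eta>)) ^ k"
      using step[OF \<eta>(1), of k] \<eta>(2) p by simp
    also have "8 / (\<delta> * c * \<eta>) = 16 / (\<delta>^2 * c) * real k"
      by (simp add: \<eta>_def power2_eq_square)
    also have "B * (16 / (\<delta>^2 * c) * real k) ^ k = B * (16 / (\<delta>^2 * c)) ^ k * (real k ^ k / fact k) * fact k"
      by (subst power_mult_distrib) simp
    also have "\<dots> \<le> B * (16 / (\<delta>^2 * c)) ^ k * exp 1 ^ k * fact k"
      using B0 c by (intro mult_right_mono mult_left_mono power_div_fact_le) auto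
    also have "\<dots> = B * L ^ k * fact k" by (simp only: L_def power_mult_distrib mult.assoc)
    finally show ?thesis .
  qed
  then show ?thesis using that[of h L] h L by blast
qed


section \<open>The series for the extension and its values on the graph\<close>

definition zbar_dir :: "'n::finite \<Rightarrow> (complex^'n) \<times> (complex^'n)" where
  "zbar_dir j = (0, axis j 1)"

definition z_dir :: "'n::finite \<Rightarrow> (complex^'n) \<times> (complex^'n)" where
  "z_dir j = (axis j 1, 0)"

lemma norm_zbar_dir [simp]: "norm (zbar_dir j) = 1"
  by (simp add: zbar_dir_def norm_prod_def)

lemma vec_expansion: "(\<zeta> :: complex^'n::finite) = (\<Sum>j\<in>UNIV. \<zeta> $ j *\<^sub>C axis j 1)"
  by (simp add: vec_eq_iff cscale_vec_def cscale_complex_def axis_def if_distrib cong: if_cong)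

lemma zbar_dir_expansion: "(0, \<zeta>) = (\<Sum>j\<in>UNIV. \<zeta> $ j *\<^sub>C zbar_dir j)"
  by (subst vec_expansion[of \<zeta>]) (simp add: zbar_dir_def cscale_prod_def prod_eq_iff fst_sum snd_sum)

text \<open>The extension is \<open>F (z, w) = (\<Sum>k. h k (z, 0) / k! * (w - \<rho> (z, 0)) ^ k)\<close>, where \<open>h k\<close> plays the
  role of the \<open>k\<close>-th derivative of \<open>F\<close> in \<open>w\<close>. Along a segment from \<open>(z, 0)\<close> to \<open>(z, \<zeta>)\<close> the derivative
  of the partial sums with base point moved to \<open>(z, t \<zeta>)\<close> telescopes.\<close>

lemma cr_function_extension:
  fixes \<rho> g :: "(complex^'n::finite) \<times> (complex^'n) \<Rightarrow> complex"
  assumes r: "r > 0" and \<rho>: "\<rho> holo_on ball 0 r" and g: "g holo_on ball 0 r" and \<rho>0: "\<rho> 0 = 0"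
    and cr: "cr_wrt (range zbar_dir) \<rho> (ball 0 r) g" and z: "dird (zbar_dir i) \<rho> 0 = 0"
    and a: "dird a (dird (zbar_dir i) \<rho>) 0 = 1" "dird a (dird (zbar_dir j) \<rho>) 0 = 0"
    and b: "dird b (dird (zbar_dir i) \<rho>) 0 = 0" "dird b (dird (zbar_dir j) \<rho>) 0 = 1"
  obtains s s' F where "s > 0" "s' > 0" "F holo_on ball (0 :: (complex^'n) \<times> complex) s'"
    "\<forall>p\<in>ball 0 s. (fst p, \<rho> p) \<in> ball 0 s' \<and> F (fst p, \<rho> p) = g p"
proof -
  have "0 \<in> ball (0::(complex^'n) \<times> (complex^'n)) r" using r by simp
  then obtain r1 B where r1: "r1 > 0" "cball 0 r1 \<subseteq> ball (0::(complex^'n) \<times> (complex^'n)) r" "B > 0"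
    and B: "\<And>p. p \<in> cball 0 r1 \<Longrightarrow> cmod (g p) \<le> B"
    using continuous_on_locally_bounded[OF holo_on_imp_continuous_on[OF g] open_ball] by blast
  have sub1: "ball 0 r1 \<subseteq> ball (0::(complex^'n) \<times> (complex^'n)) r"
    using r1(2) ball_subset_cball by blast
  obtain c \<delta> where T: "transversal a b c \<delta> (dird (zbar_dir i) \<rho>) (dird (zbar_dir j) \<rho>)" and tube: "tube a c \<delta> \<subseteq> ball 0 r1"
    by (rule transversal_exists[OF holo_on_subset[OF holo_on_dird[OF \<rho> open_ball] sub1]
      holo_on_subset[OF holo_on_dird[OF \<rho> open_ball] sub1] r1(1) z a b])
  interpret transversal a b c \<delta> "dird (zbar_dir i) \<rho>" "dird (zbar_dir j) \<rho>" by (rule T)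
  have sub2: "tube a c \<delta> \<subseteq> ball 0 r" using tube sub1 by blast
  have gB: "cmod (g p) \<le> B" if "p \<in> tube a c \<delta>" for p
    using that tube B by (meson ball_subset_cball subsetD)
  have cr': "cr_wrt (range zbar_dir) \<rho> (tube a c \<delta>) g"
    using cr sub2 unfolding cr_wrt_def by blast
  obtain h L where h: "h 0 = g" "\<forall>k. h k holo_on tube a c \<delta>" and L: "L > 0"
    and hd: "\<forall>k. \<forall>u\<in>range zbar_dir. \<forall>p\<in>tube a c \<delta>. dird u (h k) p = h (Suc k) p * dird u \<rho> p"
    and hB: "\<forall>k. \<forall>p\<in>tube a c (\<delta>/2). cmod (h k p) \<le> B * L ^ k * fact k"
    by (rule cr_iterated_quotients[OF T _ _ _ holo_on_subset[OF \<rho> sub2] holo_on_subset[OF g sub2] cr' gB]) auto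
  have "0 \<in> tube a c (\<delta>/2)" using tubeI[of 0 c "\<delta>/2" 0 a] c \<delta> by simp
  then obtain R where R: "R > 0" "ball 0 R \<subseteq> tube a c (\<delta>/2)" using openE[OF open_tube] by blast
  have sub3: "ball 0 R \<subseteq> tube a c \<delta>" using R(2) tube_mono[of c "\<delta>/2" \<delta> a] c \<delta> by auto
  have cont\<rho>: "isCont \<rho> 0"
    using holo_on_imp_continuous_on[OF \<rho>] r by (simp add: continuous_on_eq_continuous_at)
  have small: "\<exists>d>0. \<forall>p\<in>ball 0 d. cmod (\<rho> p) < e" if "e > 0" for e
    using cont\<rho> that \<rho>0 unfolding continuous_at_eps_delta by (metis dist_0_norm dist_norm mem_ball diff_zero)
  \<comment> \<open>Numbers of modulus below 1/(8L) differ by at most 1/(4L), which against the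
    growth L^k of the coefficients leaves a geometric series of ratio 1/4.\<close>
  obtain d where d: "d > 0" "\<forall>p\<in>ball 0 d. cmod (\<rho> p) < 1 / (8 * L)"
    using small[of "1 / (8 * L)"] L by auto
  define R' where "R' = min R d"
  have R': "R' > 0" "ball 0 R' \<subseteq> ball 0 R" "\<forall>p\<in>ball 0 R'. cmod (\<rho> p) < 1 / (8 * L)"
    using R d by (auto simp: R'_def)
  have hB': "cmod (h k p) \<le> B * L ^ k * fact k" if "p \<in> ball 0 R'" for k p
    using hB that R'(2) R(2) by blast
  define s' where "s' = min R' (1 / (8 * L))"
  have s': "s' > 0" using R' L by (simp add: s'_def)
  define P :: "(complex^'n) \<times> complex \<Rightarrow> (complex^'n) \<times> (complex^'n)" where "P x = (fst x, 0)" for x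
  have P: "P x \<in> ball 0 R'" "cmod (snd x - \<rho> (P x)) \<le> 1 / (4 * L)" if "x \<in> ball 0 s'" for x
  proof -
    have n: "norm (fst x) < s'" "cmod (snd x) < s'"
      using that norm_fst_le[of "fst x" "snd x"] norm_snd_le[of "snd x" "fst x"] by auto
    then show 1: "P x \<in> ball 0 R'" by (simp add: P_def s'_def norm_prod_def)
    have "cmod (\<rho> (P x)) < 1 / (8 * L)" using R'(3) 1 by blast
    then show "cmod (snd x - \<rho> (P x)) \<le> 1 / (4 * L)"
      using n norm_triangle_ineq4[of "snd x" "\<rho> (P x)"] by (simp add: s'_def)
  qed
  have clP: "complex_linear P" unfolding P_def by (intro complex_linear_intros)
  have holo_P: "(\<lambda>x. f (P x)) holo_on ball 0 s'" if "f holo_on tube a c \<delta>" for f :: "_ \<Rightarrow> complex"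
    by (rule holo_on_compose[OF that complex_linear_imp_holo_on[OF clP]]) (use P R' sub3 in blast)
  define trm where "trm k x = h k (P x) * (1 / fact k) * (snd x - \<rho> (P x)) ^ k" for k x
  have holo_term: "trm k holo_on ball 0 s'" for k
    unfolding trm_def
    by (rule holo_on_mult[OF holo_on_mult[OF holo_P holo_on_const] holo_on_power[OF holo_on_diff[OF
        complex_linear_imp_holo_on[OF complex_linear_snd] holo_P]]])
      (use h holo_on_subset[OF \<rho> sub2] in auto)
  have geom: "B * L ^ k * fact k * (1 / fact k) * (1 / (4 * L)) ^ k = B * (1/4) ^ k" for k
    using L by (simp add: power_divide power_mult_distrib)
  have bterm: "norm (trm k x) \<le> B * (1/4) ^ k" if "x \<in> ball 0 s'" for k x
  proof -
    have "norm (trm k x) \<le> B * L ^ k * fact k * (1 / fact k) * (1 / (4 * L)) ^ k"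
      unfolding trm_def norm_mult norm_power
      using hB'[OF P(1)[OF that], of k] P(2)[OF that] r1 L
      by (intro mult_mono power_mono) (auto simp: norm_divide)
    then show ?thesis by (simp only: geom)
  qed
  define F where "F x = (\<Sum>k. trm k x)" for x
  have ulim: "uniform_limit (ball 0 s') (\<lambda>n x. \<Sum>k<n. trm k x) F sequentially"
    unfolding F_def by (rule Weierstrass_m_test[OF bterm]) (auto intro: summable_mult summable_geometric)
  have sumF: "(\<lambda>k. trm k x) sums F x" if "x \<in> ball 0 s'" for x
    using tendsto_uniform_limitI[OF ulim that] by (simp add: sums_def)
  have holF: "F holo_on ball 0 s'"
  proof (rule line_holo_on_imp_holo_on[OF line_holo_on_uniform_limit[OF sequentially_bot] open_ball])
    fix x :: "(complex^'n) \<times> complex" assume "x \<in> ball 0 s'"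
    then obtain e where e: "e > 0" "ball x e \<subseteq> ball 0 s'" using openE[OF open_ball] by blast
    have "(\<lambda>x. \<Sum>k<n. trm k x) line_holo_on ball x e" for n
      by (intro holo_on_imp_line_holo_on holo_on_sum holo_on_subset[OF holo_term e(2)])
    then show "\<exists>r>0. (\<forall>\<^sub>F n in sequentially. (\<lambda>x. \<Sum>k<n. trm k x) line_holo_on ball x r) \<and>
        uniform_limit (ball x r) (\<lambda>n x. \<Sum>k<n. trm k x) F sequentially"
      using e(1) uniform_limit_on_subset[OF ulim e(2)] by auto
  qed
  obtain d' where d': "d' > 0" "\<forall>p\<in>ball 0 d'. cmod (\<rho> p) < s' / 2"
    using small[of "s' / 2"] s' by auto
  define s where "s = min d' (min (s' / 2) (R' / 2))"
  have s: "s > 0" using d' s' R' by (simp add: s_def)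
  have "(fst p, \<rho> p) \<in> ball 0 s' \<and> F (fst p, \<rho> p) = g p" if p: "p \<in> ball 0 s" for p
  proof
    obtain z \<zeta> where pz: "p = (z, \<zeta>)" by (cases p)
    have n: "norm z < s" "norm \<zeta> < s"
      using p norm_fst_le[of z \<zeta>] norm_snd_le[of \<zeta> z] by (auto simp: pz)
    have "cmod (\<rho> p) < s' / 2" using d' p by (auto simp: s_def)
    then have "norm z + cmod (\<rho> p) < s'" using n by (simp add: s_def)
    then show in_s': "(fst p, \<rho> p) \<in> ball 0 s'"
      using norm_Pair_le[of z "\<rho> p"] by (simp add: pz)
    \<comment> \<open>The segment moves only \<zeta>, so that only derivatives along
      \<open>zbar_dir\<close> enter. Its parameter runs through the closed complex unit disc, which
      is convex and suits the complex mean value bound.\<close>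
    define v where "v = ((0::complex^'n), \<zeta>)"
    define x where "x t = ((z, 0) :: (complex^'n) \<times> (complex^'n)) + t *\<^sub>C v" for t
    define w where "w = \<rho> p"
    have xb: "x t \<in> ball 0 R'" if "t \<in> cball 0 1" for t
    proof -
      have "norm (t *\<^sub>C v) \<le> 1 * norm \<zeta>"
        unfolding norm_cscale using that by (intro mult_mono) (auto simp: v_def norm_prod_def)
      then have "norm (x t) \<le> norm z + norm \<zeta>"
        unfolding x_def using norm_triangle_ineq[of "(z, 0)" "t *\<^sub>C v"] by (simp add: norm_prod_def)
      then show ?thesis using n by (simp add: s_def)
    qed
    have xD: "x t \<in> tube a c \<delta>" "x t \<in> ball 0 r" if "t \<in> cball 0 1" for t
      using xb[OF that] R'(2) sub3 sub2 by blast+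
    have x0: "x 0 = P (z, w)" and x1: "x 1 = p" by (auto simp: x_def P_def pz v_def)
    define \<rho>' where "\<rho>' t = dird v \<rho> (x t)" for t
    have dh: "dird v (h k) (x t) = h (Suc k) (x t) * \<rho>' t" if "t \<in> cball 0 1" for k t
    proof -
      have "dird v (h k) (x t) = (\<Sum>j\<in>UNIV. \<zeta> $ j * dird (zbar_dir j) (h k) (x t))"
        unfolding v_def zbar_dir_expansion using h(2) xD[OF that]
        by (simp add: dird_sum_direction[of "h k" "tube a c \<delta>"] dird_direction[of "h k" "tube a c \<delta>"])
      moreover have "\<rho>' t = (\<Sum>j\<in>UNIV. \<zeta> $ j * dird (zbar_dir j) \<rho> (x t))"
        unfolding v_def zbar_dir_expansion \<rho>'_def using xD[OF that]
        by (simp add: dird_sum_direction[OF \<rho>] dird_direction[OF \<rho>])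
      ultimately show ?thesis
        using hd xD[OF that] by (simp add: sum_distrib_left mult_ac)
    qed
    have Dh: "((\<lambda>t. h k (x t)) has_field_derivative h (Suc k) (x t) * \<rho>' t) (at t within cball 0 1)"
      if t: "t \<in> cball 0 1" for k t
    proof (rule has_field_derivative_at_within)
      show "((\<lambda>t. h k (x t)) has_field_derivative h (Suc k) (x t) * \<rho>' t) (at t)"
        using line_has_field_derivative[OF holo_on_imp_line_holo_on[OF h(2)[rule_format, of k]], of "(z, 0)" t v] xD[OF t] dh[OF t, of k]
        by (simp add: x_def)
    qed
    have D\<rho>: "((\<lambda>t. \<rho> (x t)) has_field_derivative \<rho>' t) (at t within cball 0 1)" if t: "t \<in> cball 0 1" for t
    proof (rule has_field_derivative_at_within)
      show "((\<lambda>t. \<rho> (x t)) has_field_derivative \<rho>' t) (at t)"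
        using line_has_field_derivative[OF holo_on_imp_line_holo_on[OF \<rho>], of "(z, 0)" t v] xD[OF t]
        by (simp add: x_def \<rho>'_def)
    qed
    define S where "S N t = (\<Sum>k\<le>N. h k (x t) * (1 / fact k) * (w - \<rho> (x t)) ^ k)" for N t
    have DS: "(S N has_field_derivative h (Suc N) (x t) * \<rho>' t * (1 / fact N) * (w - \<rho> (x t)) ^ N) (at t within cball 0 1)"
      if t: "t \<in> cball 0 1" for N t
    proof (induction N)
      case 0
      show ?case unfolding S_def using Dh[OF t, of 0] by simp
    next
      case (Suc N)
      have DP: "((\<lambda>t. (w - \<rho> (x t)) ^ Suc N) has_field_derivative
          of_nat (Suc N) * ((0 - \<rho>' t) * (w - \<rho> (x t)) ^ N)) (at t within cball 0 1)"
        using DERIV_power_Suc[OF DERIV_diff[OF DERIV_const D\<rho>[OF t]]] by (simp only: of_nat_Suc)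
      have "((\<lambda>t. S N t + h (Suc N) (x t) * (1 / fact (Suc N)) * (w - \<rho> (x t)) ^ Suc N) has_field_derivative
          h (Suc N) (x t) * \<rho>' t * (1 / fact N) * (w - \<rho> (x t)) ^ N +
          (h (Suc N) (x t) * (1 / fact (Suc N)) * (of_nat (Suc N) * ((0 - \<rho>' t) * (w - \<rho> (x t)) ^ N))
           + h (Suc (Suc N)) (x t) * \<rho>' t * (1 / fact (Suc N)) * (w - \<rho> (x t)) ^ Suc N)) (at t within cball 0 1)"
        by (intro DERIV_add Suc.IH DERIV_mult' DERIV_cmult_right Dh[OF t] DP)
      moreover have "h (Suc N) (x t) * \<rho>' t * (1 / fact N) * (w - \<rho> (x t)) ^ N +
          (h (Suc N) (x t) * (1 / fact (Suc N)) * (of_nat (Suc N) * ((0 - \<rho>' t) * (w - \<rho> (x t)) ^ N))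
           + h (Suc (Suc N)) (x t) * \<rho>' t * (1 / fact (Suc N)) * (w - \<rho> (x t)) ^ Suc N)
         = h (Suc (Suc N)) (x t) * \<rho>' t * (1 / fact (Suc N)) * (w - \<rho> (x t)) ^ Suc N"
      proof -
        have "of_nat (Suc N) / fact (Suc N) = (1 / fact N :: complex)" by (simp add: fact_Suc del: of_nat_Suc)
        then have "1 / fact (Suc N) * of_nat (Suc N) = (1 / fact N :: complex)" by simp
        then have "h (Suc N) (x t) * (1 / fact (Suc N)) * (of_nat (Suc N) * ((0 - \<rho>' t) * (w - \<rho> (x t)) ^ N))
           = h (Suc N) (x t) * (1 / fact N) * ((0 - \<rho>' t) * (w - \<rho> (x t)) ^ N)"
          by (metis mult.assoc)
        then show ?thesis by (simp add: algebra_simps)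
      qed
      ultimately show ?case unfolding S_def by (simp del: fact_Suc power_Suc)
    qed
    have "continuous_on (cball 0 1) \<rho>'"
      unfolding \<rho>'_def x_def
      by (rule continuous_on_compose2[OF holo_on_imp_continuous_on[OF holo_on_dird[OF \<rho> open_ball]]])
        (use xD in \<open>auto simp: x_def intro!: continuous_intros\<close>)
    then have "bounded (\<rho>' ` cball 0 1)"
      by (intro compact_imp_bounded compact_continuous_image) auto
    then obtain K where K: "K > 0" "\<forall>t\<in>cball 0 1. cmod (\<rho>' t) \<le> K"
      unfolding bounded_pos by auto
    \<comment> \<open>The derivative of the partial sum contains h (N+1), hence (N+1)!, against
      1/N!; the remaining factor N+1 is beaten by 4^-N.\<close>
    have bound: "cmod (S N 1 - S N 0) \<le> B * L * K * (real (Suc N) * (1/4) ^ N)" for N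
    proof -
      have "cmod (h (Suc N) (x t) * \<rho>' t * (1 / fact N) * (w - \<rho> (x t)) ^ N)
          \<le> B * L ^ Suc N * fact (Suc N) * K * (1 / fact N) * (1 / (4 * L)) ^ N" if t: "t \<in> cball 0 1" for t
      proof -
        have "cmod w < 1 / (8 * L)" "cmod (\<rho> (x t)) < 1 / (8 * L)"
          using R'(3) xb[OF t] xb[of 1] by (auto simp: w_def x1)
        then have "cmod (w - \<rho> (x t)) \<le> 1 / (4 * L)"
          using norm_triangle_ineq4[of w "\<rho> (x t)"] by simp
        then show ?thesis
          unfolding norm_mult norm_power using hB'[OF xb[OF t], of "Suc N"] K t r1 L
          by (intro mult_mono power_mono) (auto simp: norm_divide simp del: fact_Suc power_Suc)
      qed
      then have "cmod (S N 1 - S N 0) \<le> B * L ^ Suc N * fact (Suc N) * K * (1 / fact N) * (1 / (4 * L)) ^ N * cmod (1 - 0)"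
        by (intro field_differentiable_bound[OF convex_cball[of 0 1] DS]) auto
      also have "\<dots> = B * L * K * (real (Suc N) * (1/4) ^ N)"
        using L by (simp add: power_divide power_mult_distrib)
      finally show ?thesis .
    qed
    have "(\<lambda>N. real (Suc N) * (1/4) ^ N) \<longlonglongrightarrow> 0" by real_asymp
    then have "(\<lambda>N. B * L * K * (real (Suc N) * (1/4) ^ N)) \<longlonglongrightarrow> 0"
      by (rule tendsto_mult_right_zero)
    then have lim0: "(\<lambda>N. S N 1 - S N 0) \<longlonglongrightarrow> 0"
      by (rule Lim_null_comparison[OF always_eventually[OF allI[OF bound]]])
    \<comment> \<open>At t = 1 the base w - \<rho> is zero, and only the summand k = 0 survives
      because 0^0 = 1.\<close>
    have "S N 1 = g p" for N
    proof -
      have "S N 1 = (\<Sum>k\<le>N. if k = 0 then g p else 0)"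
        unfolding S_def x1 by (rule sum.cong) (auto simp: w_def h(1))
      then show ?thesis by simp
    qed
    moreover have "S N 0 = (\<Sum>k\<le>N. trm k (z, w))" for N
      by (simp add: S_def trm_def x0)
    ultimately have "(\<lambda>N. g p - (\<Sum>k\<le>N. trm k (z, w))) \<longlonglongrightarrow> 0" using lim0 by simp
    moreover have "(\<lambda>N. g p - (\<Sum>k\<le>N. trm k (z, w))) \<longlonglongrightarrow> g p - F (z, w)"
      using sumF[OF in_s'] by (intro tendsto_intros) (simp add: sums_def_le pz w_def)
    ultimately have "g p - F (z, w) = 0" using LIMSEQ_unique by blast
    then show "F (fst p, \<rho> p) = g p" by (simp add: pz w_def)
  qed
  then show ?thesis using that[OF s s' holF] by blast
qed

section \<open>Local existence for ordinary differential equations\<close>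

text \<open>Composed with the nearest-point projection onto the ball, the field becomes bounded and
  globally Lipschitz. The fixed point of the integral operator takes values in the ball, where the
  projection is the identity, so that it solves the original equation.\<close>

lemma picard_lindelof_local:
  fixes \<xi> :: "'a::euclidean_space \<Rightarrow> 'a"
  assumes r: "r > 0" and lip: "\<And>x y. x \<in> cball x0 r \<Longrightarrow> y \<in> cball x0 r \<Longrightarrow> norm (\<xi> x - \<xi> y) \<le> L * norm (x - y)"
  obtains b \<gamma> where "b > 0" "\<gamma> 0 = x0"
    "\<forall>t\<in>{0..b}. \<gamma> t \<in> cball x0 r \<and> (\<gamma> has_vector_derivative \<xi> (\<gamma> t)) (at t within {0..b})"
proof -
  let ?K = "cball x0 r"
  define L' where "L' = max L 0"
  have lip': "norm (\<xi> x - \<xi> y) \<le> L' * norm (x - y)" if "x \<in> ?K" "y \<in> ?K" for x y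
    using lip[OF that] mult_right_mono[of L L' "norm (x - y)"] by (auto simp: L'_def)
  have x0: "x0 \<in> ?K" using r by simp
  define X where "X x = \<xi> (closest_point ?K x)" for x
  have cp: "closest_point ?K x \<in> ?K" for x
    by (rule closest_point_in_set) (use r in auto)
  have lipX: "norm (X x - X y) \<le> L' * norm (x - y)" for x y
  proof -
    have "norm (X x - X y) \<le> L' * norm (closest_point ?K x - closest_point ?K y)"
      unfolding X_def by (rule lip'[OF cp cp])
    also have "\<dots> \<le> L' * norm (x - y)"
      using closest_point_lipschitz[of ?K x y] r by (intro mult_left_mono) (auto simp: dist_norm L'_def)
    finally show ?thesis .
  qed
  have contX: "continuous_on S X" for S
  proof -
    have "L'-lipschitz_on S X"
      by (rule lipschitz_onI) (use lipX in \<open>auto simp: dist_norm L'_def\<close>)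
    then show ?thesis by (rule lipschitz_on_continuous_on)
  qed
  define B where "B = norm (\<xi> x0) + L' * r"
  have bX: "norm (X x) \<le> B" for x
  proof -
    have "norm (X x - \<xi> x0) \<le> L' * norm (closest_point ?K x - x0)"
      unfolding X_def by (rule lip'[OF cp x0])
    also have "\<dots> \<le> L' * r"
      using cp[of x] by (intro mult_left_mono) (auto simp: dist_norm norm_minus_commute L'_def)
    finally show ?thesis using norm_triangle_ineq[of "X x - \<xi> x0" "\<xi> x0"] by (simp add: B_def)
  qed
  have B: "B \<ge> 0" using bX[of x0] norm_ge_zero order_trans by blast
  \<comment> \<open>The first entry makes the operator a contraction with factor 1/2, the second
    keeps the curve within distance r of its start.\<close>
  define b where "b = min (1 / (2 * (L' + 1))) (r / (B + 1))"
  have b: "b > 0" "b * L' \<le> 1/2" "b * B \<le> r"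
  proof -
    have L0: "L' \<ge> 0" by (simp add: L'_def)
    then show "b > 0" using r B by (simp add: b_def)
    have "b * L' \<le> 1 / (2 * (L' + 1)) * L'" using L0 by (intro mult_right_mono) (auto simp: b_def)
    also have "\<dots> \<le> 1/2" using L0 by (simp add: field_simps)
    finally show "b * L' \<le> 1/2" .
    have "b * B \<le> r / (B + 1) * B" using B by (intro mult_right_mono) (auto simp: b_def)
    also have "\<dots> \<le> r" using B r by (simp add: field_simps)
    finally show "b * B \<le> r" .
  qed
  \<comment> \<open>Clamping time to the interval from 0 to b lets the operator act on the bounded
    continuous functions on the whole line, a complete space.\<close>
  define cl where "cl t = max 0 (min b t)" for t :: real
  have cl: "0 \<le> cl t" "cl t \<le> b" for t using b by (auto simp: cl_def)
  define T where "T \<gamma> t = x0 + integral {0..cl t} (\<lambda>s. X (apply_bcontfun \<gamma> s))" for \<gamma> :: "real \<Rightarrow>\<^sub>C 'a" and t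
  have contXg: "continuous_on S (\<lambda>s. X (apply_bcontfun \<gamma> s))" for \<gamma> :: "real \<Rightarrow>\<^sub>C 'a" and S
    by (rule continuous_on_compose2[OF contX[of UNIV]]) auto
  have intX: "(\<lambda>s. X (apply_bcontfun \<gamma> s)) integrable_on {0..t}" for \<gamma> :: "real \<Rightarrow>\<^sub>C 'a" and t
    by (intro integrable_continuous_real contXg)
  have Tb: "norm (T \<gamma> t - x0) \<le> r" for \<gamma> t
  proof -
    have "norm (integral {0..cl t} (\<lambda>s. X (apply_bcontfun \<gamma> s))) \<le> B * (cl t - 0)"
      by (rule integral_bound) (use cl bX contXg in auto)
    also have "\<dots> \<le> b * B" using cl[of t] B by (simp add: mult.commute mult_left_mono)
    finally show ?thesis using b by (simp add: T_def)
  qed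
  have T: "T \<gamma> \<in> bcontfun" for \<gamma>
    unfolding bcontfun_def
  proof (intro CollectI conjI)
    have "continuous_on {0..b} (\<lambda>t. integral {0..t} (\<lambda>s. X (apply_bcontfun \<gamma> s)))"
      by (rule indefinite_integral_continuous_1[OF intX])
    then show "continuous_on UNIV (T \<gamma>)"
      unfolding T_def
      by (intro continuous_intros continuous_on_compose2[of "{0..b}" "\<lambda>t. integral {0..t} (\<lambda>s. X (apply_bcontfun \<gamma> s))" UNIV cl])
        (use b in \<open>auto simp: cl intro!: continuous_intros simp: cl_def[abs_def]\<close>)
    show "bounded (range (T \<gamma>))"
      by (rule bounded_subset[OF bounded_cball[of x0 r]]) (use Tb in \<open>auto simp: dist_norm norm_minus_commute\<close>)
  qed
  have "\<exists>!\<gamma>. Bcontfun (T \<gamma>) = \<gamma>"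
  proof (rule banach_fix_type[of "1/2"])
    show "\<forall>\<gamma> \<gamma>'. dist (Bcontfun (T \<gamma>)) (Bcontfun (T \<gamma>')) \<le> 1/2 * dist \<gamma> \<gamma>'"
    proof (intro allI dist_bound)
      fix \<gamma> \<gamma>' :: "real \<Rightarrow>\<^sub>C 'a" and t
      have "dist (T \<gamma> t) (T \<gamma>' t) = norm (integral {0..cl t} (\<lambda>s. X (apply_bcontfun \<gamma> s) - X (apply_bcontfun \<gamma>' s)))"
        by (simp add: T_def dist_norm integral_diff[OF intX intX])
      also have "\<dots> \<le> (L' * dist \<gamma> \<gamma>') * (cl t - 0)"
      proof (rule integral_bound)
        show "norm (X (apply_bcontfun \<gamma> s) - X (apply_bcontfun \<gamma>' s)) \<le> L' * dist \<gamma> \<gamma>'" for s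
          using lipX[of "apply_bcontfun \<gamma> s" "apply_bcontfun \<gamma>' s"]
            mult_left_mono[OF dist_bounded[of \<gamma> s \<gamma>'], of L'] by (simp add: dist_norm L'_def)
      qed (use cl contXg in \<open>auto intro!: continuous_intros\<close>)
      also have "\<dots> \<le> (L' * dist \<gamma> \<gamma>') * b"
        using cl[of t] by (intro mult_left_mono) (auto simp: L'_def)
      also have "\<dots> = (b * L') * dist \<gamma> \<gamma>'" by simp
      also have "\<dots> \<le> 1/2 * dist \<gamma> \<gamma>'" by (intro mult_right_mono b) auto
      finally show "dist (apply_bcontfun (Bcontfun (T \<gamma>)) t) (apply_bcontfun (Bcontfun (T \<gamma>')) t) \<le> 1/2 * dist \<gamma> \<gamma>'"
        by (simp add: Bcontfun_inverse[OF T])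
    qed
  qed auto
  then obtain \<gamma> where \<gamma>: "Bcontfun (T \<gamma>) = \<gamma>" by blast
  then have fixp: "apply_bcontfun \<gamma> t = T \<gamma> t" for t
    using Bcontfun_inverse[OF T, of \<gamma>] by simp
  have in_K: "apply_bcontfun \<gamma> t \<in> ?K" for t
    using Tb[of \<gamma> t] by (simp add: fixp[of t] dist_norm norm_minus_commute)
  have fix_eq: "apply_bcontfun \<gamma> t = x0 + integral {0..t} (\<lambda>s. X (apply_bcontfun \<gamma> s))" if "t \<in> {0..b}" for t
    using fixp[of t] that by (simp add: T_def cl_def)
  have "apply_bcontfun \<gamma> 0 = x0"
    using b fix_eq[of 0] by simp
  moreover have "(apply_bcontfun \<gamma> has_vector_derivative \<xi> (apply_bcontfun \<gamma> t)) (at t within {0..b})"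
    if t: "t \<in> {0..b}" for t
  proof -
    have "((\<lambda>t. x0 + integral {0..t} (\<lambda>s. X (apply_bcontfun \<gamma> s))) has_vector_derivative 0 + X (apply_bcontfun \<gamma> t)) (at t within {0..b})"
      by (intro has_vector_derivative_add has_vector_derivative_const integral_has_vector_derivative contXg t)
    then have "(apply_bcontfun \<gamma> has_vector_derivative 0 + X (apply_bcontfun \<gamma> t)) (at t within {0..b})"
      by (rule has_vector_derivative_transform[OF t, rotated]) (rule fix_eq)
    moreover have "X (apply_bcontfun \<gamma> t) = \<xi> (apply_bcontfun \<gamma> t)"
      unfolding X_def using closest_point_self[OF in_K] by simp
    ultimately show ?thesis by simp
  qed
  ultimately show ?thesis using that[of b "apply_bcontfun \<gamma>"] b in_K by blast
qed

section \<open>Wirtinger derivatives and holomorphic extensions\<close>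

lemma emb_axis: "emb (axis j 1) = z_dir j + zbar_dir j" "emb (axis j \<i>) = \<i> *\<^sub>C z_dir j - \<i> *\<^sub>C zbar_dir j"
  by (auto simp: emb_def z_dir_def zbar_dir_def vec_eq_iff axis_def cscale_prod_def cscale_vec_def cscale_complex_def)

text \<open>\<open>emb\<close> sends the real basis vectors to a sum and to i times a difference of
  \<open>z_dir\<close> and \<open>zbar_dir\<close> (\<open>emb_axis\<close>); the combinations in
  the Wirtinger derivatives isolate one of the two.\<close>

lemma wirtinger_of_ext:
  assumes F: "F holo_on S" "p \<in> S" and d: "(f has_derivative (\<lambda>v. dird (emb v) F p)) (at z)"
  shows "dz j f z = dird (z_dir j) F p" "dzbar j f z = dird (zbar_dir j) F p"
    "frechet_derivative f (at z) = (\<lambda>v. dird (emb v) F p)"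
proof -
  show e: "frechet_derivative f (at z) = (\<lambda>v. dird (emb v) F p)"
    using frechet_derivative_at[OF d] by simp
  show "dz j f z = dird (z_dir j) F p" "dzbar j f z = dird (zbar_dir j) F p"
    unfolding dz_def dzbar_def e emb_axis dird_direction[OF F]
    by (simp_all add: algebra_simps)
qed

lemma ext_has_derivative:
  fixes y :: "complex^'n::finite"
  assumes H: "H holo_on ball 0 r" and f: "\<And>y. emb y \<in> ball 0 r \<Longrightarrow> H (emb y) = f y" and y: "emb y \<in> ball 0 r"
  shows "(f has_derivative (\<lambda>v. dird (emb v) H (emb y))) (at y)"
proof (rule has_derivative_transform_within_open)
  show "((\<lambda>y. H (emb y)) has_derivative (\<lambda>v. dird (emb v) H (emb y))) (at y)"
    using holo_on_compose_affine_has_derivative[OF H bounded_linear_emb, of y 0] y by simp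
  show "open {y :: complex^'n. emb y \<in> ball 0 r}"
    by (intro open_vimage[unfolded vimage_def] open_ball bounded_linear.continuous_on[OF bounded_linear_emb] continuous_intros)
qed (use y f in auto)

lemma real_linear_expansion:
  fixes f :: "complex^'n::finite \<Rightarrow> complex"
  assumes "linear f"
  shows "f v = (\<Sum>j\<in>UNIV. (f (axis j 1) - \<i> * f (axis j \<i>)) / 2 * v $ j + (f (axis j 1) + \<i> * f (axis j \<i>)) / 2 * cnj (v $ j))"
proof -
  have v: "v = (\<Sum>j\<in>UNIV. Re (v $ j) *\<^sub>R axis j 1 + Im (v $ j) *\<^sub>R axis j \<i>)"
    by (auto simp: vec_eq_iff axis_def complex_eq_iff if_distrib cong: if_cong)
  have "f v = (\<Sum>j\<in>UNIV. Re (v $ j) *\<^sub>R f (axis j 1) + Im (v $ j) *\<^sub>R f (axis j \<i>))"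
    by (subst v) (simp add: linear_sum[OF assms] linear_add[OF assms] linear_scale[OF assms])
  also have "\<dots> = (\<Sum>j\<in>UNIV. (f (axis j 1) - \<i> * f (axis j \<i>)) / 2 * v $ j + (f (axis j 1) + \<i> * f (axis j \<i>)) / 2 * cnj (v $ j))"
    by (rule sum.cong) (auto simp: complex_eq_iff field_simps)
  finally show ?thesis .
qed

lemma frechet_derivative_wirtinger:
  assumes "f differentiable at z"
  shows "frechet_derivative f (at z) v = (\<Sum>j\<in>UNIV. dz j f z * v $ j + dzbar j f z * cnj (v $ j))"
  unfolding dz_def dzbar_def
  by (rule real_linear_expansion) (use assms in \<open>simp add: linear_frechet_derivative\<close>)

lemma real_analytic_imp_local_ext:
  fixes f :: "complex^'n::finite \<Rightarrow> complex"
  assumes "real_analytic_on f S" "x \<in> S"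
  obtains r F where "r > 0" "F holo_on ball 0 r" "\<forall>y. emb (y - x) \<in> ball 0 r \<longrightarrow>
     F (emb (y - x)) = f y \<and> (f has_derivative (\<lambda>v. dird (emb v) F (emb (y - x)))) (at y)"
proof -
  obtain r F where rF: "r > 0" "F holo_on ball 0 r" and F: "\<And>h. emb h \<in> ball 0 r \<Longrightarrow> F (emb h) = f (x + h)"
    using real_analytic_on_imp_holo_ext[OF assms] by blast
  have eq: "F (emb (y - x)) = f y" if "emb (y - x) \<in> ball 0 r" for y
    using F[OF that] by simp
  have E: "emb y + emb (- x) = emb (y - x)" for y
    by (simp flip: emb_simps)
  have "(f has_derivative (\<lambda>v. dird (emb v) F (emb (y - x)))) (at y)" if y: "emb (y - x) \<in> ball 0 r" for y
  proof -
    have "((\<lambda>y. F (emb y + emb (- x))) has_derivative (\<lambda>v. dird (emb v) F (emb y + emb (- x)))) (at y)"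
      by (rule holo_on_compose_affine_has_derivative[OF rF(2) bounded_linear_emb]) (simp only: E y)
    then have d: "((\<lambda>y. F (emb (y - x))) has_derivative (\<lambda>v. dird (emb v) F (emb (y - x)))) (at y)"
      by (simp only: E)
    have o: "open {y. emb (y - x) \<in> ball 0 r}"
      by (intro open_vimage[unfolded vimage_def] open_ball bounded_linear.continuous_on[OF bounded_linear_emb] continuous_intros)
    show ?thesis
      by (rule has_derivative_transform_within_open[OF d o]) (use y eq in auto)
  qed
  then show ?thesis using that[OF rF] eq by blast
qed

section \<open>Complex tangent spaces of a graph\<close>

context
  fixes \<rho> :: "complex^'n::finite \<Rightarrow> complex" and \<Omega> :: "(complex^'n) set"
  assumes \<Omega>: "open \<Omega>" and \<rho>: "real_analytic_on \<rho> \<Omega>"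
begin

lemma graph_differentiable: "z \<in> \<Omega> \<Longrightarrow> \<rho> differentiable at z"
proof -
  assume z: "z \<in> \<Omega>"
  obtain r F where r: "r > 0" "F holo_on ball 0 r" and F: "\<forall>y. emb (y - z) \<in> ball 0 r \<longrightarrow>
     F (emb (y - z)) = \<rho> y \<and> (\<rho> has_derivative (\<lambda>v. dird (emb v) F (emb (y - z)))) (at y)"
    by (rule real_analytic_imp_local_ext[OF \<rho> z])
  have "emb (z - z) \<in> ball 0 r" using r by (simp add: emb_simps(3))
  then have "(\<rho> has_derivative (\<lambda>v. dird (emb v) F (emb (z - z)))) (at z)"
    using F by blast
  then show ?thesis by (rule differentiableI)
qed

lemma graph_has_derivative: "z \<in> \<Omega> \<Longrightarrow> (\<rho> has_derivative frechet_derivative \<rho> (at z)) (at z)"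
  using graph_differentiable frechet_derivative_works by blast

lemma tangent_space_graph:
  assumes z: "z \<in> \<Omega>"
  shows "tangent_space (graph_over \<rho> \<Omega>) (z, \<rho> z) = {(v, frechet_derivative \<rho> (at z) v) |v. True}"
proof (intro equalityI subsetI)
  fix w assume "w \<in> tangent_space (graph_over \<rho> \<Omega>) (z, \<rho> z)"
  then obtain \<gamma> where \<gamma>: "\<gamma> 0 = (z, \<rho> z)" "(\<gamma> has_vector_derivative w) (at 0)" "\<forall>\<^sub>F t in nhds 0. \<gamma> t \<in> graph_over \<rho> \<Omega>"
    unfolding tangent_space_def by blast
  have d1: "((\<lambda>t. fst (\<gamma> t)) has_vector_derivative fst w) (at 0)"
    and d2: "((\<lambda>t. snd (\<gamma> t)) has_vector_derivative snd w) (at 0)"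
    using bounded_linear.has_vector_derivative[OF bounded_linear_fst \<gamma>(2)]
      bounded_linear.has_vector_derivative[OF bounded_linear_snd \<gamma>(2)] by auto
  have "(\<rho> has_derivative frechet_derivative \<rho> (at z)) (at (fst (\<gamma> 0)))"
    using graph_has_derivative[OF z] \<gamma>(1) by simp
  then have "((\<lambda>t. \<rho> (fst (\<gamma> t))) has_vector_derivative frechet_derivative \<rho> (at z) (fst w)) (at 0)"
    using vector_derivative_diff_chain_within[OF d1, of \<rho>] by (simp add: o_def has_derivative_at_withinI)
  moreover have "\<forall>\<^sub>F t in nhds 0. \<rho> (fst (\<gamma> t)) = snd (\<gamma> t)"
    using \<gamma>(3) by (rule eventually_mono) (auto simp: graph_over_def)
  ultimately have "((\<lambda>t. snd (\<gamma> t)) has_vector_derivative frechet_derivative \<rho> (at z) (fst w)) (at 0)"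
    using has_vector_derivative_cong_ev[where x = 0 and f = "\<lambda>t. \<rho> (fst (\<gamma> t))" and g = "\<lambda>t. snd (\<gamma> t)" and S = UNIV] \<gamma>(1)
    by (auto elim: eventually_mono)
  then have "snd w = frechet_derivative \<rho> (at z) (fst w)"
    by (rule vector_derivative_unique_at[OF d2])
  then show "w \<in> {(v, frechet_derivative \<rho> (at z) v) |v. True}"
    by (auto intro!: exI[of _ "fst w"] simp: prod_eq_iff)
next
  fix w assume "w \<in> {(v, frechet_derivative \<rho> (at z) v) |v. True}"
  then obtain v where w: "w = (v, frechet_derivative \<rho> (at z) v)" by blast
  define \<gamma> where "\<gamma> t = (z + t *\<^sub>R v, \<rho> (z + t *\<^sub>R v))" for t :: real
  have d1: "((\<lambda>t. z + t *\<^sub>R v) has_vector_derivative v) (at 0)"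
    by (auto intro!: derivative_eq_intros)
  have "(\<rho> has_derivative frechet_derivative \<rho> (at z)) (at (z + 0 *\<^sub>R v))"
    using graph_has_derivative[OF z] by simp
  then have d2: "((\<lambda>t. \<rho> (z + t *\<^sub>R v)) has_vector_derivative frechet_derivative \<rho> (at z) v) (at 0)"
    using vector_derivative_diff_chain_within[OF d1, of \<rho>] by (simp add: o_def has_derivative_at_withinI)
  have "(\<gamma> has_vector_derivative w) (at 0)"
    unfolding \<gamma>_def w by (rule has_vector_derivative_Pair[OF d1 d2])
  moreover have "\<gamma> 0 = (z, \<rho> z)" by (simp add: \<gamma>_def)
  moreover have "\<forall>\<^sub>F t in nhds 0. \<gamma> t \<in> graph_over \<rho> \<Omega>"
  proof -
    have "((\<lambda>t. z + t *\<^sub>R v) \<longlongrightarrow> z) (nhds 0)"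
      by (auto intro!: tendsto_eq_intros filterlim_ident)
    then have "\<forall>\<^sub>F t in nhds 0. z + t *\<^sub>R v \<in> \<Omega>"
      by (rule topological_tendstoD[OF _ \<Omega> z])
    then show ?thesis by (rule eventually_mono) (auto simp: \<gamma>_def graph_over_def)
  qed
  ultimately show "w \<in> tangent_space (graph_over \<rho> \<Omega>) (z, \<rho> z)"
    unfolding tangent_space_def by blast
qed

text \<open>A tangent vector (v, D v) is complex tangent when D is compatible with multiplication by
  i on the complex line of v. The failure of compatibility is -2i times the antilinear part of D,
  whose coefficients are the derivatives \<open>dzbar j \<rho>\<close>.\<close>

lemma complex_tangent_space_graph:
  assumes z: "z \<in> \<Omega>"
  shows "complex_tangent_space (graph_over \<rho> \<Omega>) (z, \<rho> z)
    = (\<lambda>v. (v, frechet_derivative \<rho> (at z) v)) ` {v. (\<Sum>j\<in>UNIV. dzbar j \<rho> z * cnj (v $ j)) = 0}"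
proof -
  let ?D = "frechet_derivative \<rho> (at z)"
  note D = frechet_derivative_wirtinger[OF graph_differentiable[OF z]]
  have i: "?D (\<i> *s v) = \<i> * ?D v \<longleftrightarrow> (\<Sum>j\<in>UNIV. dzbar j \<rho> z * cnj (v $ j)) = 0" for v
  proof -
    have "?D (\<i> *s v) - \<i> * ?D v = (- 2 * \<i>) * (\<Sum>j\<in>UNIV. dzbar j \<rho> z * cnj (v $ j))"
      unfolding D sum_distrib_left by (simp add: algebra_simps flip: sum_subtractf)
    then show ?thesis unfolding eq_iff_diff_eq_0[of "?D (\<i> *s v)"] by simp
  qed
  have s: "(\<Sum>j\<in>UNIV. dzbar j \<rho> z * cnj ((c *s v) $ j)) = cnj c * (\<Sum>j\<in>UNIV. dzbar j \<rho> z * cnj (v $ j))" for c v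
    by (simp add: sum_distrib_left mult_ac)
  show ?thesis
    unfolding complex_tangent_space_def tangent_space_graph[OF z]
  proof (intro equalityI subsetI)
    fix w assume "w \<in> {(v, ?D v) |v. True} \<inter> J ` {(v, ?D v) |v. True}"
    then obtain v v' where w: "w = (v, ?D v)" "w = J (v', ?D v')" by blast
    then have "v = \<i> *s v'" "?D (\<i> *s v') = \<i> * ?D v'" by (auto simp: J_def)
    then show "w \<in> (\<lambda>v. (v, ?D v)) ` {v. (\<Sum>j\<in>UNIV. dzbar j \<rho> z * cnj (v $ j)) = 0}"
      using w(1) i[of v'] by (auto simp: s simp del: vector_smult_component)
  next
    fix w assume "w \<in> (\<lambda>v. (v, ?D v)) ` {v. (\<Sum>j\<in>UNIV. dzbar j \<rho> z * cnj (v $ j)) = 0}"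
    then obtain v where w: "w = (v, ?D v)" and v: "(\<Sum>j\<in>UNIV. dzbar j \<rho> z * cnj (v $ j)) = 0" by blast
    define v' where "v' = (- \<i>) *s v"
    have v': "\<i> *s v' = v" by (simp add: v'_def vec_eq_iff)
    have "(\<Sum>j\<in>UNIV. dzbar j \<rho> z * cnj (v' $ j)) = 0" unfolding v'_def s v by simp
    then have "?D v = \<i> * ?D v'" using i[of v'] v' by simp
    then have "w = J (v', ?D v')" using w v' by (simp add: J_def)
    then show "w \<in> {(v, ?D v) |v. True} \<inter> J ` {(v, ?D v) |v. True}" using w by blast
  qed
qed

text \<open>In real terms the kernel is the orthogonal complement of the plane spanned by the
  coefficient vector b and i b, which are orthogonal to each other.\<close>

lemma dim_cr_kernel:
  fixes \<beta> :: "'n \<Rightarrow> complex"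
  assumes "\<beta> j \<noteq> 0"
  shows "dim {v :: complex^'n. (\<Sum>j\<in>UNIV. \<beta> j * cnj (v $ j)) = 0} + 2 = DIM(complex^'n)"
proof -
  define b :: "complex^'n" where "b = (\<chi> j. \<beta> j)"
  have b0: "b \<noteq> 0" "\<i> *s b \<noteq> 0" using assms by (auto simp: b_def vec_eq_iff intro!: exI[of _ j])
  have inner: "b \<bullet> v = Re (\<Sum>j\<in>UNIV. \<beta> j * cnj (v $ j))" "(\<i> *s b) \<bullet> v = - Im (\<Sum>j\<in>UNIV. \<beta> j * cnj (v $ j))" for v
    by (simp_all add: inner_vec_def inner_complex_def b_def sum_negf[symmetric])
  have orth: "b \<bullet> (\<i> *s b) = 0"
    by (simp add: inner_vec_def inner_complex_def b_def)
  have ne: "b \<noteq> \<i> *s b"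
    using orth b0 by (metis inner_eq_zero_iff)
  have "independent {b, \<i> *s b}"
    by (rule pairwise_orthogonal_independent) (use orth b0 in \<open>auto simp: pairwise_def orthogonal_def inner_commute\<close>)
  then have "dim (span {b, \<i> *s b}) = 2"
    using dim_eq_card_independent ne by (metis card_2_iff dim_span)
  moreover have "{v. (\<Sum>j\<in>UNIV. \<beta> j * cnj (v $ j)) = 0} = {y \<in> UNIV. \<forall>x\<in>span {b, \<i> *s b}. orthogonal x y}"
  proof (intro equalityI subsetI)
    fix v assume "v \<in> {v. (\<Sum>j\<in>UNIV. \<beta> j * cnj (v $ j)) = 0}"
    then have "orthogonal v x" if "x \<in> {b, \<i> *s b}" for x
      using inner[of v] that by (auto simp: orthogonal_def inner_commute)
    then show "v \<in> {y \<in> UNIV. \<forall>x\<in>span {b, \<i> *s b}. orthogonal x y}"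
      using orthogonal_to_span orthogonal_commute by blast
  next
    fix v assume "v \<in> {y \<in> UNIV. \<forall>x\<in>span {b, \<i> *s b}. orthogonal x y}"
    then have "b \<bullet> v = 0" "(\<i> *s b) \<bullet> v = 0" by (auto simp: orthogonal_def span_base)
    then show "v \<in> {v. (\<Sum>j\<in>UNIV. \<beta> j * cnj (v $ j)) = 0}" using inner[of v] by (simp add: complex_eq_iff)
  qed
  ultimately show ?thesis
    using dim_subspace_orthogonal_to_vectors[of "span {b, \<i> *s b}" UNIV] by simp
qed

lemma dim_complex_tangent_space_graph:
  assumes z: "z \<in> \<Omega>" and nz: "dzbar j \<rho> z \<noteq> 0"
  shows "dim (complex_tangent_space (graph_over \<rho> \<Omega>) (z, \<rho> z)) + 2 = DIM(complex^'n)"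
proof -
  let ?D = "frechet_derivative \<rho> (at z)"
  have lD: "linear ?D" using graph_differentiable[OF z] by (rule linear_frechet_derivative)
  have "linear (\<lambda>v. (v, ?D v))"
    by (rule linearI) (auto simp: linear_add[OF lD] linear_scale[OF lD])
  then have "dim ((\<lambda>v. (v, ?D v)) ` {v. (\<Sum>j\<in>UNIV. dzbar j \<rho> z * cnj (v $ j)) = 0})
      = dim {v. (\<Sum>j\<in>UNIV. dzbar j \<rho> z * cnj (v $ j)) = 0}"
    by (rule dim_image_eq) (auto simp: inj_on_def)
  then show ?thesis
    unfolding complex_tangent_space_graph[OF z] using dim_cr_kernel[of "\<lambda>j. dzbar j \<rho> z" j] nz by simp
qed

end

section \<open>First integrals and CR functions\<close>

lemma J_eq_cscale: "J v = \<i> *\<^sub>C v"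
  by (simp add: J_def cscale_prod_def cscale_eq_vector_scalar_mult cscale_complex_def)

text \<open>A real linear map that commutes with J is complex linear, because c = Re c + i Im
  c.\<close>

lemma holomorphic_sev_iff_holo_on: "holomorphic_sev F U \<longleftrightarrow> F holo_on U"
proof
  assume F: "holomorphic_sev F U"
  show "F holo_on U"
    unfolding holo_on_def
  proof
    fix p assume p: "p \<in> U"
    let ?F' = "frechet_derivative F (at p)"
    have d: "(F has_derivative ?F') (at p)" and J: "?F' (J v) = \<i> * ?F' v" for v
      using F p unfolding holomorphic_sev_def frechet_derivative_works by blast+
    have lin: "linear ?F'" using d has_derivative_linear by blast
    have "?F' (c *\<^sub>C v) = c *\<^sub>C ?F' v" for c v
    proof -
      have "(of_real (Re c) + of_real (Im c) * \<i>) *\<^sub>C v = Re c *\<^sub>R v + Im c *\<^sub>R J v"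
        by (simp add: J_eq_cscale cscale_add_left cscale_of_real scaleR_cscale)
      moreover have "of_real (Re c) + of_real (Im c) * \<i> = c" by (simp add: complex_eq_iff)
      ultimately have "c *\<^sub>C v = Re c *\<^sub>R v + Im c *\<^sub>R J v" by simp
      then have "?F' (c *\<^sub>C v) = Re c *\<^sub>R ?F' v + Im c *\<^sub>R (\<i> * ?F' v)"
        by (simp add: linear_add[OF lin] linear_scale[OF lin] J)
      then show ?thesis by (simp add: cscale_complex_def complex_eq_iff)
    qed
    then show "\<exists>f'. complex_linear f' \<and> (F has_derivative f') (at p)"
      using d has_derivative_bounded_linear[OF d] unfolding complex_linear_def by blast
  qed
next
  assume F: "F holo_on U"
  show "holomorphic_sev F U"
    unfolding holomorphic_sev_def
  proof (intro ballI conjI allI)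
    fix p v assume p: "p \<in> U"
    note d = holo_on_has_derivative[OF F p]
    show "F differentiable (at p)" using d(1) by (rule differentiableI)
    have e: "frechet_derivative F (at p) = (\<lambda>v. dird v F p)"
      using frechet_derivative_at[OF d(1)] by simp
    show "frechet_derivative F (at p) (J v) = \<i> * frechet_derivative F (at p) v"
      unfolding e J_eq_cscale dird_direction[OF F p] ..
  qed
qed

text \<open>On the complex tangent space the derivative of a holomorphic function that is real on \<open>M\<close> is
  complex linear and real-valued, hence zero.\<close>

lemma dird_complex_tangent_eq_0:
  assumes F: "F holo_on U" and p: "p \<in> M" and U: "M \<subseteq> U"
    and re: "\<And>p. p \<in> M \<Longrightarrow> F p \<in> \<real>" and v: "v \<in> complex_tangent_space M p"
  shows "dird v F p = 0"
proof -
  have pU: "p \<in> U" using p U by blast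
  have real: "Im (dird v F p) = 0" if v: "v \<in> tangent_space M p" for v
  proof -
    obtain \<gamma> where \<gamma>: "\<gamma> 0 = p" "(\<gamma> has_vector_derivative v) (at 0)" "\<forall>\<^sub>F t in nhds 0. \<gamma> t \<in> M"
      using v unfolding tangent_space_def by blast
    have "(F has_derivative (\<lambda>v. dird v F p)) (at (\<gamma> 0) within \<gamma> ` UNIV)"
      using has_derivative_at_withinI[OF holo_on_has_derivative(1)[OF F pU]] \<gamma>(1) by simp
    then have "((\<lambda>t. F (\<gamma> t)) has_vector_derivative dird v F p) (at 0)"
      using vector_derivative_diff_chain_within[of \<gamma> v 0 UNIV F "\<lambda>v. dird v F p"] \<gamma>(2) by (simp add: o_def)
    then have d: "((\<lambda>t. Im (F (\<gamma> t))) has_vector_derivative Im (dird v F p)) (at 0)"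
      by (rule bounded_linear.has_vector_derivative[OF bounded_linear_Im])
    have "\<forall>\<^sub>F t in nhds 0. t \<in> UNIV \<longrightarrow> Im (F (\<gamma> t)) = 0"
      using \<gamma>(3) by (rule eventually_mono) (use re in \<open>auto simp: complex_is_Real_iff\<close>)
    then have "((\<lambda>t. 0) has_vector_derivative Im (dird v F p)) (at (0::real))"
      using d has_vector_derivative_cong_ev[where x = 0 and f = "\<lambda>t. Im (F (\<gamma> t))" and g = "\<lambda>t. 0" and S = UNIV] re[OF p] \<gamma>(1)
      by (simp add: complex_is_Real_iff)
    then show ?thesis
      by (rule vector_derivative_unique_at) (rule has_vector_derivative_const)
  qed
  obtain v' where v': "v = J v'" "v' \<in> tangent_space M p" "v \<in> tangent_space M p"
    using v unfolding complex_tangent_space_def by blast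
  have "dird v F p = \<i> * dird v' F p"
    unfolding v'(1) J_eq_cscale by (rule dird_direction(2)[OF F pU])
  then show ?thesis using real[OF v'(2)] real[OF v'(3)] by (simp add: complex_eq_iff)
qed

text \<open>The differential of F vanishes on complex tangent vectors, so F is constant along each
  integral curve and, by induction on the number of steps, on each orbit.\<close>

lemma real_holo_imp_first_integral:
  assumes F: "F holo_on U" and U: "M \<subseteq> U" and re: "\<And>p. p \<in> M \<Longrightarrow> F p \<in> \<real>"
  shows "first_integral M (\<lambda>p. Re (F p))"
proof -
  have step: "F p = F q" if s: "CR_step M p q" for p q
  proof -
    obtain X \<gamma> a b where X: "CR_vector_field M X" and ab: "a \<le> b" "\<gamma> a = p" "\<gamma> b = q"
      and \<gamma>': "\<forall>t\<in>{a..b}. \<gamma> t \<in> CR_points M \<and> (\<gamma> has_vector_derivative X (\<gamma> t)) (at t within {a..b})"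
      using s unfolding CR_step_def by blast
    have \<gamma>: "\<gamma> t \<in> CR_points M" "(\<gamma> has_vector_derivative X (\<gamma> t)) (at t within {a..b})" if "t \<in> {a..b}" for t
      using \<gamma>' that by blast+
    have "((\<lambda>t. F (\<gamma> t)) has_vector_derivative 0) (at t within {a..b})" if t: "t \<in> {a..b}" for t
    proof -
      have M: "\<gamma> t \<in> M" using \<gamma>(1)[OF t] by (auto simp: CR_points_def)
      then have "dird (X (\<gamma> t)) F (\<gamma> t) = 0"
        using X \<gamma>(1)[OF t] unfolding CR_vector_field_def by (intro dird_complex_tangent_eq_0[OF F _ U re]) auto
      then show ?thesis
        using vector_derivative_diff_chain_within[OF \<gamma>(2)[OF t]
            has_derivative_at_withinI[OF holo_on_has_derivative(1)[OF F subsetD[OF U M]]]]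
        by (simp add: o_def)
    qed
    then obtain c where "\<And>t. t \<in> {a..b} \<Longrightarrow> F (\<gamma> t) = c"
      using has_vector_derivative_zero_constant[of "{a..b}" "\<lambda>t. F (\<gamma> t)"] by auto
    then show ?thesis using ab by (metis atLeastAtMost_iff order_refl)
  qed
  have "F p = F q" if "(CR_step M)\<^sup>*\<^sup>* p q" for p q
    using that by (induction rule: rtranclp_induct) (use step in auto)
  then show ?thesis unfolding first_integral_def CR_orbit_def by (metis mem_Collect_eq)
qed

text \<open>The vector with entries only at j and k that is annihilated by the antilinear part of
  the differential of \<rho>, as with a gradient rotated by a right angle. The complex factor c
  sweeps out a complex line of directions; c = 1 and c = i together separate the two Wirtinger parts
  of a first integral.\<close>

definition cr_field :: "(complex^'n::finite \<Rightarrow> complex) \<Rightarrow> 'n \<Rightarrow> 'n \<Rightarrow> complex \<Rightarrow> complex^'n \<Rightarrow> complex^'n" where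
  "cr_field \<rho> j k c z = axis j (c * cnj (dzbar k \<rho> z)) - axis k (c * cnj (dzbar j \<rho> z))"

lemma sum_axis_mult: "(\<Sum>l\<in>UNIV. \<alpha> l * axis j c $ l) = \<alpha> j * (c :: complex)"
  "(\<Sum>l\<in>UNIV. \<alpha> l * cnj (axis j c $ l)) = \<alpha> j * cnj c"
proof -
  have "(\<Sum>l\<in>UNIV. \<alpha> l * axis j c $ l) = (\<Sum>l\<in>UNIV. if l = j then \<alpha> j * c else 0)"
    "(\<Sum>l\<in>UNIV. \<alpha> l * cnj (axis j c $ l)) = (\<Sum>l\<in>UNIV. if l = j then \<alpha> j * cnj c else 0)"
    by (rule sum.cong; simp add: axis_def)+
  then show "(\<Sum>l\<in>UNIV. \<alpha> l * axis j c $ l) = \<alpha> j * c" "(\<Sum>l\<in>UNIV. \<alpha> l * cnj (axis j c $ l)) = \<alpha> j * cnj c"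
    by simp_all
qed

lemma cr_field_sums:
  "(\<Sum>l\<in>UNIV. \<alpha> l * cr_field \<rho> j k c z $ l) = c * (\<alpha> j * cnj (dzbar k \<rho> z) - \<alpha> k * cnj (dzbar j \<rho> z))"
  "(\<Sum>l\<in>UNIV. \<beta> l * cnj (cr_field \<rho> j k c z $ l)) = cnj c * (\<beta> j * dzbar k \<rho> z - \<beta> k * dzbar j \<rho> z)"
  by (simp_all add: cr_field_def right_diff_distrib sum_subtractf sum_axis_mult algebra_simps)

text \<open>Supplies the Lipschitz condition for integral curves: near-linearity with \<eta> = 1, a
  bound K for the differential at 0, and the factor 2 by which \<open>emb\<close> may increase
  norms.\<close>

lemma holo_lipschitz_along_emb:
  fixes G :: "(complex^'n::finite) \<times> (complex^'n) \<Rightarrow> complex"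
  assumes G: "G holo_on ball 0 r" and r: "r > 0"
  obtains d C where "d > 0" "\<forall>y\<in>cball z d. \<forall>y'\<in>cball z d. cmod (G (emb (y - z)) - G (emb (y' - z))) \<le> C * norm (y - y')"
proof -
  obtain R where R: "R > 0" "R \<le> r"
    "\<And>p p'. p \<in> ball 0 R \<Longrightarrow> p' \<in> ball 0 R \<Longrightarrow> cmod (G p' - G p - dird (p' - p) G 0) \<le> 1 * norm (p' - p)"
    using holo_on_near_linear[OF G r zero_less_one] by blast
  have "bounded_linear (\<lambda>v. dird v G 0)"
    using holo_on_has_derivative(2)[OF G, of 0] r by (simp add: complex_linear_def)
  then obtain K where K: "K > 0" "\<And>v. cmod (dird v G 0) \<le> norm v * K"
    using bounded_linear.pos_bounded by blast
  have "cmod (G (emb (y - z)) - G (emb (y' - z))) \<le> (2 * (K + 1)) * norm (y - y')"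
    if y: "y \<in> cball z (R/4)" "y' \<in> cball z (R/4)" for y y'
  proof -
    have in_R: "emb (x - z) \<in> ball 0 R" if "x \<in> cball z (R/4)" for x
      using norm_emb_le[of "x - z"] that R(1) by (simp add: dist_norm norm_minus_commute del: emb_simps(4))
    have E: "emb (y - z) - emb (y' - z) = emb (y - y')" by (simp add: emb_simps)
    have "cmod (G (emb (y - z)) - G (emb (y' - z))) \<le> cmod (G (emb (y - z)) - G (emb (y' - z)) - dird (emb (y - y')) G 0) + cmod (dird (emb (y - y')) G 0)"
      using norm_triangle_ineq[of "G (emb (y - z)) - G (emb (y' - z)) - dird (emb (y - y')) G 0" "dird (emb (y - y')) G 0"] by simp
    also have "\<dots> \<le> norm (emb (y - y')) + norm (emb (y - y')) * K"
      using R(3)[OF in_R[OF y(2)] in_R[OF y(1)]] K(2)[of "emb (y - y')"] unfolding E by (intro add_mono) auto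
    also have "\<dots> = (K + 1) * norm (emb (y - y'))" by (simp add: algebra_simps)
    also have "\<dots> \<le> (K + 1) * (2 * norm (y - y'))"
      using K by (intro mult_left_mono norm_emb_le) auto
    finally show ?thesis by (simp add: algebra_simps)
  qed
  then have "\<forall>y\<in>cball z (R/4). \<forall>y'\<in>cball z (R/4). cmod (G (emb (y - z)) - G (emb (y' - z))) \<le> (2 * (K + 1)) * norm (y - y')"
    by blast
  then show ?thesis by (rule that[rotated]) (use R in simp)
qed

lemma bounded_linear_axis: "bounded_linear (axis j :: complex \<Rightarrow> complex^'n::finite)"
  using complex_linear_axis unfolding complex_linear_def by blast

context
  fixes \<rho> :: "complex^'n::finite \<Rightarrow> complex" and \<Omega> :: "(complex^'n) set"
  assumes \<Omega>: "open \<Omega>" and \<rho>: "real_analytic_on \<rho> \<Omega>"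
begin

text \<open>The functions G are there because \<open>cr_field\<close> contains conjugates of
  \<open>dzbar k \<rho>\<close>; by reflection these too are restrictions of holomorphic
  functions.\<close>

lemma graph_local_ext:
  assumes "z \<in> \<Omega>"
  obtains r R G where "r > 0" "R holo_on ball 0 r" "\<forall>k. G k holo_on ball 0 r"
    "\<forall>y. emb (y - z) \<in> ball 0 r \<longrightarrow> (\<forall>k. dz k \<rho> y = dird (z_dir k) R (emb (y - z)) \<and>
       dzbar k \<rho> y = dird (zbar_dir k) R (emb (y - z)) \<and> cnj (dzbar k \<rho> y) = G k (emb (y - z)))"
proof -
  obtain r R where rR: "r > 0" "R holo_on ball 0 r" and R: "\<forall>y. emb (y - z) \<in> ball 0 r \<longrightarrow>
     R (emb (y - z)) = \<rho> y \<and> (\<rho> has_derivative (\<lambda>v. dird (emb v) R (emb (y - z)))) (at y)"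
    by (rule real_analytic_imp_local_ext[OF \<rho> assms])
  define G where "G k = (\<lambda>p. cnj (dird (zbar_dir k) R (conj_swap p)))" for k
  have "G k holo_on ball 0 r" for k
    unfolding G_def by (rule holo_on_conj_swap[OF holo_on_dird[OF rR(2) open_ball]])
  moreover have "dz k \<rho> y = dird (z_dir k) R (emb (y - z)) \<and> dzbar k \<rho> y = dird (zbar_dir k) R (emb (y - z)) \<and>
      cnj (dzbar k \<rho> y) = G k (emb (y - z))" if y: "emb (y - z) \<in> ball 0 r" for y k
    using wirtinger_of_ext(1,2)[OF rR(2) y, of \<rho> y] R y by (auto simp: G_def)
  ultimately show ?thesis using that[OF rR] by blast
qed

text \<open>Where some \<open>dzbar j \<rho>\<close> is nonzero the complex tangent space has real
  dimension 2n - 2, and being nonzero is an open condition; so the dimension is locally constant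
  there.\<close>

lemma graph_CR_points:
  assumes z: "z \<in> \<Omega>" and nz: "dzbar j \<rho> z \<noteq> 0"
  obtains \<epsilon> where "\<epsilon> > 0" "ball z \<epsilon> \<subseteq> \<Omega>" "\<forall>y\<in>ball z \<epsilon>. (y, \<rho> y) \<in> CR_points (graph_over \<rho> \<Omega>)"
proof -
  obtain r R G where r: "r > 0" and R: "R holo_on ball 0 r" and "\<forall>k. G k holo_on ball 0 r"
    and eq: "\<forall>y. emb (y - z) \<in> ball 0 r \<longrightarrow> (\<forall>k. dz k \<rho> y = dird (z_dir k) R (emb (y - z)) \<and>
       dzbar k \<rho> y = dird (zbar_dir k) R (emb (y - z)) \<and> cnj (dzbar k \<rho> y) = G k (emb (y - z)))"
    by (rule graph_local_ext[OF z])
  let ?V = "\<Omega> \<inter> {y. emb (y - z) \<in> ball 0 r}"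
  have ce: "continuous_on S (\<lambda>y. emb (y - z))" for S
    by (intro bounded_linear.continuous_on[OF bounded_linear_emb] continuous_intros)
  have oV: "open ?V"
    by (intro open_Int \<Omega> open_vimage[unfolded vimage_def] open_ball ce)
  have cb: "continuous_on ?V (\<lambda>y. dird (zbar_dir j) R (emb (y - z)))"
    by (rule continuous_on_compose2[OF holo_on_imp_continuous_on[OF holo_on_dird[OF R open_ball]] ce]) auto
  have "open (?V \<inter> (\<lambda>y. dird (zbar_dir j) R (emb (y - z))) -` (- {0}))"
    by (rule continuous_open_preimage[OF cb oV]) (simp add: open_Compl)
  moreover have zV: "emb (z - z) \<in> ball 0 r" using r by (simp add: emb_simps(3))
  then have "z \<in> ?V \<inter> (\<lambda>y. dird (zbar_dir j) R (emb (y - z))) -` (- {0})"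
    using z nz eq by auto
  ultimately obtain \<epsilon> where \<epsilon>: "\<epsilon> > 0" "ball z \<epsilon> \<subseteq> ?V \<inter> (\<lambda>y. dird (zbar_dir j) R (emb (y - z))) -` (- {0})"
    using openE by blast
  have nz': "dzbar j \<rho> y \<noteq> 0" "y \<in> \<Omega>" if "y \<in> ball z \<epsilon>" for y
  proof -
    have "y \<in> ?V \<inter> (\<lambda>y. dird (zbar_dir j) R (emb (y - z))) -` (- {0})" using that \<epsilon> by blast
    then show "dzbar j \<rho> y \<noteq> 0" "y \<in> \<Omega>" using eq by auto
  qed
  have dim: "dim (complex_tangent_space (graph_over \<rho> \<Omega>) (y, \<rho> y)) + 2 = DIM(complex^'n)" if "y \<in> ball z \<epsilon>" for y
    by (rule dim_complex_tangent_space_graph[OF \<Omega> \<rho> nz'(2)[OF that] nz'(1)[OF that]])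
  have "(y, \<rho> y) \<in> CR_points (graph_over \<rho> \<Omega>)" if y: "y \<in> ball z \<epsilon>" for y
    unfolding CR_points_def
  proof (intro CollectI conjI exI ballI)
    show "(y, \<rho> y) \<in> graph_over \<rho> \<Omega>" using nz'(2)[OF y] by (auto simp: graph_over_def)
    \<comment> \<open>For a graph, a cylinder over a ball in z isolates the part of M over that
      ball.\<close>
    show "open (ball z \<epsilon> \<times> (UNIV :: complex set))" by (intro open_Times) auto
    show "(y, \<rho> y) \<in> ball z \<epsilon> \<times> UNIV" using y by simp
    fix q assume "q \<in> graph_over \<rho> \<Omega> \<inter> ball z \<epsilon> \<times> UNIV"
    then obtain y' where "q = (y', \<rho> y')" "y' \<in> ball z \<epsilon>" by (auto simp: graph_over_def)
    then show "dim (complex_tangent_space (graph_over \<rho> \<Omega>) q) = dim (complex_tangent_space (graph_over \<rho> \<Omega>) (y, \<rho> y))"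
      using dim[of y'] dim[OF y] by simp
  qed
  moreover have "ball z \<epsilon> \<subseteq> \<Omega>" using nz'(2) by blast
  ultimately show ?thesis using that[OF \<epsilon>(1)] by blast
qed

text \<open>The formula depends on z alone, and its coefficients are restrictions of holomorphic
  functions; hence it extends the field smoothly to a cylinder in the ambient space.\<close>

lemma CR_vector_field_cr_field:
  "CR_vector_field (graph_over \<rho> \<Omega>)
     (\<lambda>q. (cr_field \<rho> j k c (fst q), frechet_derivative \<rho> (at (fst q)) (cr_field \<rho> j k c (fst q))))"
    (is "CR_vector_field ?M ?X")
  unfolding CR_vector_field_def
proof (intro conjI ballI)
  fix p assume "p \<in> CR_points ?M"
  then obtain z where z: "z \<in> \<Omega>" "p = (z, \<rho> z)" by (auto simp: CR_points_def graph_over_def)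
  show "?X p \<in> complex_tangent_space ?M p"
    unfolding z(2) complex_tangent_space_graph[OF \<Omega> \<rho> z(1)]
    by (rule image_eqI[of _ _ "cr_field \<rho> j k c z"]) (simp_all add: cr_field_sums)
next
  show "smooth_on ?X (CR_points ?M)"
    unfolding smooth_on_def
  proof
    fix p assume "p \<in> CR_points ?M"
    then obtain x where x: "x \<in> \<Omega>" "p = (x, \<rho> x)" by (auto simp: CR_points_def graph_over_def)
    obtain r R G where r: "r > 0" and R: "R holo_on ball 0 r" and G: "\<forall>k. G k holo_on ball 0 r"
      and eq: "\<forall>y. emb (y - x) \<in> ball 0 r \<longrightarrow> (\<forall>k. dz k \<rho> y = dird (z_dir k) R (emb (y - x)) \<and>
         dzbar k \<rho> y = dird (zbar_dir k) R (emb (y - x)) \<and> cnj (dzbar k \<rho> y) = G k (emb (y - x)))"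
      by (rule graph_local_ext[OF x(1)])
    define U where "U = {q :: 'n cspace. fst q \<in> \<Omega> \<and> emb (fst q) + emb (- x) \<in> ball 0 r}"
    have E: "emb y + emb (- x) = emb (y - x)" for y by (simp flip: emb_simps)
    have be: "bounded_linear (\<lambda>q :: 'n cspace. emb (fst q))"
      by (rule bounded_linear_compose[OF bounded_linear_emb bounded_linear_fst])
    have "U = fst -` \<Omega> \<inter> (\<lambda>q. emb (fst q) + emb (- x)) -` ball 0 r" by (auto simp: U_def)
    then have oU: "open U"
      using \<Omega> by (auto intro!: open_Int open_vimage continuous_intros bounded_linear.continuous_on[OF be])
    have pU: "p \<in> U" using x r by (simp add: U_def E emb_simps(3))
    let ?G1 = "\<lambda>p. c * G k p" and ?G2 = "\<lambda>p. (- c) * G j p"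
    \<comment> \<open>The w-component is the differential of \<rho> applied to the field. Its
      antilinear part vanishes on complex tangent directions, so only the derivatives
      \<open>dz\<close> occur.\<close>
    let ?G3 = "\<lambda>p. c * (dird (z_dir j) R p * G k p - dird (z_dir k) R p * G j p)"
    have Gh: "?G1 holo_on ball 0 r" "?G2 holo_on ball 0 r" "?G3 holo_on ball 0 r"
      by (intro holo_on_cmult holo_on_diff holo_on_mult holo_on_dird[OF R open_ball] G[rule_format])+
    let ?h = "\<lambda>q. (axis j (?G1 (emb (fst q) + emb (- x))), 0) + (axis k (?G2 (emb (fst q) + emb (- x))), 0)
       + (0, ?G3 (emb (fst q) + emb (- x)))"
    have bl: "bounded_linear (\<lambda>w. (axis l w, 0) :: 'n cspace)" for l
      by (intro bounded_linear_Pair bounded_linear_axis bounded_linear_zero)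
    have bl': "bounded_linear (\<lambda>w. (0, w) :: 'n cspace)"
      by (intro bounded_linear_Pair bounded_linear_ident bounded_linear_zero)
    have Ck: "Ck_on m ?h U" for m
      by (intro Ck_on_add[OF oU] Ck_on_bounded_linear[OF oU bl] Ck_on_bounded_linear[OF oU bl']
          Ck_on_holo_compose_affine[OF Gh(1) open_ball be oU] Ck_on_holo_compose_affine[OF Gh(2) open_ball be oU]
          Ck_on_holo_compose_affine[OF Gh(3) open_ball be oU]) (simp_all add: U_def)
    have hX: "?h q = ?X q" if q: "q \<in> U" for q
    proof -
      have q': "fst q \<in> \<Omega>" "emb (fst q - x) \<in> ball 0 r" using q by (auto simp: U_def E)
      have "frechet_derivative \<rho> (at (fst q)) (cr_field \<rho> j k c (fst q))
          = c * (dz j \<rho> (fst q) * cnj (dzbar k \<rho> (fst q)) - dz k \<rho> (fst q) * cnj (dzbar j \<rho> (fst q)))"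
        unfolding frechet_derivative_wirtinger[OF graph_differentiable[OF \<Omega> \<rho> q'(1)]]
        by (simp add: sum.distrib cr_field_sums)
      moreover have "axis k (- (c * cnj (dzbar j \<rho> (fst q)))) = - (axis k (c * cnj (dzbar j \<rho> (fst q))) :: complex^'n)"
        by (simp add: axis_def vec_eq_iff)
      moreover have "dz l \<rho> (fst q) = dird (z_dir l) R (emb (fst q - x))" "cnj (dzbar l \<rho> (fst q)) = G l (emb (fst q - x))" for l
        using eq q'(2) by blast+
      ultimately show ?thesis
        unfolding E by (simp add: cr_field_def)
    qed
    show "\<exists>U h. open U \<and> p \<in> U \<and> (\<forall>k. Ck_on k h U) \<and> (\<forall>q\<in>CR_points ?M \<inter> U. h q = ?X q)"
      by (rule exI[of _ U], rule exI[of _ ?X]) (use oU pU Ck_on_cong[OF oU hX Ck] in simp)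
  qed
qed

text \<open>The equation is solved in z and the solution is lifted to the graph. A short curve stays
  over the neighbourhood of CR points, so that every point of the lift is reached in one
  step.\<close>

lemma cr_field_integral_curve:
  assumes z: "z \<in> \<Omega>" and nz: "dzbar i \<rho> z \<noteq> 0"
  obtains b \<gamma> where "b > 0" "\<gamma> 0 = z" "(\<gamma> has_vector_derivative cr_field \<rho> j k c z) (at 0 within {0..b})"
    "\<forall>t\<in>{0..b}. CR_step (graph_over \<rho> \<Omega>) (z, \<rho> z) (\<gamma> t, \<rho> (\<gamma> t))"
proof -
  let ?M = "graph_over \<rho> \<Omega>"
  obtain \<epsilon> where \<epsilon>: "\<epsilon> > 0" "ball z \<epsilon> \<subseteq> \<Omega>" "\<forall>y\<in>ball z \<epsilon>. (y, \<rho> y) \<in> CR_points ?M"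
    by (rule graph_CR_points[OF z nz])
  obtain r R G where r: "r > 0" and R: "R holo_on ball 0 r" and G: "\<forall>k. G k holo_on ball 0 r"
    and eq: "\<forall>y. emb (y - z) \<in> ball 0 r \<longrightarrow> (\<forall>k. dz k \<rho> y = dird (z_dir k) R (emb (y - z)) \<and>
       dzbar k \<rho> y = dird (zbar_dir k) R (emb (y - z)) \<and> cnj (dzbar k \<rho> y) = G k (emb (y - z)))"
    by (rule graph_local_ext[OF z])
  obtain d1 C1 where d1: "d1 > 0" "\<forall>y\<in>cball z d1. \<forall>y'\<in>cball z d1. cmod (G k (emb (y - z)) - G k (emb (y' - z))) \<le> C1 * norm (y - y')"
    by (rule holo_lipschitz_along_emb[OF G[rule_format, of k] r])
  obtain d2 C2 where d2: "d2 > 0" "\<forall>y\<in>cball z d2. \<forall>y'\<in>cball z d2. cmod (G j (emb (y - z)) - G j (emb (y' - z))) \<le> C2 * norm (y - y')"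
    by (rule holo_lipschitz_along_emb[OF G[rule_format, of j] r])
  define d where "d = min (min d1 d2) (min (\<epsilon> / 2) (r / 4))"
  have d: "d > 0" using d1 d2 \<epsilon> r by (simp add: d_def)
  have na: "norm (axis l w :: complex^'n) = cmod w" for l w
    by (simp add: norm_vec_def L2_set_def axis_def if_distrib[of norm] if_distrib[of "\<lambda>x. x^2"] cong: if_cong)
  have lip: "norm (cr_field \<rho> j k c y - cr_field \<rho> j k c y') \<le> (cmod c * (C1 + C2)) * norm (y - y')"
    if y: "y \<in> cball z d" "y' \<in> cball z d" for y y'
  proof -
    have in_r: "emb (x - z) \<in> ball 0 r" if "x \<in> cball z d" for x
      using norm_emb_le[of "x - z"] that r by (simp add: d_def dist_norm norm_minus_commute del: emb_simps(4))
    have "cnj (dzbar l \<rho> y) = G l (emb (y - z))" "cnj (dzbar l \<rho> y') = G l (emb (y' - z))" for l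
      using eq in_r[OF y(1)] in_r[OF y(2)] by blast+
    then have "cr_field \<rho> j k c y - cr_field \<rho> j k c y'
        = axis j (c * (G k (emb (y - z)) - G k (emb (y' - z)))) - axis k (c * (G j (emb (y - z)) - G j (emb (y' - z))))"
      by (simp add: cr_field_def axis_def vec_eq_iff algebra_simps)
    also have "norm \<dots> \<le> cmod c * cmod (G k (emb (y - z)) - G k (emb (y' - z))) + cmod c * cmod (G j (emb (y - z)) - G j (emb (y' - z)))"
      by (rule order_trans[OF norm_triangle_ineq4]) (simp only: na norm_mult order_refl)
    also have "\<dots> \<le> cmod c * (C1 * norm (y - y')) + cmod c * (C2 * norm (y - y'))"
      using d1(2) d2(2) y by (intro add_mono mult_left_mono) (auto simp: d_def)
    finally show ?thesis by (simp add: algebra_simps)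
  qed
  obtain b \<gamma> where b: "b > 0" "\<gamma> 0 = z"
    and \<gamma>: "\<forall>t\<in>{0..b}. \<gamma> t \<in> cball z d \<and> (\<gamma> has_vector_derivative cr_field \<rho> j k c (\<gamma> t)) (at t within {0..b})"
    by (rule picard_lindelof_local[OF d lip])
  have in_e: "\<gamma> t \<in> ball z \<epsilon>" if "t \<in> {0..b}" for t
  proof -
    have "dist z (\<gamma> t) \<le> d" using \<gamma> that by simp
    then show ?thesis using \<epsilon>(1) by (simp add: d_def)
  qed
  let ?X = "\<lambda>q. (cr_field \<rho> j k c (fst q), frechet_derivative \<rho> (at (fst q)) (cr_field \<rho> j k c (fst q)))"
  have "CR_step ?M (z, \<rho> z) (\<gamma> t, \<rho> (\<gamma> t))" if t: "t \<in> {0..b}" for t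
    unfolding CR_step_def
  proof (rule exI[of _ ?X], rule exI[of _ "\<lambda>s. (\<gamma> s, \<rho> (\<gamma> s))"], rule exI[of _ 0], rule exI[of _ t], intro conjI ballI)
    fix s assume s: "s \<in> {0..t}"
    then have s': "s \<in> {0..b}" using t by auto
    show "(\<gamma> s, \<rho> (\<gamma> s)) \<in> CR_points ?M" using \<epsilon>(3) in_e[OF s'] by blast
    have "(\<gamma> has_vector_derivative cr_field \<rho> j k c (\<gamma> s)) (at s within {0..b})" using \<gamma> s' by blast
    then have d: "(\<gamma> has_vector_derivative cr_field \<rho> j k c (\<gamma> s)) (at s within {0..t})"
      by (rule has_vector_derivative_within_subset) (use t in auto)
    have "\<gamma> s \<in> \<Omega>" using in_e[OF s'] \<epsilon>(2) by blast
    from vector_derivative_diff_chain_within[OF d has_derivative_at_withinI[OF graph_has_derivative[OF \<Omega> \<rho> this]]]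
    have "((\<lambda>s. \<rho> (\<gamma> s)) has_vector_derivative frechet_derivative \<rho> (at (\<gamma> s)) (cr_field \<rho> j k c (\<gamma> s))) (at s within {0..t})"
      by (simp add: o_def)
    from has_vector_derivative_Pair[OF d this]
    show "((\<lambda>s. (\<gamma> s, \<rho> (\<gamma> s))) has_vector_derivative ?X (\<gamma> s, \<rho> (\<gamma> s))) (at s within {0..t})" by simp
  qed (use t b CR_vector_field_cr_field in auto)
  then show ?thesis using that[of b \<gamma>] b \<gamma> by auto
qed

text \<open>If both derivatives of \<rho> vanish, the claim is 0 = 0. Otherwise the point over z is
  a CR point, and g has derivative zero along \<open>cr_field\<close> for every c. This derivative
  is c P + cnj c * Q, where Q = 0 is the claim.\<close>

lemma first_integral_imp_cr:
  assumes fi: "first_integral (graph_over \<rho> \<Omega>) g" and z: "z \<in> \<Omega>"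
    and u: "(\<lambda>z. complex_of_real (g (z, \<rho> z))) differentiable at z" (is "?u differentiable at z")
  shows "dzbar j ?u z * dzbar k \<rho> z = dzbar k ?u z * dzbar j \<rho> z"
proof (cases "dzbar j \<rho> z = 0 \<and> dzbar k \<rho> z = 0")
  case False
  then obtain i where i: "dzbar i \<rho> z \<noteq> 0" by blast
  obtain \<epsilon> where \<epsilon>: "\<epsilon> > 0" "ball z \<epsilon> \<subseteq> \<Omega>" "\<forall>y\<in>ball z \<epsilon>. (y, \<rho> y) \<in> CR_points (graph_over \<rho> \<Omega>)"
    by (rule graph_CR_points[OF z i])
  have zero: "frechet_derivative ?u (at z) (cr_field \<rho> j k c z) = 0" for c
  proof -
    obtain b \<gamma> where b: "b > 0" "\<gamma> 0 = z" and \<gamma>: "(\<gamma> has_vector_derivative cr_field \<rho> j k c z) (at 0 within {0..b})"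
      and step: "\<forall>t\<in>{0..b}. CR_step (graph_over \<rho> \<Omega>) (z, \<rho> z) (\<gamma> t, \<rho> (\<gamma> t))"
      by (rule cr_field_integral_curve[OF z i])
    have const: "?u (\<gamma> t) = ?u z" if "t \<in> {0..b}" for t
    proof -
      have "(\<gamma> t, \<rho> (\<gamma> t)) \<in> CR_orbit (graph_over \<rho> \<Omega>) (z, \<rho> z)"
        unfolding CR_orbit_def using step that by blast
      moreover have "(z, \<rho> z) \<in> CR_points (graph_over \<rho> \<Omega>)" using \<epsilon> by simp
      ultimately show ?thesis using fi unfolding first_integral_def by auto
    qed
    have "(?u has_derivative frechet_derivative ?u (at z)) (at (\<gamma> 0) within \<gamma> ` {0..b})"
      using u b(2) by (simp add: frechet_derivative_works has_derivative_at_withinI)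
    from vector_derivative_diff_chain_within[OF \<gamma> this]
    have d: "((\<lambda>t. ?u (\<gamma> t)) has_vector_derivative frechet_derivative ?u (at z) (cr_field \<rho> j k c z)) (at 0 within {0..b})"
      by (simp add: o_def)
    have "((\<lambda>t. ?u (\<gamma> t)) has_vector_derivative 0) (at 0 within {0..b})"
      by (rule has_vector_derivative_transform[OF _ _ has_vector_derivative_const[of "?u z"]]) (use b const in auto)
    then show ?thesis
      using vector_derivative_unique_within_closed_interval[of 0 b 0 "\<lambda>t. ?u (\<gamma> t)"] d b by simp
  qed
  define P where "P = dz j ?u z * cnj (dzbar k \<rho> z) - dz k ?u z * cnj (dzbar j \<rho> z)"
  define Q where "Q = dzbar j ?u z * dzbar k \<rho> z - dzbar k ?u z * dzbar j \<rho> z"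
  have PQ: "c * P + cnj c * Q = 0" for c
    using zero[of c] unfolding frechet_derivative_wirtinger[OF u] P_def Q_def
    by (simp add: sum.distrib cr_field_sums)
  \<comment> \<open>The choices c = 1 and c = i eliminate P.\<close>
  have "2 * Q = (1 * P + cnj 1 * Q) + \<i> * (\<i> * P + cnj \<i> * Q)"
    by (simp add: algebra_simps)
  then have "Q = 0" unfolding PQ by simp
  then show ?thesis by (simp add: Q_def)
qed auto

end

section \<open>The quadratic part of the graph\<close>

lemma dird_conj_swap:
  assumes f: "f holo_on ball 0 r" and p: "p \<in> ball 0 r"
  shows "dird v (\<lambda>p. cnj (f (conj_swap p))) p = cnj (dird (conj_swap v) f (conj_swap p))"
proof -
  have p': "conj_swap p \<in> ball 0 r" using p by simp
  have "((\<lambda>p. cnj (f (conj_swap p))) has_derivative (\<lambda>v. cnj (dird (conj_swap v) f (conj_swap p)))) (at p)"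
    by (intro bounded_linear.has_derivative[OF bounded_linear_cnj]
        has_derivative_compose[OF bounded_linear_imp_has_derivative[OF bounded_linear_conj_swap]]
        holo_on_has_derivative(1)[OF f p'])
  from has_derivative_unique[OF this holo_on_has_derivative(1)[OF holo_on_conj_swap[OF f] p]]
  show ?thesis by metis
qed

lemma conj_swap_dirs: "conj_swap (z_dir k) = zbar_dir k" "conj_swap (zbar_dir k) = z_dir k" "conj_swap 0 = 0"
  by (auto simp: conj_swap_def z_dir_def zbar_dir_def vec_eq_iff axis_def prod_eq_iff)

text \<open>The reflection principle: an extension of a real-valued function is symmetric under
  conjugate swapping.\<close>

lemma real_ext_symmetric:
  assumes G: "G holo_on ball 0 r" and r: "r > 0" and re: "\<And>y. emb y \<in> ball 0 r \<Longrightarrow> G (emb y) \<in> \<real>"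
  shows "dird (z_dir k) G 0 = cnj (dird (zbar_dir k) G 0)"
    "dird (z_dir j) (dird (z_dir k) G) 0 = cnj (dird (zbar_dir j) (dird (zbar_dir k) G) 0)"
proof -
  let ?G' = "\<lambda>p. cnj (G (conj_swap p))"
  have G': "?G' holo_on ball 0 r" by (rule holo_on_conj_swap[OF G])
  have vanish: "G p - ?G' p = 0" if "p \<in> ball 0 (r/2)" for p
    by (rule holo_on_vanishing_on_emb[OF holo_on_diff[OF G G'] _ that])
      (use re in \<open>auto simp: complex_is_Real_iff complex_eq_iff\<close>)
  have eq: "G p = ?G' p" if "p \<in> ball 0 (r/2)" for p
    by (rule eq_iff_diff_eq_0[THEN iffD2, OF vanish[OF that]])
  have 0: "0 \<in> ball 0 (r/2)" using r by simp
  have d: "dird (z_dir k) G p = cnj (dird (zbar_dir k) G (conj_swap p))" if p: "p \<in> ball 0 (r/2)" for p k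
  proof -
    have "dird (z_dir k) G p = dird (z_dir k) ?G' p"
      by (rule dird_cong[OF open_ball p eq])
    moreover have "p \<in> ball 0 r" using p norm_ge_zero[of p] by (simp del: norm_ge_zero)
    ultimately show ?thesis using dird_conj_swap[OF G, of p "z_dir k"] by (simp add: conj_swap_dirs)
  qed
  show "dird (z_dir k) G 0 = cnj (dird (zbar_dir k) G 0)"
    using d[OF 0] by (simp add: conj_swap_dirs)
  have "dird (z_dir j) (dird (z_dir k) G) 0 = dird (z_dir j) (\<lambda>p. cnj (dird (zbar_dir k) G (conj_swap p))) 0"
    by (rule dird_cong[OF open_ball 0 d])
  also have "\<dots> = cnj (dird (zbar_dir j) (dird (zbar_dir k) G) 0)"
    using dird_conj_swap[OF holo_on_dird[OF G open_ball], of 0 "z_dir j"] r by (simp add: conj_swap_dirs)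
  finally show "dird (z_dir j) (dird (z_dir k) G) 0 = cnj (dird (zbar_dir j) (dird (zbar_dir k) G) 0)" .
qed

text \<open>The coefficients are removed from the bottom: once the lower ones are zero, dividing by
  the matching power of t leaves a bound that tends to 0 with t.\<close>

lemma quadratic_eq_0_of_cubic_bound:
  fixes c0 c1 c2 :: complex
  assumes "d > 0" "\<And>t. 0 < t \<Longrightarrow> t < d \<Longrightarrow> cmod (c0 + c1 * of_real t + c2 * of_real t ^ 2) \<le> K * t ^ 3"
  shows "c0 = 0" "c1 = 0" "c2 = 0"
proof -
  have ev: "\<forall>\<^sub>F t in at_right 0. 0 < t \<and> t < d"
    using assms(1) by (simp add: eventually_at_right_less eventually_conj order_tendstoD(2)[OF tendsto_ident_at])
  have lim: "c = 0" if l: "((\<lambda>t::real. c + c' * of_real t + c'' * of_real t ^ 2) \<longlongrightarrow> c) (at_right 0)"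
    and b: "\<And>t. 0 < t \<Longrightarrow> t < d \<Longrightarrow> cmod (c + c' * of_real t + c'' * of_real t ^ 2) \<le> K * t" for c c' c'' :: complex and K
  proof (rule tendsto_unique[OF trivial_limit_at_right_real l])
    show "((\<lambda>t::real. c + c' * of_real t + c'' * of_real t ^ 2) \<longlongrightarrow> 0) (at_right 0)"
    proof (rule Lim_null_comparison)
      show "\<forall>\<^sub>F t in at_right 0. norm (c + c' * of_real t + c'' * of_real t ^ 2) \<le> K * t"
        using ev by (rule eventually_mono) (use b in blast)
      show "((\<lambda>t. K * t) \<longlongrightarrow> 0) (at_right 0)" by (auto intro!: tendsto_eq_intros)
    qed
  qed
  have l: "((\<lambda>t::real. c + c' * of_real t + c'' * of_real t ^ 2) \<longlongrightarrow> c) (at_right 0)" for c c' c'' :: complex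
    by (auto intro!: tendsto_eq_intros)
  show c0: "c0 = 0"
  proof (rule lim[OF l])
    fix t assume t: "0 < t" "t < d"
    have "K * t ^ 3 \<le> (\<bar>K\<bar> * d ^ 2) * t"
    proof -
      have "K * t ^ 3 \<le> \<bar>K\<bar> * t ^ 3" using t by (intro mult_right_mono) auto
      also have "\<dots> = \<bar>K\<bar> * t ^ 2 * t" by (simp add: power2_eq_square power3_eq_cube)
      also have "\<dots> \<le> \<bar>K\<bar> * d ^ 2 * t" using t by (intro mult_right_mono mult_left_mono power_mono) auto
      finally show ?thesis .
    qed
    then show "cmod (c0 + c1 * of_real t + c2 * of_real t ^ 2) \<le> (\<bar>K\<bar> * d ^ 2) * t" using assms(2)[OF t] by linarith
  qed
  show c1: "c1 = 0"
  proof (rule lim[OF l])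
    fix t assume t: "0 < t" "t < d"
    have "cmod (c1 * of_real t + c2 * of_real t ^ 2) = cmod (of_real t * (c1 + c2 * of_real t + 0 * of_real t ^ 2))"
      by (simp add: algebra_simps power2_eq_square)
    then have "t * cmod (c1 + c2 * of_real t + 0 * of_real t ^ 2) \<le> K * t ^ 3"
      using assms(2)[OF t] t c0 by (simp add: norm_mult)
    also have "K * t ^ 3 \<le> t * ((\<bar>K\<bar> * d) * t)"
    proof -
      have "K * t ^ 3 \<le> \<bar>K\<bar> * t ^ 3" using t by (intro mult_right_mono) auto
      also have "\<dots> = \<bar>K\<bar> * t * t ^ 2" by (simp add: power2_eq_square power3_eq_cube)
      also have "\<dots> \<le> \<bar>K\<bar> * d * t ^ 2" using t by (intro mult_right_mono mult_left_mono) auto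
      finally show ?thesis by (simp add: power2_eq_square mult_ac)
    qed
    finally show "cmod (c1 + c2 * of_real t + 0 * of_real t ^ 2) \<le> (\<bar>K\<bar> * d) * t"
      using t by (simp only: mult_le_cancel_left_pos)
  qed
  show "c2 = 0"
  proof (rule lim[OF l])
    fix t assume t: "0 < t" "t < d"
    have "t ^ 2 * cmod (c2 + 0 * of_real t + 0 * of_real t ^ 2) \<le> t ^ 2 * (K * t)"
      using assms(2)[OF t] t c0 c1 by (simp add: norm_mult norm_power power2_eq_square power3_eq_cube mult_ac)
    then show "cmod (c2 + 0 * of_real t + 0 * of_real t ^ 2) \<le> K * t"
      using t by (subst (asm) mult_le_cancel_left_pos) auto
  qed
qed

text \<open>The Taylor remainder is itself cubic, so the bound passes from \<phi> to its quadratic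
  Taylor polynomial. Real positive parameters suffice to make the coefficients of that polynomial
  vanish.\<close>

lemma cubic_bound_on_line:
  assumes \<phi>: "\<phi> holomorphic_on ball 0 R" and R: "R > 0" and d: "d > 0"
    and K: "\<And>t. 0 < t \<Longrightarrow> t < d \<Longrightarrow> cmod (\<phi> (of_real t)) \<le> K * t ^ 3"
  shows "\<phi> 0 = 0" "deriv \<phi> 0 = 0" "(deriv ^^ 2) \<phi> 0 = 0"
proof -
  have h: "(deriv ^^ i) \<phi> holomorphic_on ball 0 R" for i
    by (rule holomorphic_higher_deriv[OF \<phi> open_ball])
  have sub: "cball 0 (R/2) \<subseteq> ball (0::complex) R" using R by auto
  have "continuous_on (cball 0 (R/2)) ((deriv ^^ 3) \<phi>)"
    using holomorphic_on_imp_continuous_on[OF h] sub by (rule continuous_on_subset)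
  then have "bounded ((deriv ^^ 3) \<phi> ` cball 0 (R/2))"
    by (intro compact_imp_bounded compact_continuous_image) auto
  then obtain B where B: "\<And>x. x \<in> cball 0 (R/2) \<Longrightarrow> cmod ((deriv ^^ 3) \<phi> x) \<le> B"
    unfolding bounded_iff by blast
  have taylor: "cmod (\<phi> t - (\<phi> 0 + deriv \<phi> 0 * t + (deriv ^^ 2) \<phi> 0 / 2 * t ^ 2)) \<le> B / 2 * cmod t ^ 3"
    if t: "t \<in> cball 0 (R/2)" for t
  proof -
    have "cmod ((\<lambda>i. (deriv ^^ i) \<phi>) 0 t - (\<Sum>i\<le>2. (deriv ^^ i) \<phi> 0 * (t - 0) ^ i / fact i)) \<le> B * cmod (t - 0) ^ Suc 2 / fact 2"
    proof (rule complex_Taylor[where S = "cball 0 (R/2)"])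
      fix i x assume "x \<in> cball (0::complex) (R/2)" and "i \<le> (2::nat)"
      then have x: "x \<in> ball 0 R" using sub by blast
      show "((deriv ^^ i) \<phi> has_field_derivative (deriv ^^ Suc i) \<phi> x) (at x within cball 0 (R/2))"
        using holomorphic_derivI[OF h open_ball x] by simp
    next
      show "cmod ((deriv ^^ Suc 2) \<phi> x) \<le> B" if "x \<in> cball 0 (R/2)" for x
        using B[OF that] by (simp add: numeral_3_eq_3 numeral_2_eq_2)
    qed (use R t in auto)
    then show ?thesis by (simp add: numeral_2_eq_2 numeral_3_eq_3 mult_ac)
  qed
  have tri: "cmod a \<le> cmod x + cmod (x - a)" for a x :: complex
    using norm_triangle_ineq4[of x "x - a"] by simp
  let ?e = "min d (R/2)"
  have "cmod (\<phi> 0 + deriv \<phi> 0 * of_real t + (deriv ^^ 2) \<phi> 0 / 2 * of_real t ^ 2) \<le> (K + B / 2) * t ^ 3"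
    if t: "0 < t" "t < ?e" for t
  proof -
    have "cmod (\<phi> 0 + deriv \<phi> 0 * of_real t + (deriv ^^ 2) \<phi> 0 / 2 * of_real t ^ 2)
        \<le> cmod (\<phi> (of_real t)) + cmod (\<phi> (of_real t) - (\<phi> 0 + deriv \<phi> 0 * of_real t + (deriv ^^ 2) \<phi> 0 / 2 * of_real t ^ 2))"
      by (rule tri)
    also have "\<dots> \<le> K * t ^ 3 + B / 2 * t ^ 3"
      using K[of t] taylor[of "of_real t"] t by (intro add_mono) auto
    finally show ?thesis by (simp add: algebra_simps)
  qed
  moreover have "?e > 0" using d R by simp
  ultimately show "\<phi> 0 = 0" "deriv \<phi> 0 = 0" "(deriv ^^ 2) \<phi> 0 = 0"
    using quadratic_eq_0_of_cubic_bound[of ?e "\<phi> 0" "deriv \<phi> 0" "(deriv ^^ 2) \<phi> 0 / 2" "K + B / 2"] by auto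
qed

text \<open>The bound is known on the totally real subspace only. On lines spanned by its points the
  one-variable case applies, polarisation gives the mixed second derivatives, and
  \<open>emb_complexify\<close> extends the result to all complex directions.\<close>

lemma dird_vanish_of_cubic_bound:
  fixes T :: "(complex^'n::finite) \<times> (complex^'n) \<Rightarrow> complex"
  assumes T: "T holo_on ball 0 r" and r: "r > 0" and d: "d > 0"
    and K: "\<And>y. norm y < d \<Longrightarrow> cmod (T (emb y)) \<le> K * norm y ^ 3"
  shows "T 0 = 0" "dird v T 0 = 0" "dird u (dird v T) 0 = 0"
proof -
  have 0: "0 \<in> ball (0::(complex^'n) \<times> (complex^'n)) r" using r by simp
  note Td = holo_on_dird[OF T open_ball]
  have line: "T 0 = 0 \<and> dird (emb h) T 0 = 0 \<and> dird (emb h) (dird (emb h) T) 0 = 0" for h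
  proof -
    obtain s where s: "s > 0" "\<And>t. cmod t \<le> s \<Longrightarrow> norm (t *\<^sub>C emb h) < r"
      using small_on_line[OF r, of "emb h"] by blast
    have hol: "(\<lambda>t. T (0 + t *\<^sub>C emb h)) holomorphic_on ball 0 s"
      by (rule line_holomorphic_on[OF holo_on_imp_line_holo_on[OF T]]) (use s in auto)
    define e where "e = d / (norm h + 1)"
    have h1: "norm h + 1 > 0" by (simp add: add_nonneg_pos)
    have e: "e > 0" using d h1 by (simp add: e_def)
    have "cmod (T (0 + of_real t *\<^sub>C emb h)) \<le> (K * norm h ^ 3) * t ^ 3" if t: "0 < t" "t < e" for t
    proof -
      have "norm (t *\<^sub>R h) \<le> t * (norm h + 1)" using t by simp
      also have "\<dots> < d" using t h1 by (simp add: e_def pos_less_divide_eq)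
      finally have "cmod (T (emb (t *\<^sub>R h))) \<le> K * norm (t *\<^sub>R h) ^ 3" by (rule K)
      then show ?thesis using t by (simp add: cscale_of_real emb_simps power_mult_distrib mult_ac)
    qed
    from cubic_bound_on_line[OF hol s(1) e this]
    show ?thesis
      using higher_deriv_line(2)[OF T open_ball, of 0 0 "emb h" 1] higher_deriv_line(2)[OF T open_ball, of 0 0 "emb h" 2] r
      by (simp add: numeral_2_eq_2)
  qed
  show "T 0 = 0" using line by blast
  obtain x y where xy: "v = emb x + \<i> *\<^sub>C emb y" by (rule emb_complexify)
  show "dird v T 0 = 0" unfolding xy using line by (simp add: dird_direction[OF T 0])
  define S where "S u v = dird u (dird v T) 0" for u v
  have S1: "S (u + u') v = S u v + S u' v" "S (c *\<^sub>C u) v = c * S u v" for u u' v c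
    unfolding S_def by (rule dird_direction[OF Td 0])+
  have sym: "S u v = S v u" for u v
    unfolding S_def by (rule dird_commute[OF T open_ball 0])
  have S2: "S u (v + v') = S u v + S u v'" "S u (c *\<^sub>C v) = c * S u v" for u v v' c
    using S1 sym by metis+
  have emb0: "S (emb h) (emb k) = 0" for h k
  proof -
    have "S (emb (h + k)) (emb (h + k)) = 0" "S (emb h) (emb h) = 0" "S (emb k) (emb k) = 0"
      using line unfolding S_def by blast+
    then have "S (emb h) (emb k) + S (emb k) (emb h) = 0"
      by (simp add: emb_simps S1(1) S2(1) algebra_simps)
    then show ?thesis using sym[of "emb h" "emb k"] by simp
  qed
  obtain x' y' where xy': "u = emb x' + \<i> *\<^sub>C emb y'" by (rule emb_complexify)
  have "S u v = 0" unfolding xy xy' by (simp add: S1 S2 emb0)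
  then show "dird u (dird v T) 0 = 0" by (simp add: S_def)
qed

text \<open>Q with cnj z replaced by \<zeta>; the conjugate of z^t B z becomes the form of the
  conjugated matrix in \<zeta>.\<close>

definition quad_ext :: "complex^'n^'n \<Rightarrow> complex^'n^'n \<Rightarrow> complex^'n^'n \<Rightarrow> (complex^'n::finite) \<times> (complex^'n) \<Rightarrow> complex" where
  "quad_ext A B C p = (\<Sum>i\<in>UNIV. \<Sum>k\<in>UNIV. A $ i $ k * (snd p $ i * fst p $ k)
     + cnj (B $ i $ k) * (snd p $ i * snd p $ k) + C $ i $ k * (fst p $ i * fst p $ k))"

text \<open>The \<zeta>_j-derivative of \<open>quad_ext\<close> for symmetric B, whence the factor
  2. Up to conjugation and this factor its coefficients form the j-th column of the stacked
  matrix.\<close>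

definition zbar_form :: "complex^'n^'n \<Rightarrow> complex^'n^'n \<Rightarrow> 'n \<Rightarrow> (complex^'n::finite) \<times> (complex^'n) \<Rightarrow> complex" where
  "zbar_form A B j p = (\<Sum>k\<in>UNIV. A $ j $ k * fst p $ k + 2 * cnj (B $ j $ k) * snd p $ k)"

lemma quad_ext_emb: "quad_ext A B C (emb z) = sesq_form A z + cnj (bilin_form B z) + bilin_form C z"
  by (simp add: quad_ext_def sesq_form_def bilin_form_def emb_def matrix_vector_mult_def sum.distrib sum_distrib_left mult_ac)

lemma complex_linear_coords: "complex_linear (\<lambda>p :: (complex^'n::finite) \<times> (complex^'n). fst p $ k)"
  "complex_linear (\<lambda>p :: (complex^'n::finite) \<times> (complex^'n). snd p $ k)"
  by (intro complex_linear_intros)+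

lemma complex_linear_zbar_form: "complex_linear (zbar_form A B j)"
  unfolding zbar_form_def by (intro complex_linear_intros)

lemma holo_on_quad_ext: "quad_ext A B C holo_on S"
  unfolding quad_ext_def
  by (intro holo_on_sum holo_on_add holo_on_cmult holo_on_mult complex_linear_imp_holo_on[OF complex_linear_coords(1)]
      complex_linear_imp_holo_on[OF complex_linear_coords(2)])

lemma dird_quad_ext:
  "dird v (quad_ext A B C) p = (\<Sum>i\<in>UNIV. \<Sum>k\<in>UNIV. A $ i $ k * (snd p $ i * fst v $ k + snd v $ i * fst p $ k)
     + cnj (B $ i $ k) * (snd p $ i * snd v $ k + snd v $ i * snd p $ k) + C $ i $ k * (fst p $ i * fst v $ k + fst v $ i * fst p $ k))"
proof -
  note h = complex_linear_imp_holo_on[OF complex_linear_coords(1), where S = UNIV]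
    complex_linear_imp_holo_on[OF complex_linear_coords(2), where S = UNIV]
  note hm = holo_on_mult[OF h(1) h(1)] holo_on_mult[OF h(2) h(1)] holo_on_mult[OF h(2) h(2)]
  note hc = hm[THEN holo_on_cmult]
  show ?thesis
    unfolding quad_ext_def
    by (simp add: dird_sum_fun[where S = UNIV] dird_add_fun[where S = UNIV] dird_cmult[where S = UNIV]
        dird_mult[where S = UNIV] holo_on_sum holo_on_add h hm hc dird_linear_map[OF complex_linear_coords(1)]
        dird_linear_map[OF complex_linear_coords(2)])
qed

lemma dird_zbar_quad_ext:
  assumes "transpose B = B"
  shows "dird (zbar_dir j) (quad_ext A B C) p = zbar_form A B j p"
proof -
  have B: "B $ i $ k = B $ k $ i" for i k
    using assms by (metis transpose_def vec_lambda_beta)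
  have d: "fst (zbar_dir j) $ k = 0" "snd (zbar_dir j) $ k = (if k = j then 1 else 0)" for k
    by (auto simp: zbar_dir_def axis_def)
  have "dird (zbar_dir j) (quad_ext A B C) p
      = (\<Sum>i\<in>UNIV. \<Sum>k\<in>UNIV. (if i = j then A $ i $ k * fst p $ k + cnj (B $ i $ k) * snd p $ k else 0)
         + (if k = j then cnj (B $ i $ k) * snd p $ i else 0))"
    unfolding dird_quad_ext d by (intro sum.cong refl) (auto simp: algebra_simps)
  also have "\<dots> = (\<Sum>k\<in>UNIV. A $ j $ k * fst p $ k + cnj (B $ j $ k) * snd p $ k) + (\<Sum>i\<in>UNIV. cnj (B $ i $ j) * snd p $ i)"
  proof -
    have "(\<Sum>k\<in>UNIV. if i = j then f i k else 0) = (if i = j then \<Sum>k\<in>UNIV. f i k else 0)" for i and f :: "'a \<Rightarrow> 'a \<Rightarrow> complex"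
      by simp
    then have 1: "(\<Sum>i\<in>UNIV. \<Sum>k\<in>UNIV. if i = j then f i k else 0) = (\<Sum>k\<in>UNIV. f j k)" for f :: "'a \<Rightarrow> 'a \<Rightarrow> complex"
      by simp
    have 2: "(\<Sum>i\<in>UNIV. \<Sum>k\<in>UNIV. if k = j then f i k else 0) = (\<Sum>i\<in>UNIV. f i j)" for f :: "'a \<Rightarrow> 'a \<Rightarrow> complex"
      by simp
    show ?thesis by (simp only: sum.distrib 1 2)
  qed
  also have "\<dots> = zbar_form A B j p"
    using B[of _ j] by (simp add: zbar_form_def sum.distrib algebra_simps flip: sum_distrib_left)
  finally show ?thesis .
qed

text \<open>If all 2 by 2 minors vanish, every row is a multiple of one row that has a nonzero
  entry, and the row space has dimension at most 1.\<close>

lemma rank_ge_2_minor: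
  fixes M :: "'a::field^'n::finite^'m::finite"
  assumes "rank M \<ge> 2"
  obtains j k r s where "M $ r $ j * M $ s $ k \<noteq> M $ s $ j * M $ r $ k"
proof (rule ccontr)
  assume "\<not> thesis"
  then have minors: "M $ r $ j * M $ s $ k = M $ s $ j * M $ r $ k" for r s j k using that by blast
  have "\<exists>W. finite W \<and> card W \<le> 1 \<and> rows M \<subseteq> vec.span W"
  proof (cases "\<exists>r j. M $ r $ j \<noteq> 0")
    case True
    then obtain r j where rj: "M $ r $ j \<noteq> 0" by blast
    have "M $ s = (M $ s $ j / M $ r $ j) *s M $ r" for s
      using minors[of r j s] rj by (simp add: vec_eq_iff field_simps)
    moreover have "(M $ s $ j / M $ r $ j) *s M $ r \<in> vec.span {M $ r}" for s
      by (intro vec.span_scale vec.span_base) auto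
    ultimately have "M $ s \<in> vec.span {M $ r}" for s by metis
    then have "rows M \<subseteq> vec.span {M $ r}" by (auto simp: rows_def row_def vec_nth_inverse)
    then show ?thesis by (intro exI[of _ "{M $ r}"]) auto
  next
    case False
    then have "rows M \<subseteq> vec.span {}" by (auto simp: rows_def row_def vec_eq_iff)
    then show ?thesis by (intro exI[of _ "{}"]) auto
  qed
  then obtain W where "finite W" "card W \<le> 1" "rows M \<subseteq> vec.span W" by blast
  then have "vec.dim (rows M) \<le> 1"
    using vec.dim_le_card[of "rows M" W] by linarith
  then show False using assms by (simp add: row_rank_def_gen)
qed

lemma zbar_form_dirs: "zbar_form A B j (z_dir k) = A $ j $ k" "zbar_form A B j (zbar_dir k) = 2 * cnj (B $ j $ k)"
  using sum_axis_mult(1)[of "\<lambda>l. A $ j $ l" k 1] sum_axis_mult(1)[of "\<lambda>l. 2 * cnj (B $ j $ l)" k 1]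
  by (simp_all add: zbar_form_def z_dir_def zbar_dir_def)

text \<open>A nonzero minor of the stacked matrix selects two forms and two coordinate directions.
  Inverting the 2 by 2 matrix of their values by Cramer's rule gives the dual vectors
  \<open>a\<close> and \<open>b\<close> that \<open>transversal_exists\<close> asks for.\<close>

lemma zbar_forms_independent:
  assumes B: "transpose B = B" and rank: "rank (stack (conj_transpose A) B) \<ge> 2"
  obtains i j a b where "zbar_form A B i a = 1" "zbar_form A B j a = 0" "zbar_form A B i b = 0" "zbar_form A B j b = 1"
proof -
  let ?M = "stack (conj_transpose A) B"
  obtain i j r s where m: "?M $ r $ i * ?M $ s $ j \<noteq> ?M $ s $ i * ?M $ r $ j"
    using rank_ge_2_minor[OF rank] by blast
  define dir where "dir r = (case r of Inl k \<Rightarrow> z_dir k | Inr k \<Rightarrow> zbar_dir k)" for r :: "'a + 'a"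
  \<comment> \<open>The factors between the values of the forms and the conjugated matrix entries;
    they are nonzero, so the minor stays nonzero.\<close>
  define w where "w r = (case r of Inl _ \<Rightarrow> (1::complex) | Inr _ \<Rightarrow> 2)" for r :: "'a + 'a"
  have w: "w r \<noteq> 0" for r by (simp add: w_def split: sum.split)
  have Bs: "B $ i $ k = B $ k $ i" for i k
    using B by (metis transpose_def vec_lambda_beta)
  have l: "zbar_form A B i (dir r) = w r * cnj (?M $ r $ i)" for i r
    by (cases r) (auto simp: dir_def w_def zbar_form_dirs stack_def conj_transpose_def Bs[of i])
  define \<Delta> where "\<Delta> = zbar_form A B i (dir r) * zbar_form A B j (dir s) - zbar_form A B i (dir s) * zbar_form A B j (dir r)"
  have "\<Delta> = w r * w s * cnj (?M $ r $ i * ?M $ s $ j - ?M $ s $ i * ?M $ r $ j)"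
    by (simp add: \<Delta>_def l algebra_simps)
  then have \<Delta>: "\<Delta> \<noteq> 0" using w m by (simp del: complex_cnj_diff complex_cnj_mult)
  note cl = complex_linear_zbar_form[of A B]
  have lin: "zbar_form A B k (c *\<^sub>C u - d *\<^sub>C v) = c * zbar_form A B k u - d * zbar_form A B k v" for k c d u v
    using complex_linearD(2)[OF cl] linear_diff[OF bounded_linear.linear[OF complex_linearD(1)[OF cl]]]
    by (simp add: cscale_complex_def)
  show ?thesis
  proof (rule that[of i "(zbar_form A B j (dir s) / \<Delta>) *\<^sub>C dir r - (zbar_form A B j (dir r) / \<Delta>) *\<^sub>C dir s" j
        "(zbar_form A B i (dir r) / \<Delta>) *\<^sub>C dir s - (zbar_form A B i (dir s) / \<Delta>) *\<^sub>C dir r"])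
  qed (use \<Delta> in \<open>simp_all add: lin field_simps, simp_all add: \<Delta>_def algebra_simps\<close>)
qed

lemma second_derivatives_of_ext:
  fixes u :: "complex^'n::finite \<Rightarrow> complex"
  assumes G: "G holo_on ball 0 r" and r: "r > 0" and u: "\<And>y. emb y \<in> ball 0 r \<Longrightarrow> u y = G (emb y)"
  shows "dz j (dz k u) 0 = dird (z_dir j) (dird (z_dir k) G) 0"
    "dz j (dzbar k u) 0 = dird (z_dir j) (dird (zbar_dir k) G) 0"
    "dzbar j (dzbar k u) 0 = dird (zbar_dir j) (dird (zbar_dir k) G) 0"
proof -
  have 1: "dz k u y = dird (z_dir k) G (emb y)" "dzbar k u y = dird (zbar_dir k) G (emb y)" if "emb y \<in> ball 0 r" for y k
    by (rule wirtinger_of_ext(1,2)[OF G that ext_has_derivative[OF G u[symmetric] that]]; assumption)+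
  have 0: "emb (0::complex^'n) \<in> ball 0 r" using r by (simp add: emb_simps)
  note Gd = holo_on_dird[OF G open_ball]
  have w: "dz j f 0 = dird (z_dir j) (dird v G) 0" "dzbar j f 0 = dird (zbar_dir j) (dird v G) 0"
    if "\<And>y. emb y \<in> ball 0 r \<Longrightarrow> dird v G (emb y) = f y" for f v
    using wirtinger_of_ext(1,2)[OF Gd 0 ext_has_derivative[OF Gd that 0]] by (simp_all add: emb_simps)
  show "dz j (dz k u) 0 = dird (z_dir j) (dird (z_dir k) G) 0"
    "dz j (dzbar k u) 0 = dird (z_dir j) (dird (zbar_dir k) G) 0"
    "dzbar j (dzbar k u) 0 = dird (zbar_dir j) (dird (zbar_dir k) G) 0"
    using w(1)[of "z_dir k" "dz k u"] w(1)[of "zbar_dir k" "dzbar k u"] w(2)[of "zbar_dir k" "dzbar k u"] 1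
    by simp_all
qed

section \<open>Flattening\<close>

lemma graph_compose:
  fixes F :: "'n::finite cspace \<Rightarrow> complex" and R :: "(complex^'n) \<times> (complex^'n) \<Rightarrow> complex"
  assumes F: "F holo_on V" and R: "R holo_on S" and V: "\<And>p. p \<in> S \<Longrightarrow> (fst p, R p) \<in> V"
  shows "(\<lambda>p. F (fst p, R p)) holo_on S"
    and "p \<in> S \<Longrightarrow> dird v (\<lambda>p. F (fst p, R p)) p = dird (fst v, dird v R p) F (fst p, R p)"
proof -
  show "(\<lambda>p. F (fst p, R p)) holo_on S"
    by (rule holo_on_compose[OF F holo_on_Pair[OF complex_linear_imp_holo_on[OF complex_linear_fst] R] V])
  assume p: "p \<in> S"
  have d: "((\<lambda>p. (fst p, R p)) has_derivative (\<lambda>v. (fst v, dird v R p))) (at p)"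
    by (intro has_derivative_Pair holo_on_has_derivative(1)[OF R p] bounded_linear_imp_has_derivative bounded_linear_fst)
  have cl: "complex_linear (\<lambda>v. (fst v, dird v R p))"
    by (intro complex_linear_Pair complex_linear_fst holo_on_has_derivative(2)[OF R p])
  show "dird v (\<lambda>p. F (fst p, R p)) p = dird (fst v, dird v R p) F (fst p, R p)"
    by (rule dird_compose[where f = F and g = "\<lambda>p. (fst p, R p)", OF F d cl V[OF p]])
qed

text \<open>The \<zeta>-directions fix z, so the first derivative of the composite is F_w times that
  of R. After a second differentiation the term with the derivative of F_w carries the factor dR(0)
  = 0.\<close>

lemma graph_compose_derivatives_at_0:
  fixes F :: "'n::finite cspace \<Rightarrow> complex" and R :: "(complex^'n) \<times> (complex^'n) \<Rightarrow> complex"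
  assumes F: "F holo_on V" "open V" and R: "R holo_on ball 0 s" and s: "s > 0"
    and V: "\<And>p. p \<in> ball 0 s \<Longrightarrow> (fst p, R p) \<in> V"
    and R0: "R 0 = 0" "\<And>v. dird v R 0 = 0"
  shows "dird v (\<lambda>p. F (fst p, R p)) 0 = dird (fst v, 0) F 0"
    and "dird u (dird (zbar_dir k) (\<lambda>p. F (fst p, R p))) 0 = dird (0, 1) F 0 * dird u (dird (zbar_dir k) R) 0"
proof -
  have 0: "0 \<in> ball (0::(complex^'n) \<times> (complex^'n)) s" using s by simp
  have z: "(fst (0::(complex^'n) \<times> (complex^'n)), R 0) = 0"
    unfolding R0(1) fst_zero by (simp add: zero_prod_def)
  have "dird v (\<lambda>p. F (fst p, R p)) 0 = dird (fst v, dird v R 0) F (fst (0::(complex^'n) \<times> (complex^'n)), R 0)"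
    by (rule graph_compose(2)[OF F(1) R V 0])
  then show "dird v (\<lambda>p. F (fst p, R p)) 0 = dird (fst v, 0) F 0"
    unfolding z R0(2) .
  let ?Fw = "\<lambda>p. dird (0, 1) F (fst p, R p)"
  have Fw: "?Fw holo_on ball 0 s"
    by (rule graph_compose(1)[OF holo_on_dird[OF F] R V])
  have "dird (zbar_dir k) (\<lambda>p. F (fst p, R p)) p = ?Fw p * dird (zbar_dir k) R p" if p: "p \<in> ball 0 s" for p
  proof -
    have "(fst (zbar_dir k), dird (zbar_dir k) R p) = dird (zbar_dir k) R p *\<^sub>C (0, 1)"
      by (simp add: zbar_dir_def cscale_prod_def cscale_complex_def)
    moreover have "dird (zbar_dir k) (\<lambda>p. F (fst p, R p)) p = dird (fst (zbar_dir k), dird (zbar_dir k) R p) F (fst p, R p)"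
      by (rule graph_compose(2)[OF F(1) R V p])
    ultimately show ?thesis
      by (simp add: dird_direction(2)[OF F(1) V[OF p]])
  qed
  then have "dird u (dird (zbar_dir k) (\<lambda>p. F (fst p, R p))) 0 = dird u (\<lambda>p. ?Fw p * dird (zbar_dir k) R p) 0"
    by (rule dird_cong[OF open_ball 0])
  also have "\<dots> = ?Fw 0 * dird u (dird (zbar_dir k) R) 0 + dird u ?Fw 0 * dird (zbar_dir k) R 0"
    by (rule dird_mult[OF Fw holo_on_dird[OF R open_ball] 0])
  finally show "dird u (dird (zbar_dir k) (\<lambda>p. F (fst p, R p))) 0 = dird (0, 1) F 0 * dird u (dird (zbar_dir k) R) 0"
    unfolding z unfolding R0(2) by simp
qed

text \<open>On the totally real subspace R - \<open>quad_ext\<close> equals E, which is of third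
  order, so all its derivatives of order at most two vanish at 0 in the doubled space.\<close>

lemma graph_ext_derivatives_at_0:
  fixes \<rho> E :: "complex^'n::finite \<Rightarrow> complex"
  assumes \<Omega>: "open \<Omega>" "0 \<in> \<Omega>"
    and \<rho>: "\<And>z. z \<in> \<Omega> \<Longrightarrow> \<rho> z = sesq_form A z + cnj (bilin_form B z) + bilin_form C z + E z"
    and B: "transpose B = B" and E: "E \<in> O[nhds 0](\<lambda>z. complex_of_real (norm z ^ 3))"
    and R: "R holo_on ball 0 r" and r: "r > 0" and ext: "\<And>y. emb y \<in> ball 0 r \<Longrightarrow> R (emb y) = \<rho> y"
  shows "R 0 = 0" "dird v R 0 = 0" "dird u (dird (zbar_dir j) R) 0 = zbar_form A B j u"
proof -
  let ?T = "\<lambda>p. R p - quad_ext A B C p"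
  have T: "?T holo_on ball 0 r" by (intro holo_on_diff R holo_on_quad_ext)
  obtain K where "\<forall>\<^sub>F z in nhds 0. norm (E z) \<le> K * norm (complex_of_real (norm z ^ 3))"
    using E by (elim landau_o.bigE)
  then obtain d1 where d1: "d1 > 0" "\<And>z. norm z < d1 \<Longrightarrow> norm (E z) \<le> K * norm (complex_of_real (norm z ^ 3))"
    by (auto simp: eventually_nhds_metric)
  obtain d2 where d2: "d2 > 0" "ball 0 d2 \<subseteq> \<Omega>" using openE[OF \<Omega>] by blast
  define d where "d = min (min d1 d2) (r / 2)"
  have d: "d > 0" using d1 d2 r by (simp add: d_def)
  have K: "cmod (?T (emb y)) \<le> K * norm y ^ 3" if y: "norm y < d" for y
  proof -
    have "emb y \<in> ball 0 r" using norm_emb_le[of y] y by (simp add: d_def)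
    moreover have "y \<in> \<Omega>" using y d2 by (auto simp: d_def)
    ultimately have "?T (emb y) = E y" by (simp add: ext \<rho> quad_ext_emb)
    then show ?thesis using d1(2)[of y] y by (simp add: d_def norm_power)
  qed
  note v = dird_vanish_of_cubic_bound[OF T r d K]
  have 0: "0 \<in> ball (0::(complex^'n) \<times> (complex^'n)) r" using r by simp
  show "R 0 = 0" using v(1) by (simp add: quad_ext_def)
  show "dird v R 0 = 0" for v
    using v(2)[of v] by (simp add: dird_diff_fun[OF R holo_on_quad_ext 0] dird_quad_ext)
  have "dird u (dird (zbar_dir j) ?T) 0 = dird u (\<lambda>p. dird (zbar_dir j) R p - zbar_form A B j p) 0"
    by (rule dird_cong[OF open_ball 0]) (simp add: dird_diff_fun[OF R holo_on_quad_ext] dird_zbar_quad_ext[OF B])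
  also have "\<dots> = dird u (dird (zbar_dir j) R) 0 - zbar_form A B j u"
    by (simp add: dird_diff_fun[OF holo_on_dird[OF R open_ball] complex_linear_imp_holo_on[OF complex_linear_zbar_form] 0]
        dird_linear_map[OF complex_linear_zbar_form])
  finally show "dird u (dird (zbar_dir j) R) 0 = zbar_form A B j u" using v(3) by simp
qed

text \<open>Second derivatives with at least one conjugate variable are F_w(0) times coefficients of
  the forms \<open>zbar_form\<close>, and those in z alone are conjugate to the ones in cnj z
  because u is real. By the rank condition not all coefficients are zero.\<close>

lemma second_derivatives_vanish_iff:
  fixes F :: "'n::finite cspace \<Rightarrow> complex" and R :: "(complex^'n) \<times> (complex^'n) \<Rightarrow> complex"
  assumes F: "F holo_on V" "open V" and R: "R holo_on ball 0 s" and s: "s > 0"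
    and V: "\<And>p. p \<in> ball 0 s \<Longrightarrow> (fst p, R p) \<in> V"
    and R0: "R 0 = 0" "\<And>v. dird v R 0 = 0"
    and R2: "\<And>j u. dird u (dird (zbar_dir j) R) 0 = zbar_form A B j u"
    and B: "transpose B = B" and rank: "rank (stack (conj_transpose A) B) \<ge> 2"
    and re: "\<And>y. emb y \<in> ball 0 s \<Longrightarrow> F (y, R (emb y)) \<in> \<real>"
    and u: "\<And>y. emb y \<in> ball 0 s \<Longrightarrow> u y = F (y, R (emb y))"
  shows "second_derivatives_vanish u 0 \<longleftrightarrow> dird (0, 1) F 0 = 0"
proof -
  let ?G = "\<lambda>p. F (fst p, R p)"
  have G: "?G holo_on ball 0 s" by (rule graph_compose(1)[OF F(1) R V])
  have Gu: "u y = ?G (emb y)" if "emb y \<in> ball 0 s" for y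
    using u[OF that] by (simp add: emb_def)
  have re': "?G (emb y) \<in> \<real>" if "emb y \<in> ball 0 s" for y
    using re[OF that] by (simp add: emb_def)
  have "dird v (dird (zbar_dir k) ?G) 0 = dird (0, 1) F 0 * dird v (dird (zbar_dir k) R) 0" for v k
    by (rule graph_compose_derivatives_at_0(2)[OF F R s V R0])
  then have D: "dird v (dird (zbar_dir k) ?G) 0 = dird (0, 1) F 0 * zbar_form A B k v" for v k
    unfolding R2 .
  have S: "dz j (dz k u) 0 = dird (z_dir j) (dird (z_dir k) ?G) 0"
    "dz j (dzbar k u) 0 = dird (z_dir j) (dird (zbar_dir k) ?G) 0"
    "dzbar j (dzbar k u) 0 = dird (zbar_dir j) (dird (zbar_dir k) ?G) 0" for j k
    by (rule second_derivatives_of_ext[OF G s Gu]; assumption)+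
  have zz: "dird (z_dir j) (dird (z_dir k) ?G) 0 = cnj (dird (zbar_dir j) (dird (zbar_dir k) ?G) 0)" for j k
    by (rule real_ext_symmetric(2)[OF G s re'])
  show ?thesis
  proof
    assume "dird (0, 1) F 0 = 0"
    then show "second_derivatives_vanish u 0"
      unfolding second_derivatives_vanish_def S zz D by simp
  next
    assume v: "second_derivatives_vanish u 0"
    show "dird (0, 1) F 0 = 0"
    proof (rule ccontr)
      assume "dird (0, 1) F 0 \<noteq> 0"
      then have "zbar_form A B k (z_dir j) = 0" "zbar_form A B k (zbar_dir j) = 0" for j k
        using v unfolding second_derivatives_vanish_def S D by (auto simp: mult_eq_0_iff)
      then have "A $ k $ j = 0" "B $ k $ j = 0" for j k
        by (simp_all add: zbar_form_dirs)
      moreover obtain i a where "zbar_form A B i a = 1"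
        using zbar_forms_independent[OF B rank] by blast
      ultimately show False by (simp add: zbar_form_def)
    qed
  qed
qed

lemma direction_expansion: "((v, c) :: 'n::finite cspace) = (\<Sum>k\<in>UNIV. v $ k *\<^sub>C (axis k 1, 0)) + c *\<^sub>C (0, 1)"
proof -
  have "(\<Sum>k\<in>UNIV. v $ k *\<^sub>C (axis k 1, 0::complex)) = (\<Sum>k\<in>UNIV. (v $ k *\<^sub>C axis k 1, 0))"
    by (simp add: cscale_prod_def)
  also have "\<dots> = (v, 0)"
    by (simp add: prod_eq_iff fst_sum snd_sum flip: vec_expansion)
  finally show ?thesis by (simp add: cscale_prod_def cscale_complex_def)
qed

context
  fixes \<Omega> :: "(complex^'n::finite) set" and \<rho> E :: "complex^'n \<Rightarrow> complex" and A B C :: "complex^'n^'n"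
  assumes \<Omega>: "open \<Omega>" "0 \<in> \<Omega>" and ra: "real_analytic_on \<rho> \<Omega>"
    and \<rho>: "\<And>z. z \<in> \<Omega> \<Longrightarrow> \<rho> z = sesq_form A z + cnj (bilin_form B z) + bilin_form C z + E z"
    and B: "transpose B = B" and E: "E \<in> O[nhds 0](\<lambda>z. complex_of_real (norm z ^ 3))"
    and rank: "rank (stack (conj_transpose A) B) \<ge> 2"
begin

lemma rho_ext_at_0:
  obtains r R where "r > 0" "R holo_on ball 0 r" "\<forall>y. emb y \<in> ball 0 r \<longrightarrow> R (emb y) = \<rho> y"
    "R 0 = 0" "\<forall>v. dird v R 0 = 0" "\<forall>j u. dird u (dird (zbar_dir j) R) 0 = zbar_form A B j u"
proof -
  obtain r R where r: "r > 0" and R: "R holo_on ball 0 r" and ext: "\<And>h. emb h \<in> ball 0 r \<Longrightarrow> R (emb h) = \<rho> (0 + h)"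
    using real_analytic_on_imp_holo_ext[OF ra \<Omega>(2)] by blast
  have ext': "R (emb y) = \<rho> y" if "emb y \<in> ball 0 r" for y using ext[OF that] by simp
  show ?thesis
    using that[OF r R] graph_ext_derivatives_at_0[OF \<Omega> \<rho> B E R r ext'] ext' by blast
qed

lemma flattenable_imp_first_integral:
  assumes "flattenable (graph_over \<rho> \<Omega>)"
  shows "\<exists>\<Omega>' g. open \<Omega>' \<and> 0 \<in> \<Omega>' \<and> \<Omega>' \<subseteq> \<Omega> \<and> real_analytic_on (\<lambda>z. g (z, \<rho> z)) \<Omega>' \<and>
       \<not> g constant_on (graph_over \<rho> \<Omega>') \<and> first_integral (graph_over \<rho> \<Omega>') g \<and>
       \<not> second_derivatives_vanish (\<lambda>z. complex_of_real (g (z, \<rho> z))) 0"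
proof -
  obtain U and F :: "'n cspace \<Rightarrow> complex" where U: "open U" "0 \<in> U" and F: "F holo_on U"
    and dF: "\<forall>p\<in>U. frechet_derivative F (at p) \<noteq> (\<lambda>v. 0)" and re: "\<forall>p\<in>graph_over \<rho> \<Omega> \<inter> U. F p \<in> \<real>"
    using assms unfolding flattenable_def holomorphic_sev_iff_holo_on by blast
  obtain r R where r: "r > 0" and R: "R holo_on ball 0 r" and ext: "\<forall>y. emb y \<in> ball 0 r \<longrightarrow> R (emb y) = \<rho> y"
    and R0: "R 0 = 0" "\<forall>v. dird v R 0 = 0" and R2: "\<forall>j u. dird u (dird (zbar_dir j) R) 0 = zbar_form A B j u"
    by (rule rho_ext_at_0)
  have cont: "continuous_on \<Omega> \<rho>"
    using graph_differentiable[OF \<Omega>(1) ra] \<Omega>(1)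
    by (intro differentiable_imp_continuous_on) (simp add: differentiable_on_eq_differentiable_at)
  define \<Omega>' where "\<Omega>' = {z \<in> \<Omega>. (z, \<rho> z) \<in> U}"
  have "\<Omega>' = \<Omega> \<inter> (\<lambda>z. (z, \<rho> z)) -` U" by (auto simp: \<Omega>'_def)
  then have o: "open \<Omega>'"
    using continuous_open_preimage[OF continuous_on_Pair[OF continuous_on_id cont] \<Omega>(1) U(1)] by simp
  have \<rho>0: "\<rho> 0 = 0" using ext R0(1) r by (metis centre_in_ball emb_simps(3))
  have 0: "0 \<in> \<Omega>'" using \<Omega> U \<rho>0 by (simp add: \<Omega>'_def zero_prod_def)
  have sub: "\<Omega>' \<subseteq> \<Omega>" by (auto simp: \<Omega>'_def)
  have gU: "graph_over \<rho> \<Omega>' \<subseteq> U" by (auto simp: graph_over_def \<Omega>'_def)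
  have re': "F p \<in> \<real>" if "p \<in> graph_over \<rho> \<Omega>'" for p
    using re that gU sub by (auto simp: graph_over_def)
  define g where "g p = Re (F p)" for p
  have gF: "complex_of_real (g (z, \<rho> z)) = F (z, \<rho> z)" if "z \<in> \<Omega>'" for z
    using re'[of "(z, \<rho> z)"] that by (auto simp: g_def graph_over_def)
  obtain s where s: "s > 0" "s \<le> r" "\<forall>p\<in>ball 0 s. (fst p, R p) \<in> U" "\<forall>y. emb y \<in> ball 0 s \<longrightarrow> y \<in> \<Omega>'"
  proof -
    have "open (ball 0 r \<inter> (\<lambda>p. (fst p, R p)) -` U)"
      by (rule continuous_open_preimage[OF _ open_ball U(1)])
        (intro continuous_on_Pair continuous_on_fst continuous_on_id holo_on_imp_continuous_on[OF R])
    moreover have "0 \<in> ball 0 r \<inter> (\<lambda>p. (fst p, R p)) -` U" using r U R0 by (simp add: zero_prod_def)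
    ultimately obtain s1 where s1: "s1 > 0" "ball 0 s1 \<subseteq> ball 0 r \<inter> (\<lambda>p. (fst p, R p)) -` U" using openE by blast
    obtain s2 where s2: "s2 > 0" "ball 0 s2 \<subseteq> \<Omega>'" using openE[OF o 0] by blast
    have "y \<in> \<Omega>'" if "emb y \<in> ball 0 (min (min s1 s2) r)" for y
      using that norm_le_norm_emb[of y] s2(2) by (auto simp: subset_iff)
    moreover have "(fst p, R p) \<in> U" if "p \<in> ball 0 (min (min s1 s2) r)" for p
      using that s1(2) by auto
    ultimately show ?thesis using that[of "min (min s1 s2) r"] s1(1) s2(1) r by auto
  qed
  have Rs: "R holo_on ball 0 s" using R s(2) by (auto intro: holo_on_subset)
  have ext_s: "R (emb y) = \<rho> y" if "emb y \<in> ball 0 s" for y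
    using ext that s(2) by auto
  let ?u = "\<lambda>z. complex_of_real (g (z, \<rho> z))"
  let ?G = "\<lambda>p. F (fst p, R p)"
  have V: "(fst p, R p) \<in> U" if "p \<in> ball 0 s" for p using s(3) that by blast
  have G: "?G holo_on ball 0 s" by (rule graph_compose(1)[OF F Rs V])
  have reR: "F (y, R (emb y)) \<in> \<real>" if y: "emb y \<in> ball 0 s" for y
    using re'[of "(y, \<rho> y)"] s(4) y ext_s[OF y] by (auto simp: graph_over_def)
  have uR: "?u y = F (y, R (emb y))" if y: "emb y \<in> ball 0 s" for y
    using gF[of y] s(4) y ext_s[OF y] by simp
  have R0': "dird v R 0 = 0" for v using R0 by blast
  have nv: "\<not> second_derivatives_vanish ?u 0"
  proof
    assume "second_derivatives_vanish ?u 0"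
    moreover have "second_derivatives_vanish ?u 0 \<longleftrightarrow> dird (0, 1) F 0 = 0"
      by (rule second_derivatives_vanish_iff[OF F U(1) Rs s(1) V R0(1) R0' R2[rule_format] B rank reR uR])
    ultimately have Fw: "dird (0, 1) F 0 = 0" by blast
    have D1: "dird v ?G 0 = dird (fst v, 0) F 0" for v
      by (rule graph_compose_derivatives_at_0(1)[OF F U(1) Rs s(1) V R0(1) R0'])
    \<comment> \<open>Because dR(0) = 0, the composite has derivative zero in the \<zeta>-directions
      and F_z in the z-directions. Reality makes the two conjugate, so F_z vanishes too; with F_w =
      0 this would give dF(0) = 0.\<close>
    have z: "dird (axis k 1, 0) F 0 = 0" for k
    proof -
      have "dird (zbar_dir k) ?G 0 = 0"
        unfolding D1 by (simp add: zbar_dir_def flip: zero_prod_def)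
      moreover have "dird (z_dir k) ?G 0 = cnj (dird (zbar_dir k) ?G 0)"
        by (rule real_ext_symmetric(1)[OF G s(1)]) (use reR in \<open>simp add: emb_def\<close>)
      ultimately have "dird (z_dir k) ?G 0 = 0" by simp
      then show ?thesis unfolding D1 by (simp add: z_dir_def)
    qed
    have "dird (v, c) F 0 = 0" for v c
      unfolding direction_expansion[of v c]
      by (simp add: dird_direction[OF F U(2)] dird_sum_direction[OF F U(2)] z Fw)
    then have "dird v F 0 = 0" for v by (cases v) simp
    then have "frechet_derivative F (at 0) = (\<lambda>v. 0)"
      unfolding frechet_derivative_at[OF holo_on_has_derivative(1)[OF F U(2)], symmetric] by simp
    then show False using dF U(2) by blast
  qed
  \<comment> \<open>Nonconstancy follows from the second-order jet: a constant has vanishing second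
    derivatives.\<close>
  have "\<not> g constant_on (graph_over \<rho> \<Omega>')"
  proof
    assume "g constant_on (graph_over \<rho> \<Omega>')"
    then obtain c where c: "\<And>p. p \<in> graph_over \<rho> \<Omega>' \<Longrightarrow> g p = c" by (auto simp: constant_on_def)
    have cu: "?u y = (\<lambda>p. complex_of_real c) (emb y)" if "emb y \<in> ball 0 s" for y
      using c[of "(y, \<rho> y)"] s(4) that by (auto simp: graph_over_def)
    have zero: "dird v (\<lambda>p. complex_of_real c) = (\<lambda>p. 0)" for v :: "(complex^'n) \<times> (complex^'n)"
      by (rule HOL.ext) simp
    have "dz j (dz k ?u) 0 = dird (z_dir j) (dird (z_dir k) (\<lambda>p. complex_of_real c)) 0"
      "dz j (dzbar k ?u) 0 = dird (z_dir j) (dird (zbar_dir k) (\<lambda>p. complex_of_real c)) 0"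
      "dzbar j (dzbar k ?u) 0 = dird (zbar_dir j) (dird (zbar_dir k) (\<lambda>p. complex_of_real c)) 0" for j k
      by (rule second_derivatives_of_ext[OF holo_on_const s(1) cu]; assumption)+
    then have "second_derivatives_vanish ?u 0"
      unfolding second_derivatives_vanish_def zero by simp
    then show False using nv by blast
  qed
  moreover have "first_integral (graph_over \<rho> \<Omega>') g"
    unfolding g_def by (rule real_holo_imp_first_integral[OF F gU re'])
  moreover have "real_analytic_on (\<lambda>z. F (z, \<rho> z)) \<Omega>'"
    unfolding real_analytic_on_def
  proof
    fix x assume x: "x \<in> \<Omega>'"
    obtain r' R' where r': "r' > 0" and R': "R' holo_on ball 0 r'" and ext': "\<And>h. emb h \<in> ball 0 r' \<Longrightarrow> R' (emb h) = \<rho> (x + h)"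
      using real_analytic_on_imp_holo_ext[OF ra, of x] x sub by blast
    \<comment> \<open>The holomorphic extension of the parametrisation of M about x; composed with F
      it extends F on M, and the power series follows from
      \<open>holo_ext_imp_power_series\<close>.\<close>
    let ?l = "\<lambda>p. (x + fst p, R' p)"
    have hl: "?l holo_on ball 0 r'"
      by (intro holo_on_Pair holo_on_add holo_on_const complex_linear_imp_holo_on[OF complex_linear_fst] R')
    have "R' 0 = \<rho> x" using ext'[of 0] r' by (simp add: emb_simps)
    then have "0 \<in> ball 0 r' \<inter> ?l -` U" using r' x by (simp add: \<Omega>'_def)
    moreover have "open (ball 0 r' \<inter> ?l -` U)"
      by (rule continuous_open_preimage[OF holo_on_imp_continuous_on[OF hl] open_ball U(1)])
    ultimately obtain t where t: "t > 0" "ball 0 t \<subseteq> ball 0 r' \<inter> ?l -` U" using openE by blast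
    show "\<exists>r>0. \<exists>c. \<forall>h. norm h < r \<longrightarrow>
        ((\<lambda>\<alpha>. (\<Prod>b\<in>Basis. (h \<bullet> b) ^ \<alpha> b) *\<^sub>R c \<alpha>) has_sum F (x + h, \<rho> (x + h))) (Basis \<rightarrow>\<^sub>E UNIV)"
    proof (rule holo_ext_imp_power_series[OF t(1), where f = "\<lambda>z. F (z, \<rho> z)"])
      show "(\<lambda>p. F (?l p)) holo_on ball 0 t"
        by (rule holo_on_compose[OF F holo_on_subset[OF hl]]) (use t(2) in auto)
      fix h :: "complex^'n" assume "emb h \<in> ball 0 t"
      then have "emb h \<in> ball 0 r'" using t(2) by blast
      then show "F (x + fst (emb h), R' (emb h)) = F (x + h, \<rho> (x + h))"
        using ext' by (simp add: emb_def)
    qed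
  qed
  then have "real_analytic_on (\<lambda>z. g (z, \<rho> z)) \<Omega>'"
    unfolding g_def by (rule real_analytic_on_bounded_linear[OF _ bounded_linear_Re])
  ultimately show ?thesis using o 0 sub nv by blast
qed

lemma first_integral_imp_flattenable:
  assumes \<Omega>': "open \<Omega>'" "0 \<in> \<Omega>'" "\<Omega>' \<subseteq> \<Omega>" and g: "real_analytic_on (\<lambda>z. g (z, \<rho> z)) \<Omega>'"
    and fi: "first_integral (graph_over \<rho> \<Omega>') g"
    and nv: "\<not> second_derivatives_vanish (\<lambda>z. complex_of_real (g (z, \<rho> z))) 0"
  shows "flattenable (graph_over \<rho> \<Omega>)"
proof -
  let ?u = "\<lambda>z. complex_of_real (g (z, \<rho> z))"
  have ra': "real_analytic_on \<rho> \<Omega>'" using ra \<Omega>'(3) by (auto simp: real_analytic_on_def)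
  have u: "real_analytic_on ?u \<Omega>'" by (rule real_analytic_on_bounded_linear[OF g bounded_linear_of_real])
  obtain r1 R where r1: "r1 > 0" and R: "R holo_on ball 0 r1" and ext: "\<forall>y. emb y \<in> ball 0 r1 \<longrightarrow> R (emb y) = \<rho> y"
    and R0: "R 0 = 0" "\<forall>v. dird v R 0 = 0" and R2: "\<forall>j u. dird u (dird (zbar_dir j) R) 0 = zbar_form A B j u"
    by (rule rho_ext_at_0)
  obtain r2 G where r2: "r2 > 0" and G: "G holo_on ball 0 r2" and Gext: "\<And>h. emb h \<in> ball 0 r2 \<Longrightarrow> G (emb h) = ?u (0 + h)"
    using real_analytic_on_imp_holo_ext[OF u \<Omega>'(2)] by blast
  obtain r3 where r3: "r3 > 0" "ball 0 r3 \<subseteq> \<Omega>'" using openE[OF \<Omega>'(1,2)] by blast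
  define r where "r = min (min r1 r2) r3"
  have r: "r > 0" using r1 r2 r3 by (simp add: r_def)
  have Rr: "R holo_on ball 0 r" and Gr: "G holo_on ball 0 r"
    using R G by (auto intro: holo_on_subset simp: r_def)
  have ext: "R (emb y) = \<rho> y" "G (emb y) = ?u y" "y \<in> \<Omega>'" if "emb y \<in> ball 0 r" for y
    using that ext Gext[of y] r3(2) norm_le_norm_emb[of y] by (auto simp: r_def subset_iff)
  note Rd = holo_on_dird[OF Rr open_ball] and Gd = holo_on_dird[OF Gr open_ball]
  \<comment> \<open>First integrals give these equations on the totally real subspace; the identity
    theorem carries them to the doubled space at the price of half the radius.\<close>
  have cr: "cr_wrt (range zbar_dir) R (ball 0 (r/2)) G"
    unfolding cr_wrt_def
  proof (intro ballI)
    fix e e' p :: "(complex^'n) \<times> (complex^'n)" assume "e \<in> range zbar_dir" "e' \<in> range zbar_dir" and p: "p \<in> ball 0 (r/2)"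
    then obtain j k where jk: "e = zbar_dir j" "e' = zbar_dir k" by blast
    let ?\<Phi> = "\<lambda>p. dird (zbar_dir j) G p * dird (zbar_dir k) R p - dird (zbar_dir k) G p * dird (zbar_dir j) R p"
    have "?\<Phi> p = 0"
    proof (rule holo_on_vanishing_on_emb[OF _ _ p])
      show "?\<Phi> holo_on ball 0 r" by (intro holo_on_diff holo_on_mult Rd Gd)
      fix z :: "complex^'n" assume z: "emb z \<in> ball 0 r"
      have dR: "(\<rho> has_derivative (\<lambda>v. dird (emb v) R (emb z))) (at z)" by (rule ext_has_derivative[OF Rr ext(1) z])
      have dG: "(?u has_derivative (\<lambda>v. dird (emb v) G (emb z))) (at z)" by (rule ext_has_derivative[OF Gr ext(2) z])
      have "dzbar j ?u z * dzbar k \<rho> z = dzbar k ?u z * dzbar j \<rho> z"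
        by (rule first_integral_imp_cr[OF \<Omega>'(1) ra' fi ext(3)[OF z]]) (rule differentiableI[OF dG])
      then show "?\<Phi> (emb z) = 0"
        unfolding wirtinger_of_ext(2)[OF Rr z dR] wirtinger_of_ext(2)[OF Gr z dG] by simp
    qed
    then show "dird e G p * dird e' R p = dird e' G p * dird e R p" by (simp add: jk)
  qed
  have half: "r / 2 > 0" "ball 0 (r/2) \<subseteq> ball (0::(complex^'n) \<times> (complex^'n)) r" using r by auto
  obtain i j a b where ab: "zbar_form A B i a = 1" "zbar_form A B j a = 0" "zbar_form A B i b = 0" "zbar_form A B j b = 1"
    by (rule zbar_forms_independent[OF B rank])
  obtain s s' F where s: "s > 0" "s' > 0" and F: "F holo_on ball (0 :: 'n cspace) s'"
    and FG: "\<forall>p\<in>ball 0 s. (fst p, R p) \<in> ball 0 s' \<and> F (fst p, R p) = G p"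
    by (rule cr_function_extension[OF half(1) holo_on_subset[OF Rr half(2)] holo_on_subset[OF Gr half(2)] R0(1) cr,
        of i a j b]) (simp_all add: R0 R2 ab)
  define t where "t = min s r"
  have t: "t > 0" using s r by (simp add: t_def)
  have Rt: "R holo_on ball 0 t" using Rr by (rule holo_on_subset) (auto simp: t_def)
  have V: "(fst p, R p) \<in> ball 0 s'" if "p \<in> ball 0 t" for p using FG that by (auto simp: t_def)
  have FR: "F (y, R (emb y)) = ?u y" if y: "emb y \<in> ball 0 t" for y
  proof -
    have "emb y \<in> ball 0 s" using y by (simp add: t_def)
    then have "F (fst (emb y), R (emb y)) = G (emb y)" using FG by blast
    then show ?thesis using ext(2)[of y] y by (simp add: emb_def t_def)
  qed
  have "F (y, R (emb y)) \<in> \<real>" if "emb y \<in> ball 0 t" for y using FR[OF that] by simp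
  then have "second_derivatives_vanish ?u 0 \<longleftrightarrow> dird (0, 1) F 0 = 0"
    by (intro second_derivatives_vanish_iff[OF F open_ball Rt t V R0(1) R0(2)[rule_format] R2[rule_format] B rank _ FR[symmetric]])
  then have Fw: "dird (0, 1) F 0 \<noteq> 0" using nv by blast
  have cFw: "continuous_on (ball 0 s') (dird (0, 1) F)"
    by (rule holo_on_imp_continuous_on[OF holo_on_dird[OF F open_ball]])
  \<comment> \<open>The first factor makes dF nonzero throughout U; the second confines z to the
    neighbourhood where F equals g on the graph.\<close>
  define U where "U = (ball 0 s' \<inter> dird (0, 1) F -` (- {0})) \<inter> {p. emb (fst p) \<in> ball 0 t}"
  have "open (ball 0 s' \<inter> dird (0, 1) F -` (- {0}))"
    by (rule continuous_open_preimage[OF cFw open_ball]) (simp add: open_Compl)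
  moreover have "open {p :: 'n cspace. emb (fst p) \<in> ball 0 t}"
    by (intro open_vimage[unfolded vimage_def] open_ball bounded_linear.continuous_on[OF bounded_linear_emb] continuous_intros)
  ultimately have "open U" unfolding U_def by (rule open_Int)
  moreover have "0 \<in> U" using s(2) Fw t by (simp add: U_def emb_simps)
  moreover have FU: "F holo_on U" by (rule holo_on_subset[OF F]) (auto simp: U_def)
  moreover have "frechet_derivative F (at p) \<noteq> (\<lambda>v. 0)" if p: "p \<in> U" for p
  proof
    assume "frechet_derivative F (at p) = (\<lambda>v. 0)"
    then have "dird (0, 1) F p = 0"
      using frechet_derivative_at[OF holo_on_has_derivative(1)[OF FU p]] by metis
    then show False using p by (simp add: U_def)
  qed
  moreover have "F p \<in> \<real>" if p: "p \<in> graph_over \<rho> \<Omega> \<inter> U" for p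
  proof -
    obtain z where z: "p = (z, \<rho> z)" "emb z \<in> ball 0 t" using p by (auto simp: graph_over_def U_def)
    then have "F p = F (z, R (emb z))" using ext(1)[of z] by (simp add: t_def)
    then show ?thesis using FR[OF z(2)] by simp
  qed
  ultimately show ?thesis
    unfolding flattenable_def holomorphic_sev_iff_holo_on by blast
qed

end

theorem corollary6p1:
  fixes \<Omega> :: "(complex^'n::finite) set"
    and \<rho> E :: "complex^'n \<Rightarrow> complex"
    and A B C :: "complex^'n^'n"
  assumes "open \<Omega>" and "0 \<in> \<Omega>"
    and "real_analytic_on \<rho> \<Omega>"
    and "\<And>z. z \<in> \<Omega> \<Longrightarrow>
           \<rho> z = sesq_form A z + cnj (bilin_form B z) + bilin_form C z + E z"
    and "transpose B = B" and "transpose C = C"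
    and "E \<in> O[nhds 0](\<lambda>z. complex_of_real (norm z ^ 3))"
    and "rank (stack (conj_transpose A) B) \<ge> 2"
  shows "flattenable (graph_over \<rho> \<Omega>) \<longleftrightarrow>
    (\<exists>\<Omega>' g. open \<Omega>' \<and> 0 \<in> \<Omega>' \<and> \<Omega>' \<subseteq> \<Omega> \<and>
       real_analytic_on (\<lambda>z. g (z, \<rho> z)) \<Omega>' \<and>
       \<not> g constant_on (graph_over \<rho> \<Omega>') \<and>
       first_integral (graph_over \<rho> \<Omega>') g \<and>
       \<not> second_derivatives_vanish (\<lambda>z. complex_of_real (g (z, \<rho> z))) 0)"
proof
  assume f: "flattenable (graph_over \<rho> \<Omega>)"
  show "\<exists>\<Omega>' g. open \<Omega>' \<and> 0 \<in> \<Omega>' \<and> \<Omega>' \<subseteq> \<Omega> \<and>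
       real_analytic_on (\<lambda>z. g (z, \<rho> z)) \<Omega>' \<and>
       \<not> g constant_on (graph_over \<rho> \<Omega>') \<and>
       first_integral (graph_over \<rho> \<Omega>') g \<and>
       \<not> second_derivatives_vanish (\<lambda>z. complex_of_real (g (z, \<rho> z))) 0"
    by (rule flattenable_imp_first_integral[OF assms(1-5,7,8) f])
next
  assume "\<exists>\<Omega>' g. open \<Omega>' \<and> 0 \<in> \<Omega>' \<and> \<Omega>' \<subseteq> \<Omega> \<and>
       real_analytic_on (\<lambda>z. g (z, \<rho> z)) \<Omega>' \<and>
       \<not> g constant_on (graph_over \<rho> \<Omega>') \<and>
       first_integral (graph_over \<rho> \<Omega>') g \<and>
       \<not> second_derivatives_vanish (\<lambda>z. complex_of_real (g (z, \<rho> z))) 0"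
  then obtain \<Omega>' g where g: "open \<Omega>'" "0 \<in> \<Omega>'" "\<Omega>' \<subseteq> \<Omega>" "real_analytic_on (\<lambda>z. g (z, \<rho> z)) \<Omega>'"
    "first_integral (graph_over \<rho> \<Omega>') g" "\<not> second_derivatives_vanish (\<lambda>z. complex_of_real (g (z, \<rho> z))) 0"
    by blast
  show "flattenable (graph_over \<rho> \<Omega>)"
    by (rule first_integral_imp_flattenable[OF assms(1-5,7,8) g])
qed

end
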